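(* Let $\Delta$ be a thick polar space of finite rank $n\ge3$. Then $\Delta$ is Moufang.
   Context: A point-line geometry is a set of points with a set of lines (subsets of the point set). Points $x,y$ on a common line are collinear, $x\perp y$ (each point is collinear to itself); $x^\perp$ is the set of points collinear to $x$. A (non-degenerate) polar space is a point-line geometry in which every line has at least three points and, for every point $x$, $x^\perp$ is a proper subspace (closed under lines meeting it in at least two points, not everything) meeting every line. Singular subspaces are subspaces of pairwise collinear points. Rank $n$: maximal singular subspaces are projective spaces of dimension $n-1$. Thick: every singular subspace of dimension $n-2$ is contained in at least three maximal singular subspaces. A collineation is a permutation of the points inducing a permutation of the lines. A polar frame is a set of $2n$ points $p_{-n},\dots,p_{-1},p_1,\dots,p_n$ with $p_i\perp p_j$ if and only if $i+j\ne0$. The corresponding apartment $\mathcal A$ is the set of all singular subspaces spanned by points of the frame. A root $\alpha$ of the first kind is obtained by choosing a frame point $p_i$ and removing from $\mathcal A$ all members containing $p_i$; its interior $\alpha^+$ consists of the members of $\mathcal A$ containing $p_{-i}$. A root $\alpha$ of the second kind is obtained by choosing two distinct collinear frame points $p_i,p_j$ and removing every member of $\mathcal A$ that contains $p_i$ or $p_j$ and is contained in a maximal member of $\mathcal A$ containing both; its interior $\alpha^+$ consists of the members of $\mathcal A$ that contain at least one of $p_{-i},p_{-j}$ and neither $p_i$ nor $p_j$. $\Delta$ is Moufang if for every root $\alpha$ (of either kind) the group of collineations of $\Delta$ that fix every point of every member of $\alpha^+$ and stabilize every singular subspace incident with (containing or contained in) some member of $\alpha^+$ acts transitively on the set of apartments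 containing $\alpha$. *)

theory Defs
  imports Main "HOL-Combinatorics.Permutations"
begin

record 'a geometry =
  points :: "'a set"
  lines :: "'a set set"

definition point_line_geometry :: "'a geometry \<Rightarrow> bool" where
  "point_line_geometry \<Delta> \<longleftrightarrow> (\<forall>l\<in>lines \<Delta>. l \<subseteq> points \<Delta>)"

definition collinear :: "'a geometry \<Rightarrow> 'a \<Rightarrow> 'a \<Rightarrow> bool" where
  "collinear \<Delta> x y \<longleftrightarrow> x \<in> points \<Delta> \<and> y \<in> points \<Delta> \<and>
     (x = y \<or> (\<exists>l\<in>lines \<Delta>. x \<in> l \<and> y \<in> l))"

definition perp :: "'a geometry \<Rightarrow> 'a \<Rightarrow> 'a set" where
  "perp \<Delta> x = {y. collinear \<Delta> x y}"

definition subspace :: "'a geometry \<Rightarrow> 'a set \<Rightarrow> bool" where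
  "subspace \<Delta> S \<longleftrightarrow> S \<subseteq> points \<Delta> \<and>
     (\<forall>l\<in>lines \<Delta>. (\<exists>x\<in>l \<inter> S. \<exists>y\<in>l \<inter> S. x \<noteq> y) \<longrightarrow> l \<subseteq> S)"

definition span :: "'a geometry \<Rightarrow> 'a set \<Rightarrow> 'a set" where
  "span \<Delta> X = \<Inter> {S. subspace \<Delta> S \<and> X \<subseteq> S}"

definition three_pointed_lines :: "'a geometry \<Rightarrow> bool" where
  "three_pointed_lines \<Delta> \<longleftrightarrow>
     (\<forall>l\<in>lines \<Delta>. \<exists>x\<in>l. \<exists>y\<in>l. \<exists>z\<in>l. x \<noteq> y \<and> x \<noteq> z \<and> y \<noteq> z)"

definition polar_space :: "'a geometry \<Rightarrow> bool" where
  "polar_space \<Delta> \<longleftrightarrow> point_line_geometry \<Delta> \<and> three_pointed_lines \<Delta> \<and>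
     (\<forall>x\<in>points \<Delta>. subspace \<Delta> (perp \<Delta> x) \<and> perp \<Delta> x \<noteq> points \<Delta> \<and>
        (\<forall>l\<in>lines \<Delta>. perp \<Delta> x \<inter> l \<noteq> {}))"

definition singular_subspace :: "'a geometry \<Rightarrow> 'a set \<Rightarrow> bool" where
  "singular_subspace \<Delta> U \<longleftrightarrow> subspace \<Delta> U \<and> (\<forall>x\<in>U. \<forall>y\<in>U. collinear \<Delta> x y)"

definition maximal_singular_subspace :: "'a geometry \<Rightarrow> 'a set \<Rightarrow> bool" where
  "maximal_singular_subspace \<Delta> M \<longleftrightarrow> singular_subspace \<Delta> M \<and>
     (\<forall>U. singular_subspace \<Delta> U \<longrightarrow> M \<subseteq> U \<longrightarrow> U = M)"

text \<open>The last condition is the Veblen-Young axiom: two lines \<open>m\<close>, \<open>m'\<close> that both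
  meet each of two lines \<open>l\<close>, \<open>l'\<close> through a point \<open>p\<close>, but away from \<open>p\<close>, meet each
  other. The empty geometry and a single point without lines are projective spaces.\<close>

definition projective_space :: "'a geometry \<Rightarrow> bool" where
  "projective_space \<Delta> \<longleftrightarrow> point_line_geometry \<Delta> \<and> three_pointed_lines \<Delta> \<and>
     (\<forall>x\<in>points \<Delta>. \<forall>y\<in>points \<Delta>. x \<noteq> y \<longrightarrow> (\<exists>!l. l \<in> lines \<Delta> \<and> x \<in> l \<and> y \<in> l)) \<and>
     (\<forall>l\<in>lines \<Delta>. \<forall>l'\<in>lines \<Delta>. \<forall>m\<in>lines \<Delta>. \<forall>m'\<in>lines \<Delta>. \<forall>p.
        l \<noteq> l' \<and> p \<in> l \<and> p \<in> l' \<and> p \<notin> m \<and> p \<notin> m' \<and>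
        m \<inter> l \<noteq> {} \<and> m \<inter> l' \<noteq> {} \<and> m' \<inter> l \<noteq> {} \<and> m' \<inter> l' \<noteq> {} \<longrightarrow> m \<inter> m' \<noteq> {})"

definition basis_of :: "'a geometry \<Rightarrow> 'a set \<Rightarrow> bool" where
  "basis_of \<Delta> B \<longleftrightarrow> B \<subseteq> points \<Delta> \<and> span \<Delta> B = points \<Delta> \<and>
     (\<forall>b\<in>B. b \<notin> span \<Delta> (B - {b}))"

text \<open>Dimensions are projective, hence integers: the empty space has dimension \<open>-1\<close>
  and a point has dimension \<open>0\<close>.\<close>

definition projective_space_of_dim :: "'a geometry \<Rightarrow> int \<Rightarrow> bool" where
  "projective_space_of_dim \<Delta> d \<longleftrightarrow> projective_space \<Delta> \<and>
     (\<exists>B. finite B \<and> basis_of \<Delta> B \<and> int (card B) = d + 1)"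

definition induced :: "'a geometry \<Rightarrow> 'a set \<Rightarrow> 'a geometry" where
  "induced \<Delta> U = \<lparr>points = U, lines = {l \<in> lines \<Delta>. l \<subseteq> U}\<rparr>"

definition has_rank :: "'a geometry \<Rightarrow> nat \<Rightarrow> bool" where
  "has_rank \<Delta> n \<longleftrightarrow> (\<forall>M. maximal_singular_subspace \<Delta> M \<longrightarrow>
     projective_space_of_dim (induced \<Delta> M) (int n - 1))"

definition thick :: "'a geometry \<Rightarrow> nat \<Rightarrow> bool" where
  "thick \<Delta> n \<longleftrightarrow>
     (\<forall>U. singular_subspace \<Delta> U \<and> projective_space_of_dim (induced \<Delta> U) (int n - 2) \<longrightarrow>
        (\<exists>M1 M2 M3. M1 \<noteq> M2 \<and> M1 \<noteq> M3 \<and> M2 \<noteq> M3 \<and>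
           (\<forall>M\<in>{M1, M2, M3}. maximal_singular_subspace \<Delta> M \<and> U \<subseteq> M)))"

text \<open>Requiring \<open>g permutes points \<Delta>\<close> makes \<open>g\<close> the identity outside the carrier, so that
  these functions correspond one-to-one to permutations of the point set.\<close>

definition collineation :: "'a geometry \<Rightarrow> ('a \<Rightarrow> 'a) \<Rightarrow> bool" where
  "collineation \<Delta> g \<longleftrightarrow> g permutes points \<Delta> \<and> bij_betw ((`) g) (lines \<Delta>) (lines \<Delta>)"

definition frame_index :: "nat \<Rightarrow> int set" where
  "frame_index n = {- int n..int n} - {0}"

definition polar_frame :: "'a geometry \<Rightarrow> nat \<Rightarrow> (int \<Rightarrow> 'a) \<Rightarrow> bool" where
  "polar_frame \<Delta> n p \<longleftrightarrow> p ` frame_index n \<subseteq> points \<Delta> \<and> inj_on p (frame_index n) \<and>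
     (\<forall>i\<in>frame_index n. \<forall>j\<in>frame_index n. collinear \<Delta> (p i) (p j) \<longleftrightarrow> i + j \<noteq> 0)"

text \<open>Only nonempty subspaces are taken as members of an apartment.\<close>

definition apartment :: "'a geometry \<Rightarrow> nat \<Rightarrow> (int \<Rightarrow> 'a) \<Rightarrow> 'a set set" where
  "apartment \<Delta> n p =
     {U. singular_subspace \<Delta> U \<and> (\<exists>X. X \<noteq> {} \<and> X \<subseteq> p ` frame_index n \<and> U = span \<Delta> X)}"

definition apartments :: "'a geometry \<Rightarrow> nat \<Rightarrow> 'a set set set" where
  "apartments \<Delta> n = {apartment \<Delta> n p | p. polar_frame \<Delta> n p}"

definition maximal_member :: "'a set set \<Rightarrow> 'a set \<Rightarrow> bool" where
  "maximal_member A M \<longleftrightarrow> M \<in> A \<and> (\<forall>U\<in>A. M \<subseteq> U \<longrightarrow> U = M)"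

definition root1 :: "'a geometry \<Rightarrow> nat \<Rightarrow> (int \<Rightarrow> 'a) \<Rightarrow> int \<Rightarrow> 'a set set" where
  "root1 \<Delta> n p i = apartment \<Delta> n p - {U. p i \<in> U}"

definition interior1 :: "'a geometry \<Rightarrow> nat \<Rightarrow> (int \<Rightarrow> 'a) \<Rightarrow> int \<Rightarrow> 'a set set" where
  "interior1 \<Delta> n p i = {U \<in> apartment \<Delta> n p. p (- i) \<in> U}"

definition root2 :: "'a geometry \<Rightarrow> nat \<Rightarrow> (int \<Rightarrow> 'a) \<Rightarrow> int \<Rightarrow> int \<Rightarrow> 'a set set" where
  "root2 \<Delta> n p i j = apartment \<Delta> n p -
     {U. (p i \<in> U \<or> p j \<in> U) \<and>
         (\<exists>M. maximal_member (apartment \<Delta> n p) M \<and> p i \<in> M \<and> p j \<in> M \<and> U \<subseteq> M)}"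

definition interior2 :: "'a geometry \<Rightarrow> nat \<Rightarrow> (int \<Rightarrow> 'a) \<Rightarrow> int \<Rightarrow> int \<Rightarrow> 'a set set" where
  "interior2 \<Delta> n p i j =
     {U \<in> apartment \<Delta> n p. (p (- i) \<in> U \<or> p (- j) \<in> U) \<and> p i \<notin> U \<and> p j \<notin> U}"

text \<open>\<open>root_with_interior \<Delta> n \<alpha> \<beta>\<close>: \<open>\<alpha>\<close> is a root, of either kind, with interior \<open>\<beta>\<close>.\<close>

definition root_with_interior ::
  "'a geometry \<Rightarrow> nat \<Rightarrow> 'a set set \<Rightarrow> 'a set set \<Rightarrow> bool" where
  "root_with_interior \<Delta> n \<alpha> \<beta> \<longleftrightarrow>
     (\<exists>p. polar_frame \<Delta> n p \<and>
        ((\<exists>i\<in>frame_index n. \<alpha> = root1 \<Delta> n p i \<and> \<beta> = interior1 \<Delta> n p i) \<or>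
         (\<exists>i\<in>frame_index n. \<exists>j\<in>frame_index n. p i \<noteq> p j \<and> collinear \<Delta> (p i) (p j) \<and>
            \<alpha> = root2 \<Delta> n p i j \<and> \<beta> = interior2 \<Delta> n p i j)))"

definition root_group :: "'a geometry \<Rightarrow> 'a set set \<Rightarrow> ('a \<Rightarrow> 'a) set" where
  "root_group \<Delta> \<beta> = {g. collineation \<Delta> g \<and>
     (\<forall>U\<in>\<beta>. \<forall>x\<in>U. g x = x) \<and>
     (\<forall>W. singular_subspace \<Delta> W \<and> (\<exists>U\<in>\<beta>. U \<subseteq> W \<or> W \<subseteq> U) \<longrightarrow> g ` W = W)}"

text \<open>A collineation \<open>g\<close> sends the apartment \<open>A\<close> to \<open>(`) g ` A\<close>. Elements of a root
  group stabilize each member of the root, so they permute the apartments containing it.\<close>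

definition moufang :: "'a geometry \<Rightarrow> nat \<Rightarrow> bool" where
  "moufang \<Delta> n \<longleftrightarrow> (\<forall>\<alpha> \<beta>. root_with_interior \<Delta> n \<alpha> \<beta> \<longrightarrow>
     (\<forall>A\<in>apartments \<Delta> n. \<forall>B\<in>apartments \<Delta> n. \<alpha> \<subseteq> A \<and> \<alpha> \<subseteq> B \<longrightarrow>
        (\<exists>g\<in>root_group \<Delta> \<beta>. (`) g ` A = B)))"

end

theory Submission
  imports Defs
begin

text \<open>
  A collineation with center \<open>u\<close> is determined by what it does on the cone \<open>u\<^sup>\<bottom>\<close> and on one point
  \<open>a\<close> opposite \<open>u\<close>. Conversely, a permutation \<open>g\<close> of \<open>u\<^sup>\<bottom>\<close> that fixes every line through \<open>u\<close>,
  preserves lines and maps the section \<open>u\<^sup>\<bottom> \<inter> a\<^sup>\<bottom>\<close> onto \<open>u\<^sup>\<bottom> \<inter> b\<^sup>\<bottom>\<close> extends to a collineation with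
  \<open>a \<mapsto> b\<close>: paths of points opposite \<open>u\<close> are lifted, and closed paths decompose into triangles.
  Such a \<open>g\<close> exists for all \<open>a\<close> and \<open>b\<close> opposite \<open>u\<close>. In each plane through \<open>u\<close> it is an elation
  with center \<open>u\<close>, obtained as a composition of dualities between opposite planes, and elations
  of different planes through a line agree on that line as soon as they agree at one point.

  For a root of the first kind take \<open>u = p\<^sub>-\<^sub>i\<close>. For a root of the second kind take \<open>u = p\<^sub>-\<^sub>i\<close>
  again, with \<open>a\<close> and \<open>b\<close> on the line \<open>p\<^sub>i p\<^sub>-\<^sub>j\<close>; then \<open>{p\<^sub>-\<^sub>i, p\<^sub>-\<^sub>j}\<^sup>\<bottom>\<close> is fixed pointwise, and
  connectedness shows that \<open>p\<^sub>-\<^sub>j\<close> is a center as well.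
\<close>

section \<open>Lines and singular subspaces\<close>

text \<open>Everything is built from collinearity alone; no coordinates and no classification are
  available. Rank at least 3 puts a plane on every line. Hence the common perp of two opposite
  points is rich enough for its part outside a further perp to be connected, and this connectedness
  drives both the lifting of paths and the proof of the second center. Thickness is used twice: a
  second maximal singular subspace through a hyperplane yields a point collinear to a prescribed
  singular subspace and opposite a prescribed point off it; a third one yields a point opposite two
  prescribed opposite points. Two obstacles shape the construction. Paths of length two from
  \<open>a\<close> outside the cone of \<open>u\<close> do not reach every point, so exceptional
  points need separate treatment. And a single duality between planes turns points into lines, so
  elations need an even number of them; the auxiliary planes are placed so that the effect on a line
  through \<open>u\<close> does not depend on the plane, since otherwise the elations could not be
  glued to one map of the cone.\<close>

locale thick_polar_space =
  fixes \<Delta> :: "'a geometry" and n :: nat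
  assumes polar: "polar_space \<Delta>" and rank: "has_rank \<Delta> n"
    and thick: "thick \<Delta> n" and n_ge_3: "n \<ge> 3"
begin

abbreviation "P \<equiv> points \<Delta>"
abbreviation "L \<equiv> lines \<Delta>"
abbreviation "co \<equiv> collinear \<Delta>"
abbreviation "sing \<equiv> singular_subspace \<Delta>"
abbreviation "msing \<equiv> maximal_singular_subspace \<Delta>"

definition opp :: "'a \<Rightarrow> 'a \<Rightarrow> bool" where
  "opp x y \<longleftrightarrow> x \<in> P \<and> y \<in> P \<and> \<not> co x y"

definition ln :: "'a \<Rightarrow> 'a \<Rightarrow> 'a set" where
  "ln x y = (THE l. l \<in> L \<and> x \<in> l \<and> y \<in> l)"

text \<open>Meant for \<open>x\<close> outside a subspace \<open>W\<close> and collinear to all of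
  it. For \<open>x\<close> in \<open>W\<close> the meaningless \<open>ln x x\<close> would enter,
  hence the recurring premise \<open>x \<notin> W\<close>.\<close>

definition join :: "'a \<Rightarrow> 'a set \<Rightarrow> 'a set" where
  "join x W = insert x (\<Union>w\<in>W. ln x w)"

definition perps :: "'a set \<Rightarrow> 'a set" where
  "perps X = {y \<in> P. \<forall>x\<in>X. co x y}"

definition clique :: "'a set \<Rightarrow> bool" where
  "clique X \<longleftrightarrow> (\<forall>x\<in>X. \<forall>y\<in>X. co x y)"

lemma line_P: "l \<in> L \<Longrightarrow> x \<in> l \<Longrightarrow> x \<in> P"
  using polar unfolding polar_space_def point_line_geometry_def by blast

lemma co_P: "co x y \<Longrightarrow> x \<in> P" "co x y \<Longrightarrow> y \<in> P"
  unfolding collinear_def by auto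

lemma co_refl: "x \<in> P \<Longrightarrow> co x x"
  unfolding collinear_def by auto

lemma co_sym: "co x y \<Longrightarrow> co y x"
  unfolding collinear_def by auto

lemma line_co: "l \<in> L \<Longrightarrow> x \<in> l \<Longrightarrow> y \<in> l \<Longrightarrow> co x y"
  using line_P unfolding collinear_def by blast

lemma oppD: "opp x y \<Longrightarrow> x \<in> P" "opp x y \<Longrightarrow> y \<in> P" "opp x y \<Longrightarrow> \<not> co x y"
    "opp x y \<Longrightarrow> \<not> co y x" "opp x y \<Longrightarrow> x \<noteq> y" "opp x y \<Longrightarrow> opp y x"
  unfolding opp_def using co_refl co_sym by blast+

lemma perp_subspace: "x \<in> P \<Longrightarrow> subspace \<Delta> (perp \<Delta> x)"
  using polar unfolding polar_space_def by blast

lemma perp_line: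
  assumes "l \<in> L" "x \<in> l" "y \<in> l" "x \<noteq> y" "co p x" "co p y" "z \<in> l"
  shows "co p z"
proof -
  have "subspace \<Delta> (perp \<Delta> p)" using perp_subspace co_P assms by blast
  moreover have "x \<in> l \<inter> perp \<Delta> p" "y \<in> l \<inter> perp \<Delta> p" using assms unfolding perp_def by auto
  ultimately have "l \<subseteq> perp \<Delta> p" using assms unfolding subspace_def perp_def by blast
  then show ?thesis using assms unfolding perp_def by blast
qed

lemma perp_meets: "p \<in> P \<Longrightarrow> l \<in> L \<Longrightarrow> \<exists>z\<in>l. co p z"
  using polar unfolding polar_space_def perp_def by blast

lemma ex_opp: "p \<in> P \<Longrightarrow> \<exists>q. opp p q"
proof -
  assume p: "p \<in> P"
  then have "perp \<Delta> p \<noteq> P" using polar unfolding polar_space_def by blast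
  moreover have "perp \<Delta> p \<subseteq> P" unfolding perp_def using co_P by blast
  ultimately show ?thesis using p unfolding perp_def opp_def by blast
qed

lemma third_point: "l \<in> L \<Longrightarrow> \<exists>z\<in>l. z \<noteq> x \<and> z \<noteq> y"
proof -
  assume l: "l \<in> L"
  have "three_pointed_lines \<Delta>" using polar unfolding polar_space_def by blast
  then obtain a b c where "a \<in> l" "b \<in> l" "c \<in> l" "a \<noteq> b" "a \<noteq> c" "b \<noteq> c"
    using l unfolding three_pointed_lines_def by meson
  then show ?thesis by metis
qed

lemma subspaceI:
  assumes "S \<subseteq> P"
    and "\<And>l x y z. l \<in> L \<Longrightarrow> x \<in> l \<Longrightarrow> y \<in> l \<Longrightarrow> x \<in> S \<Longrightarrow> y \<in> S \<Longrightarrow> x \<noteq> y \<Longrightarrow> z \<in> l \<Longrightarrow> z \<in> S"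
  shows "subspace \<Delta> S"
  unfolding subspace_def
proof (intro conjI ballI impI)
  show "S \<subseteq> P" by (rule assms(1))
next
  fix l assume l: "l \<in> L" and "\<exists>x\<in>l \<inter> S. \<exists>y\<in>l \<inter> S. x \<noteq> y"
  then obtain x y where "x \<in> l" "y \<in> l" "x \<in> S" "y \<in> S" "x \<noteq> y" by blast
  then show "l \<subseteq> S" using assms(2)[OF l] by blast
qed

lemma subspaceD:
  assumes "subspace \<Delta> S" "l \<in> L" "x \<in> l" "y \<in> l" "x \<in> S" "y \<in> S" "x \<noteq> y" "z \<in> l"
  shows "z \<in> S"
proof -
  have "x \<in> l \<inter> S" "y \<in> l \<inter> S" using assms by auto
  then have "l \<subseteq> S" using assms unfolding subspace_def by blast
  then show ?thesis using assms by blast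
qed

lemma perps_subspace: "subspace \<Delta> (perps X)"
proof (rule subspaceI)
  show "perps X \<subseteq> P" unfolding perps_def by blast
next
  fix l x y z assume "l \<in> L" "x \<in> l" "y \<in> l" "x \<in> perps X" "y \<in> perps X" "x \<noteq> y" "z \<in> l"
  then show "z \<in> perps X"
    unfolding perps_def using perp_line line_P by blast
qed

lemma subspace_Int:
  assumes "subspace \<Delta> S" "subspace \<Delta> T" shows "subspace \<Delta> (S \<inter> T)"
proof (rule subspaceI)
  show "S \<inter> T \<subseteq> P" using assms(1) unfolding subspace_def by blast
next
  fix l x y z assume "l \<in> L" "x \<in> l" "y \<in> l" "x \<in> S \<inter> T" "y \<in> S \<inter> T" "x \<noteq> y" "z \<in> l"
  then show "z \<in> S \<inter> T"
    using subspaceD[OF assms(1), of l x y z] subspaceD[OF assms(2), of l x y z] by blast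
qed

lemma span_subset: "X \<subseteq> span \<Delta> X"
  unfolding span_def by blast

lemma span_least: "subspace \<Delta> S \<Longrightarrow> X \<subseteq> S \<Longrightarrow> span \<Delta> X \<subseteq> S"
  unfolding span_def by blast

lemma P_subspace: "subspace \<Delta> P"
  unfolding subspace_def using line_P by blast

lemma span_is_subspace: "X \<subseteq> P \<Longrightarrow> subspace \<Delta> (span \<Delta> X)"
proof (rule subspaceI)
  assume "X \<subseteq> P"
  then show "span \<Delta> X \<subseteq> P" using span_least P_subspace by blast
next
  fix l x y z assume *: "l \<in> L" "x \<in> l" "y \<in> l" "x \<in> span \<Delta> X" "y \<in> span \<Delta> X" "x \<noteq> y" "z \<in> l"
  show "z \<in> span \<Delta> X" unfolding span_def
  proof safe
    fix S assume "subspace \<Delta> S" "X \<subseteq> S"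
    then show "z \<in> S" using * subspaceD[of S l x y z] unfolding span_def by blast
  qed
qed

lemma clique_P: "clique X \<Longrightarrow> X \<subseteq> P"
  unfolding clique_def using co_P by blast

lemma span_perps: "X \<subseteq> perps Y \<Longrightarrow> span \<Delta> X \<subseteq> perps Y"
  using span_least perps_subspace by blast

text \<open>\<open>X\<close> lies in its own perp, and perps are subspaces, so the span lies in the
  perp of \<open>X\<close>. Reading this from the other side, \<open>X\<close> lies in the perp of
  the span, and a second round makes the span perpendicular to itself.\<close>

lemma clique_span: "clique X \<Longrightarrow> clique (span \<Delta> X)"
proof -
  assume c: "clique X"
  have "X \<subseteq> perps X" using c clique_P unfolding perps_def clique_def by blast
  then have "span \<Delta> X \<subseteq> perps X" by (rule span_perps)
  then have "X \<subseteq> perps (span \<Delta> X)" using clique_P[OF c] co_sym unfolding perps_def by blast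
  then have "span \<Delta> X \<subseteq> perps (span \<Delta> X)" by (rule span_perps)
  then show ?thesis unfolding clique_def perps_def by blast
qed

lemma sing_iff: "sing U \<longleftrightarrow> subspace \<Delta> U \<and> clique U"
  unfolding singular_subspace_def clique_def by simp

lemma sing_span: "clique X \<Longrightarrow> sing (span \<Delta> X)"
  using clique_span span_is_subspace clique_P sing_iff by blast

lemma sing_subspace: "sing U \<Longrightarrow> subspace \<Delta> U"
  using sing_iff by blast

lemma sing_co: "sing U \<Longrightarrow> x \<in> U \<Longrightarrow> y \<in> U \<Longrightarrow> co x y"
  using sing_iff clique_def by blast

lemma sing_P: "sing U \<Longrightarrow> x \<in> U \<Longrightarrow> x \<in> P"
  using sing_co co_P by blast

section \<open>Maximal singular subspaces\<close>

lemma chain_subspace: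
  assumes "C \<noteq> {}" "\<And>U. U \<in> C \<Longrightarrow> subspace \<Delta> U" "\<And>U V. U \<in> C \<Longrightarrow> V \<in> C \<Longrightarrow> U \<subseteq> V \<or> V \<subseteq> U"
  shows "subspace \<Delta> (\<Union>C)"
proof (rule subspaceI)
  show "\<Union>C \<subseteq> P" using assms(2) unfolding subspace_def by blast
next
  fix l x y z assume *: "l \<in> L" "x \<in> l" "y \<in> l" "x \<in> \<Union>C" "y \<in> \<Union>C" "x \<noteq> y" "z \<in> l"
  then obtain U V where "U \<in> C" "V \<in> C" "x \<in> U" "y \<in> V" by blast
  then obtain W where W: "W \<in> C" "x \<in> W" "y \<in> W" using assms(3) by blast
  then show "z \<in> \<Union>C" using subspaceD[of W l x y z] assms(2) * by blast
qed

text \<open>One form of Zorn's lemma for three uses: singular subspaces, subspaces of a maximal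
  singular subspace that miss a point, and singular subspaces inside a common perp. Only
  \<open>Q\<close> has to be checked on chains.\<close>

lemma maximal_subspace_Zorn:
  assumes "Q U0" "subspace \<Delta> U0"
    and "\<And>C. C \<noteq> {} \<Longrightarrow> (\<And>U. U \<in> C \<Longrightarrow> Q U) \<Longrightarrow>
      (\<And>U V. U \<in> C \<Longrightarrow> V \<in> C \<Longrightarrow> U \<subseteq> V \<or> V \<subseteq> U) \<Longrightarrow> Q (\<Union>C)"
  obtains M where "Q M" "subspace \<Delta> M" "U0 \<subseteq> M"
    "\<And>U. Q U \<Longrightarrow> subspace \<Delta> U \<Longrightarrow> M \<subseteq> U \<Longrightarrow> U = M"
proof -
  let ?A = "{U. Q U \<and> subspace \<Delta> U \<and> U0 \<subseteq> U}"
  have "\<exists>M\<in>?A. \<forall>X\<in>?A. M \<subseteq> X \<longrightarrow> X = M"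
  proof (rule subset_Zorn_nonempty)
    show "?A \<noteq> {}" using assms by blast
  next
    fix C assume C: "C \<noteq> {}" "subset.chain ?A C"
    then have sub: "C \<subseteq> ?A" and ch: "\<And>U V. U \<in> C \<Longrightarrow> V \<in> C \<Longrightarrow> U \<subseteq> V \<or> V \<subseteq> U"
      unfolding subset.chain_def by blast+
    have "Q (\<Union>C)" using assms(3)[of C] C(1) sub ch by blast
    moreover have "subspace \<Delta> (\<Union>C)" using chain_subspace C(1) sub ch by blast
    moreover have "U0 \<subseteq> \<Union>C" using sub C(1) by blast
    ultimately show "\<Union>C \<in> ?A" by blast
  qed
  then obtain M where M: "M \<in> ?A" "\<forall>X\<in>?A. M \<subseteq> X \<longrightarrow> X = M" by (rule bexE)
  show ?thesis
  proof (rule that[of M])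
    fix U assume U: "Q U" "subspace \<Delta> U" "M \<subseteq> U"
    then have "U \<in> ?A" using M(1) by auto
    then show "U = M" using M(2) U(3) by blast
  qed (use M(1) in auto)
qed

lemma chain_clique:
  assumes "\<And>U. U \<in> C \<Longrightarrow> clique U" "\<And>U V. U \<in> C \<Longrightarrow> V \<in> C \<Longrightarrow> U \<subseteq> V \<or> V \<subseteq> U"
  shows "clique (\<Union>C)"
  using assms unfolding clique_def by (metis (no_types, lifting) UnionE subsetD)

lemma ex_msing:
  assumes "clique X" obtains M where "msing M" "X \<subseteq> M"
proof -
  obtain M where M: "clique M" "subspace \<Delta> M" "span \<Delta> X \<subseteq> M"
      "\<And>U. clique U \<Longrightarrow> subspace \<Delta> U \<Longrightarrow> M \<subseteq> U \<Longrightarrow> U = M"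
    by (rule maximal_subspace_Zorn[of clique "span \<Delta> X"])
      (use assms clique_span span_is_subspace clique_P chain_clique in auto)
  then have "msing M" unfolding maximal_singular_subspace_def sing_iff by blast
  then show ?thesis using that M(3) span_subset by blast
qed

lemma msing_sing: "msing M \<Longrightarrow> sing M"
  unfolding maximal_singular_subspace_def by blast

lemma msing_eq: "msing M \<Longrightarrow> sing U \<Longrightarrow> M \<subseteq> U \<Longrightarrow> U = M"
  unfolding maximal_singular_subspace_def by blast

lemma msing_absorb:
  assumes "msing M" "\<And>x. x \<in> M \<Longrightarrow> co t x" "t \<in> P"
  shows "t \<in> M"
proof -
  have "clique (insert t M)"
    unfolding clique_def using assms co_sym co_refl sing_co[OF msing_sing] by blast
  then have "sing (span \<Delta> (insert t M))" by (rule sing_span)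
  moreover have "insert t M \<subseteq> span \<Delta> (insert t M)" by (rule span_subset)
  ultimately show ?thesis using msing_eq[OF assms(1)] by blast
qed

section \<open>Uniqueness of lines, Veblen's axiom and joins\<close>

lemma msing_projective: "msing M \<Longrightarrow> projective_space (induced \<Delta> M)"
  using rank unfolding has_rank_def projective_space_of_dim_def by blast

text \<open>The polar space axioms do not state this. Two collinear points lie in a maximal singular
  subspace, which the rank hypothesis makes a projective space, and every line through both points
  lies in it.\<close>

lemma line_unique:
  assumes "l \<in> L" "l' \<in> L" "x \<in> l" "y \<in> l" "x \<in> l'" "y \<in> l'" "x \<noteq> y"
  shows "l = l'"
proof -
  have "clique {x, y}" unfolding clique_def using line_co assms by blast
  then obtain M where M: "msing M" "{x, y} \<subseteq> M" by (rule ex_msing)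
  have "\<exists>!l. l \<in> lines (induced \<Delta> M) \<and> x \<in> l \<and> y \<in> l"
    using msing_projective[OF M(1)] M(2) assms(7)
    unfolding projective_space_def by (simp add: induced_def)
  moreover have "k \<in> lines (induced \<Delta> M)" if "k \<in> L" "x \<in> k" "y \<in> k" for k
  proof -
    have "k \<subseteq> M" using that M(2) subspaceD[OF sing_subspace[OF msing_sing[OF M(1)]], of k x y] assms(7)
      by blast
    then show ?thesis using that unfolding induced_def by simp
  qed
  ultimately show ?thesis using assms by metis
qed

text \<open>Inherited from a maximal singular subspace through \<open>l\<close> and
  \<open>l'\<close>. A line that meets both away from \<open>p\<close> meets them in distinct
  points, so it lies in that subspace as well.\<close>

lemma veblen:
  assumes "l \<in> L" "l' \<in> L" "m \<in> L" "m' \<in> L" "clique (l \<union> l')" "l \<noteq> l'" "p \<in> l" "p \<in> l'"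
    "p \<notin> m" "p \<notin> m'" "m \<inter> l \<noteq> {}" "m \<inter> l' \<noteq> {}" "m' \<inter> l \<noteq> {}" "m' \<inter> l' \<noteq> {}"
  shows "m \<inter> m' \<noteq> {}"
proof -
  obtain M where M: "msing M" "l \<union> l' \<subseteq> M" using ex_msing[OF assms(5)] by blast
  have sub: "k \<subseteq> M" if k: "k \<in> L" "p \<notin> k" "k \<inter> l \<noteq> {}" "k \<inter> l' \<noteq> {}" for k
  proof -
    obtain x y where xy: "x \<in> k" "x \<in> l" "y \<in> k" "y \<in> l'" using k by blast
    have "x \<noteq> y" using xy line_unique[of l l' p x] assms k by metis
    then show ?thesis using subspaceD[OF sing_subspace[OF msing_sing[OF M(1)]], of k x y] k xy M by blast
  qed
  have "\<forall>l\<in>lines (induced \<Delta> M). \<forall>l'\<in>lines (induced \<Delta> M). \<forall>m\<in>lines (induced \<Delta> M).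
        \<forall>m'\<in>lines (induced \<Delta> M). \<forall>p.
        l \<noteq> l' \<and> p \<in> l \<and> p \<in> l' \<and> p \<notin> m \<and> p \<notin> m' \<and>
        m \<inter> l \<noteq> {} \<and> m \<inter> l' \<noteq> {} \<and> m' \<inter> l \<noteq> {} \<and> m' \<inter> l' \<noteq> {} \<longrightarrow> m \<inter> m' \<noteq> {}"
    using msing_projective[OF M(1)] unfolding projective_space_def by blast
  moreover have "l \<in> lines (induced \<Delta> M)" "l' \<in> lines (induced \<Delta> M)" "m \<in> lines (induced \<Delta> M)"
      "m' \<in> lines (induced \<Delta> M)"
    using sub[of m] sub[of m'] M(2) assms unfolding induced_def by auto
  ultimately show ?thesis using assms by blast
qed

lemma ln_props:
  assumes "co x y" "x \<noteq> y" shows "ln x y \<in> L" "x \<in> ln x y" "y \<in> ln x y"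
proof -
  obtain l where "l \<in> L" "x \<in> l" "y \<in> l" using assms unfolding collinear_def by blast
  then have "\<exists>!l. l \<in> L \<and> x \<in> l \<and> y \<in> l" using line_unique assms(2) by blast
  then have "ln x y \<in> L \<and> x \<in> ln x y \<and> y \<in> ln x y" unfolding ln_def by (rule theI')
  then show "ln x y \<in> L" "x \<in> ln x y" "y \<in> ln x y" by auto
qed

lemma ln_eq: "l \<in> L \<Longrightarrow> x \<in> l \<Longrightarrow> y \<in> l \<Longrightarrow> x \<noteq> y \<Longrightarrow> ln x y = l"
  using ln_props line_unique line_co by metis

lemma ln_sym: "ln x y = ln y x"
  unfolding ln_def by meson

lemma ln_co: "co x y \<Longrightarrow> x \<noteq> y \<Longrightarrow> z \<in> ln x y \<Longrightarrow> w \<in> ln x y \<Longrightarrow> co z w"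
  using ln_props line_co by blast

lemma ln_move: "co x y \<Longrightarrow> x \<noteq> y \<Longrightarrow> z \<in> ln x y \<Longrightarrow> z \<noteq> x \<Longrightarrow> ln x z = ln x y"
  using ln_props ln_eq by metis

lemma ln_perp: "co x y \<Longrightarrow> x \<noteq> y \<Longrightarrow> co p x \<Longrightarrow> co p y \<Longrightarrow> z \<in> ln x y \<Longrightarrow> co p z"
  using perp_line ln_props by blast

lemma ln_sub: "subspace \<Delta> S \<Longrightarrow> x \<in> S \<Longrightarrow> y \<in> S \<Longrightarrow> co x y \<Longrightarrow> x \<noteq> y \<Longrightarrow> ln x y \<subseteq> S"
  using subspaceD ln_props by blast

lemma line_sing: "l \<in> L \<Longrightarrow> sing l"
  unfolding sing_iff clique_def
  using line_co line_unique line_P by (metis subspaceI subsetI)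

lemma point_sing: "x \<in> P \<Longrightarrow> sing {x}"
  unfolding sing_iff clique_def using co_refl by (auto intro: subspaceI)

text \<open>Two points of a line in a perp would put the whole line into it. Together with
  \<open>perp_meets\<close> this makes the projection of a point onto a line well defined.\<close>

lemma line_opp_unique:
  assumes "l \<in> L" "x \<in> l" "\<not> co p x" "y \<in> l" "z \<in> l" "co p y" "co p z" shows "y = z"
  using assms perp_line by metis

lemma join_memI: "w \<in> W \<Longrightarrow> y \<in> ln x w \<Longrightarrow> y \<in> join x W"
  unfolding join_def by blast

lemma join_self: "x \<in> join x W" unfolding join_def by blast

lemma join_memE:
  assumes "y \<in> join x W" "x \<notin> W" "\<And>w. w \<in> W \<Longrightarrow> co x w"
  obtains "y = x" | w where "w \<in> W" "y \<in> ln x w" "y \<noteq> x" "w \<noteq> x" "ln x w \<in> L" "ln x y = ln x w"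
  using assms unfolding join_def by (auto, metis ln_props(1,2) ln_eq)

lemma join_least: "subspace \<Delta> S \<Longrightarrow> x \<in> S \<Longrightarrow> W \<subseteq> S \<Longrightarrow> x \<notin> W \<Longrightarrow> (\<And>w. w \<in> W \<Longrightarrow> co x w) \<Longrightarrow> join x W \<subseteq> S"
  unfolding join_def using ln_sub by blast

lemma join_base: "x \<notin> W \<Longrightarrow> (\<And>w. w \<in> W \<Longrightarrow> co x w) \<Longrightarrow> W \<subseteq> join x W"
proof
  fix w assume "\<And>w. w \<in> W \<Longrightarrow> co x w" "x \<notin> W" "w \<in> W"
  then show "w \<in> join x W" using join_memI[of w W w x] ln_props(3)[of x w] by metis
qed

text \<open>Only a line \<open>k\<close> that misses \<open>x\<close> needs work. It cuts two lines
  from \<open>x\<close> to \<open>W\<close>, so by Veblen it meets the line through their feet; a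
  second use of the axiom shows that the line from \<open>x\<close> to a third point of
  \<open>k\<close> meets this line of \<open>W\<close>, too.\<close>

lemma join_subspace:
  assumes W: "sing W" and x: "x \<notin> W" "\<And>w. w \<in> W \<Longrightarrow> co x w" "x \<in> P"
  shows "sing (join x W)"
proof -
  have cliq: "clique (insert x W)" unfolding clique_def
    using W x co_sym co_refl sing_co by blast
  have sp: "sing (span \<Delta> (insert x W))" using cliq by (rule sing_span)
  have sub: "join x W \<subseteq> span \<Delta> (insert x W)"
    by (rule join_least) (use x sing_subspace[OF sp] span_subset[of "insert x W"] in auto)
  have cl: "co a b" if "a \<in> join x W" "b \<in> join x W" for a b
    using that sub sing_co[OF sp] by blast
  \<comment> \<open>The premise \<open>p1 \<noteq> w1\<close> keeps \<open>p1\<close> off the line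
    \<open>w1 w2\<close>, as the second use of \<open>veblen\<close>, with apex \<open>p1\<close>,
    demands. If it fails, \<open>p1\<close> and \<open>p2\<close> exchange roles, or both lie in
    \<open>W\<close>.\<close>
  have main: "p3 \<in> join x W"
    if k: "k \<in> L" "p1 \<in> k" "p2 \<in> k" "p1 \<noteq> p2" "p3 \<in> k" "p3 \<noteq> p1" "p3 \<noteq> p2" "x \<notin> k" "p1 \<noteq> w1"
      and w: "w1 \<in> W" "w2 \<in> W" "p1 \<in> ln x w1" "p2 \<in> ln x w2" for k p1 p2 p3 w1 w2
  proof -
    have kc: "k \<subseteq> span \<Delta> (insert x W)"
      using subspaceD[OF sing_subspace[OF sp], of k p1 p2] k sub
        join_memI[OF w(1,3)] join_memI[OF w(2,4)] by blast
    have l1: "ln x w1 \<in> L" "x \<in> ln x w1" "w1 \<in> ln x w1" using ln_props x w by metis+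
    have l2: "ln x w2 \<in> L" "x \<in> ln x w2" "w2 \<in> ln x w2" using ln_props x w by metis+
    have ne: "ln x w1 \<noteq> ln x w2" using line_unique[of k "ln x w1" p1 p2] k w l1 by metis
    have w12: "w1 \<noteq> w2" using ne by blast
    let ?m = "ln w1 w2"
    have m: "?m \<in> L" "w1 \<in> ?m" "w2 \<in> ?m" using ln_props w12 sing_co[OF W] w by metis+
    have mW: "?m \<subseteq> W" using ln_sub[OF sing_subspace[OF W]] w w12 sing_co[OF W] by blast
    have xm: "x \<notin> ?m" using mW x by blast
    have lspan: "ln x w1 \<subseteq> span \<Delta> (insert x W)" "ln x w2 \<subseteq> span \<Delta> (insert x W)"
      using sub join_memI w by blast+
    have "clique (ln x w1 \<union> ln x w2)" unfolding clique_def using lspan sing_co[OF sp] by blast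
    then have "k \<inter> ?m \<noteq> {}"
      using veblen[of "ln x w1" "ln x w2" k ?m x] l1 l2 m ne xm k w by blast
    then obtain r where r: "r \<in> k" "r \<in> ?m" by blast
    have p1m: "p1 \<notin> ?m" using line_unique[of ?m "ln x w1" p1 w1] m l1 w k xm by metis
    have xp3: "x \<noteq> p3" using k by blast
    have cx3: "co x p3" using kc sing_co[OF sp] k span_subset by blast
    have lx: "ln x p3 \<in> L" "x \<in> ln x p3" "p3 \<in> ln x p3" using ln_props cx3 xp3 by metis+
    have p1x: "p1 \<notin> ln x p3" using line_unique[of "ln x p3" k p1 p3] lx k by metis
    have kne: "ln x w1 \<noteq> k" using l1 k by blast
    have cl2: "clique (ln x w1 \<union> k)" unfolding clique_def using lspan kc sing_co[OF sp] by blast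
    have "ln x p3 \<inter> ?m \<noteq> {}"
      using veblen[of "ln x w1" k "ln x p3" ?m p1] l1 k lx m kne cl2 p1m p1x r w by blast
    then obtain s where s: "s \<in> ln x p3" "s \<in> ?m" by blast
    have "s \<noteq> x" using s xm by blast
    then have "ln x s = ln x p3" using ln_eq lx s by metis
    then show ?thesis using join_memI[of s W p3 x] s mW lx by blast
  qed
  have "subspace \<Delta> (join x W)"
  proof (rule subspaceI)
    show "join x W \<subseteq> P" using cl co_P by blast
  next
    fix k p1 p2 p3 assume k: "k \<in> L" "p1 \<in> k" "p2 \<in> k" "p1 \<in> join x W" "p2 \<in> join x W"
      "p1 \<noteq> p2" "p3 \<in> k"
    have thru: "p3 \<in> join x W" if q: "q \<in> k" "q \<in> join x W" "q \<noteq> x" "x \<in> k" for q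
    proof -
      obtain w where "w \<in> W" "ln x q = ln x w" using join_memE[OF q(2) x(1,2)] q by metis
      then show ?thesis using join_memI[of w W p3 x] ln_eq[of k x q] k q by metis
    qed
    show "p3 \<in> join x W"
    proof (cases "x \<in> k \<or> p3 = p1 \<or> p3 = p2")
      case True then show ?thesis using thru k by metis
    next
      case False
      obtain w1 where w1: "w1 \<in> W" "p1 \<in> ln x w1" using join_memE[OF k(4) x(1,2)] False k by metis
      obtain w2 where w2: "w2 \<in> W" "p2 \<in> ln x w2" using join_memE[OF k(5) x(1,2)] False k by metis
      consider "p1 \<noteq> w1" | "p2 \<noteq> w2" | "p1 = w1" "p2 = w2" by blast
      then show ?thesis
      proof cases
        case 1 then show ?thesis using main[of k p1 p2 p3 w1 w2] k False w1 w2 by blast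
      next
        case 2 then show ?thesis using main[of k p2 p1 p3 w2 w1] k False w1 w2 by blast
      next
        case 3
        then have "p3 \<in> W" using subspaceD[OF sing_subspace[OF W]] k w1 w2 by blast
        then show ?thesis using join_base x by blast
      qed
    qed
  qed
  then show ?thesis using cl unfolding sing_iff clique_def by blast
qed

end

section \<open>Hyperplanes of maximal singular subspaces\<close>

context thick_polar_space
begin

lemma induced_subspace:
  assumes "subspace \<Delta> U"
  shows "subspace (induced \<Delta> U) S \<longleftrightarrow> subspace \<Delta> S \<and> S \<subseteq> U"
proof
  assume S: "subspace (induced \<Delta> U) S"
  then have SU: "S \<subseteq> U" unfolding subspace_def induced_def by simp
  have "subspace \<Delta> S"
  proof (rule subspaceI)
    show "S \<subseteq> P" using SU assms unfolding subspace_def by blast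
  next
    fix l x y z assume *: "l \<in> L" "x \<in> l" "y \<in> l" "x \<in> S" "y \<in> S" "x \<noteq> y" "z \<in> l"
    have "l \<subseteq> U" using subspaceD[OF assms, of l x y] * SU by blast
    then have "l \<in> lines (induced \<Delta> U)" using * unfolding induced_def by simp
    moreover have "x \<in> l \<inter> S" "y \<in> l \<inter> S" using * by auto
    ultimately have "l \<subseteq> S" using S * unfolding subspace_def by blast
    then show "z \<in> S" using * by blast
  qed
  then show "subspace \<Delta> S \<and> S \<subseteq> U" using SU by blast
next
  assume S: "subspace \<Delta> S \<and> S \<subseteq> U"
  then show "subspace (induced \<Delta> U) S" unfolding subspace_def induced_def by auto
qed

lemma induced_span:
  assumes "subspace \<Delta> U" "X \<subseteq> U"
  shows "span (induced \<Delta> U) X = span \<Delta> X"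
proof
  show "span (induced \<Delta> U) X \<subseteq> span \<Delta> X"
  proof
    fix y assume y: "y \<in> span (induced \<Delta> U) X"
    show "y \<in> span \<Delta> X" unfolding span_def
    proof safe
      fix S assume "subspace \<Delta> S" "X \<subseteq> S"
      then have "subspace (induced \<Delta> U) (S \<inter> U)" "X \<subseteq> S \<inter> U"
        using induced_subspace[OF assms(1)] subspace_Int assms by auto
      then show "y \<in> S" using y unfolding span_def by blast
    qed
  qed
  show "span \<Delta> X \<subseteq> span (induced \<Delta> U) X"
    unfolding span_def[of "induced \<Delta> U"] induced_subspace[OF assms(1)]
    using span_least by blast
qed

lemma clique_subset: "clique X \<Longrightarrow> Y \<subseteq> X \<Longrightarrow> clique Y"
  unfolding clique_def by blast

lemma sing_clique: "sing U \<Longrightarrow> clique U"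
  using sing_iff by blast

lemma sing_projective:
  assumes U: "sing U" shows "projective_space (induced \<Delta> U)"
  unfolding projective_space_def
proof (intro conjI ballI impI allI)
  have lin: "lines (induced \<Delta> U) = {l \<in> L. l \<subseteq> U}" and pt: "points (induced \<Delta> U) = U"
    unfolding induced_def by auto
  show "point_line_geometry (induced \<Delta> U)" unfolding point_line_geometry_def lin pt by blast
  show "three_pointed_lines (induced \<Delta> U)"
    using polar unfolding three_pointed_lines_def polar_space_def lin by blast
  fix x y assume xy: "x \<in> points (induced \<Delta> U)" "y \<in> points (induced \<Delta> U)" "x \<noteq> y"
  then have "co x y" using sing_co U pt by blast
  moreover have "ln x y \<subseteq> U" using ln_sub[OF sing_subspace[OF U]] xy calculation pt by blast
  ultimately show "\<exists>!l. l \<in> lines (induced \<Delta> U) \<and> x \<in> l \<and> y \<in> l"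
    using ln_props[of x y] ln_eq[of _ x y] xy lin by blast
next
  fix l l' m m' p
  assume l: "l \<in> lines (induced \<Delta> U)" "l' \<in> lines (induced \<Delta> U)" "m \<in> lines (induced \<Delta> U)"
    "m' \<in> lines (induced \<Delta> U)" and
    *: "l \<noteq> l' \<and> p \<in> l \<and> p \<in> l' \<and> p \<notin> m \<and> p \<notin> m' \<and>
          m \<inter> l \<noteq> {} \<and> m \<inter> l' \<noteq> {} \<and> m' \<inter> l \<noteq> {} \<and> m' \<inter> l' \<noteq> {}"
  have "clique (l \<union> l')" using l clique_subset[OF sing_clique[OF U], of "l \<union> l'"] unfolding induced_def by simp
  then show "m \<inter> m' \<noteq> {}"
    using veblen[of l l' m m' p] l * unfolding induced_def by simp
qed

lemma msing_basis:
  assumes "msing M"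
  obtains B where "finite B" "card B = n" "B \<subseteq> M" "span \<Delta> B = M"
    "\<And>b. b \<in> B \<Longrightarrow> b \<notin> span \<Delta> (B - {b})"
proof -
  obtain B where B: "finite B" "basis_of (induced \<Delta> M) B" "int (card B) = int n - 1 + 1"
    using rank assms unfolding has_rank_def projective_space_of_dim_def by blast
  have sub: "subspace \<Delta> M" using assms msing_sing sing_subspace by blast
  have BM: "B \<subseteq> M" using B(2) unfolding basis_of_def induced_def by simp
  have sp: "span (induced \<Delta> M) X = span \<Delta> X" if "X \<subseteq> B" for X
    using induced_span[OF sub] that BM by blast
  show ?thesis
  proof (rule that[OF B(1) _ BM])
    show "card B = n" using B(3) by simp
    show "span \<Delta> B = M" using B(2) sp unfolding basis_of_def induced_def by simp
    show "\<And>b. b \<in> B \<Longrightarrow> b \<notin> span \<Delta> (B - {b})"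
      using B(2) sp[of "B - {_}"] unfolding basis_of_def by blast
  qed
qed

text \<open>A basis of the hyperplane \<open>U\<close> arises by projecting the points of a basis of \<open>M\<close>
  from one that lies outside \<open>U\<close>.\<close>

lemma hyperplane_dim:
  assumes M: "msing M" and U: "sing U" "U \<subseteq> M" and a: "a \<in> M" "a \<notin> U" "M \<subseteq> join a U"
  shows "projective_space_of_dim (induced \<Delta> U) (int n - 2)"
proof -
  obtain B where B: "finite B" "card B = n" "B \<subseteq> M" "span \<Delta> B = M"
    "\<And>b. b \<in> B \<Longrightarrow> b \<notin> span \<Delta> (B - {b})" using msing_basis[OF M] by blast
  have sM: "sing M" using M msing_sing by blast
  have coM: "co x y" if "x \<in> M" "y \<in> M" for x y using sing_co[OF sM] that .
  have spS: "sing (span \<Delta> X)" if "X \<subseteq> M" for X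
    using sing_span clique_subset[OF sing_clique[OF sM]] that by blast
  obtain b0 where b0: "b0 \<in> B" "b0 \<notin> U"
    using span_least[OF sing_subspace[OF U(1)], of B] B(4) a by blast
  have b0M: "b0 \<in> M" using b0 B by blast
  have cob: "co b0 w" if "w \<in> U" for w using coM b0M U that by blast
  have sJ: "sing (join b0 U)" using join_subspace[OF U(1) b0(2)] cob co_P by (metis sing_P sM b0M)
  have "a \<in> join b0 U"
  proof (cases "a = b0")
    case True then show ?thesis using join_self by simp
  next
    case False
    have "b0 \<in> join a U" using a(3) b0M by blast
    then obtain w where w: "w \<in> U" "b0 \<in> ln a w" "ln a b0 = ln a w"
      using join_memE[of b0 a U] a False U(2) coM by (metis subsetD)
    have "a \<in> ln a w" using w ln_props(2)[of a b0] False coM a b0M by metis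
    moreover have "ln b0 w = ln a w"
      using ln_eq[of "ln a w" b0 w] ln_props[of a w] w a(2) coM a(1) U(2) b0(2) by (metis subsetD)
    ultimately show ?thesis using join_memI[of w U a b0] w by simp
  qed
  then have MJ: "M \<subseteq> join b0 U"
    using join_least[OF sing_subspace[OF sJ], of a U] join_base[of b0 U] b0 cob a coM U by blast
  have "\<forall>b\<in>B - {b0}. \<exists>w. w \<in> U \<and> b \<in> ln b0 w \<and> ln b0 b = ln b0 w"
  proof
    fix b assume b: "b \<in> B - {b0}"
    then have "b \<in> join b0 U" using MJ B by blast
    then show "\<exists>w. w \<in> U \<and> b \<in> ln b0 w \<and> ln b0 b = ln b0 w"
      using join_memE[of b b0 U] b0 cob b by (metis Diff_iff insertI1)
  qed
  then obtain f where f: "\<And>b. b \<in> B - {b0} \<Longrightarrow> f b \<in> U \<and> b \<in> ln b0 (f b) \<and> ln b0 b = ln b0 (f b)"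
    using bchoice[of "B - {b0}"] by (metis (no_types, lifting))
  have fb: "f b \<in> ln b0 b" "f b \<noteq> b0" if "b \<in> B - {b0}" for b
    using f[OF that] b0 ln_props(3)[of b0 "f b"] cob by metis+
  let ?C = "f ` (B - {b0})"
  have inj: "inj_on f (B - {b0})"
  proof (rule inj_onI, rule ccontr)
    fix b b' assume *: "b \<in> B - {b0}" "b' \<in> B - {b0}" "f b = f b'" "b \<noteq> b'"
    have "b' \<in> ln b0 b" using * f by metis
    moreover have "ln b0 b \<subseteq> span \<Delta> (B - {b'})"
    proof (rule ln_sub)
      show "subspace \<Delta> (span \<Delta> (B - {b'}))" using spS sing_subspace B(3) by blast
      show "b0 \<in> span \<Delta> (B - {b'})" "b \<in> span \<Delta> (B - {b'})"
        using span_subset[of "B - {b'}"] * b0 by blast+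
      show "co b0 b" "b0 \<noteq> b" using * coM B(3) b0M by blast+
    qed
    ultimately show False using B(5)[of b'] * by blast
  qed
  have CU: "?C \<subseteq> U" using f by blast
  have spC: "span \<Delta> ?C = U"
  proof
    show "span \<Delta> ?C \<subseteq> U" using span_least sing_subspace U(1) CU by blast
    have sS: "sing (span \<Delta> ?C)" using spS CU U by blast
    have SU: "span \<Delta> ?C \<subseteq> U" using span_least sing_subspace U(1) CU by blast
    have nS: "b0 \<notin> span \<Delta> ?C" and cS: "\<And>w. w \<in> span \<Delta> ?C \<Longrightarrow> co b0 w" using SU b0 cob by blast+
    have sJ: "sing (join b0 (span \<Delta> ?C))" using join_subspace[OF sS nS cS] b0M sing_P sM by blast
    have "b \<in> join b0 (span \<Delta> ?C)" if "b \<in> B" for b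
    proof (cases "b = b0")
      case True then show ?thesis using join_self by simp
    next
      case False
      then have "f b \<in> span \<Delta> ?C" using span_subset[of ?C] that by blast
      then show ?thesis using join_memI[of "f b" _ b b0] f[of b] False that by blast
    qed
    then have MJ': "M \<subseteq> join b0 (span \<Delta> ?C)" using span_least sing_subspace sJ B(4) by blast
    show "U \<subseteq> span \<Delta> ?C"
    proof
      fix u assume u: "u \<in> U"
      then have "u \<in> join b0 (span \<Delta> ?C)" using MJ' U by blast
      then obtain w where w: "w \<in> span \<Delta> ?C" "u \<in> ln b0 w"
        using join_memE[OF _ nS cS] u b0 by metis
      show "u \<in> span \<Delta> ?C"
      proof (rule ccontr)
        assume n: "u \<notin> span \<Delta> ?C"
        have lb: "ln b0 w \<in> L" "b0 \<in> ln b0 w" "w \<in> ln b0 w" using ln_props[of b0 w] w nS cS by blast+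
        have "b0 \<in> U" by (rule subspaceD[OF sing_subspace[OF U(1)], of "ln b0 w" u w])
            (use lb w u n SU in auto)
        then show False using b0 by blast
      qed
    qed
  qed
  have ind: "c \<notin> span \<Delta> (?C - {c})" if c: "c \<in> ?C" for c
  proof
    assume in_span: "c \<in> span \<Delta> (?C - {c})"
    obtain b where b: "b \<in> B - {b0}" "c = f b" using c by blast
    let ?T = "span \<Delta> (B - {b})"
    have sT: "sing ?T" using spS B(3) by blast
    have b0T: "b0 \<in> ?T" using span_subset[of "B - {b}"] b b0 by blast
    have "?C - {c} \<subseteq> ?T"
    proof
      fix d assume "d \<in> ?C - {c}"
      then obtain b2 where b2: "b2 \<in> B - {b0}" "d = f b2" "b2 \<noteq> b" using b by blast
      have "b2 \<in> ?T" using span_subset[of "B - {b}"] b2 by blast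
      then have "ln b0 b2 \<subseteq> ?T" using ln_sub[OF sing_subspace[OF sT] b0T] sing_co[OF sT b0T] b2 by blast
      then show "d \<in> ?T" using fb b2 by blast
    qed
    then have "c \<in> ?T" using in_span span_least[OF sing_subspace[OF sT]] by blast
    then have "ln b0 c \<subseteq> ?T"
      using ln_sub[OF sing_subspace[OF sT] b0T] sing_co[OF sT b0T] fb(2)[OF b(1)] b(2) by metis
    then have "b \<in> ?T" using f[OF b(1)] b(2) by blast
    then show False using B(5) b by blast
  qed
  have "card ?C = n - 1" using inj B b0 by (simp add: card_image)
  then have "int (card ?C) = int n - 2 + 1" using n_ge_3 by simp
  moreover have "basis_of (induced \<Delta> U) ?C"
  proof -
    have "span (induced \<Delta> U) X = span \<Delta> X" if "X \<subseteq> ?C" for X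
      using induced_span[OF sing_subspace[OF U(1)]] that CU by blast
    then show ?thesis unfolding basis_of_def using CU spC ind by (simp add: induced_def)
  qed
  moreover have "finite ?C" using B(1) by simp
  ultimately show ?thesis unfolding projective_space_of_dim_def
    by (intro conjI sing_projective[OF U(1)] exI[of _ ?C])
qed

text \<open>Rank at least 3 becomes geometric here: a maximal singular subspace through
  \<open>l\<close> has a basis of at least three points, whereas two points of a line already
  generate it, so that \<open>l\<close> has no such basis.\<close>

lemma ex_coplanar:
  assumes l: "l \<in> L" obtains f where "f \<in> P" "f \<notin> l" "\<And>y. y \<in> l \<Longrightarrow> co f y"
proof -
  obtain M where M: "msing M" "l \<subseteq> M" using ex_msing sing_clique line_sing l by blast
  obtain B where B: "finite B" "card B = n" "B \<subseteq> M" "span \<Delta> B = M"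
    "\<And>b. b \<in> B \<Longrightarrow> b \<notin> span \<Delta> (B - {b})" using msing_basis[OF M(1)] by blast
  have "M \<noteq> l"
  proof
    assume Ml: "M = l"
    obtain b1 where b1: "b1 \<in> B" using B n_ge_3 by fastforce
    have "card (B - {b1}) \<ge> 2" using B b1 n_ge_3 by simp
    then have "B - {b1} \<noteq> {}" by (intro notI) simp
    then obtain b2 where b2: "b2 \<in> B - {b1}" by blast
    have "card (B - {b1} - {b2}) \<ge> 1" using \<open>card (B - {b1}) \<ge> 2\<close> b2 B by simp
    then have "B - {b1} - {b2} \<noteq> {}" by (intro notI) simp
    then obtain b3 where b3: "b3 \<in> B - {b1} - {b2}" by blast
    have sub: "subspace \<Delta> (span \<Delta> (B - {b1}))" 
      by (rule sing_subspace[OF sing_span[OF clique_subset[OF sing_clique[OF msing_sing[OF M(1)]]]]]) (use B(3) in blast)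
    have "b1 \<in> span \<Delta> (B - {b1})"
      by (rule subspaceD[OF sub, of l b2 b3])
        (use l b1 b2 b3 Ml B(3) span_subset[of "B - {b1}"] in auto)
    then show False using B(5) b1 by blast
  qed
  then obtain f where f: "f \<in> M" "f \<notin> l" using M by blast
  then show ?thesis using that[of f] sing_co[OF msing_sing[OF M(1)]] sing_P[OF msing_sing[OF M(1)]] M(2) by blast
qed

lemma ex_neighbour:
  assumes x: "x \<in> P" obtains y where "co x y" "y \<noteq> x"
proof -
  have "clique {x}" using x co_refl unfolding clique_def by blast
  then obtain M where M: "msing M" "{x} \<subseteq> M" by (rule ex_msing)
  obtain B where B: "finite B" "card B = n" "B \<subseteq> M" using msing_basis[OF M(1)] by blast
  have "M \<noteq> {x}"
  proof
    assume "M = {x}"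
    then have "card B \<le> 1" using card_mono[of "{x}" B] B by simp
    then show False using n_ge_3 B by simp
  qed
  then obtain y where "y \<in> M" "y \<noteq> x" using M by blast
  then show ?thesis using that[of y] sing_co[OF msing_sing[OF M(1)]] M(2) by blast
qed

text \<open>Thickness in the form in which it is applied: hyperplanes are recognised as
  \<open>M \<subseteq> join a U\<close> instead of by dimension, and of three maximal singular
  subspaces through \<open>U\<close> one differs from both \<open>M\<close> and an arbitrary
  \<open>M'\<close>.\<close>

lemma thick_hyperplane:
  assumes "msing M" "sing U" "U \<subseteq> M" "a \<in> M" "a \<notin> U" "M \<subseteq> join a U"
  obtains N where "msing N" "U \<subseteq> N" "N \<noteq> M" "N \<noteq> M'"
proof -
  have "projective_space_of_dim (induced \<Delta> U) (int n - 2)" by (rule hyperplane_dim[OF assms])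
  with assms(2) have "\<exists>M1 M2 M3. M1 \<noteq> M2 \<and> M1 \<noteq> M3 \<and> M2 \<noteq> M3 \<and>
      (\<forall>M\<in>{M1, M2, M3}. msing M \<and> U \<subseteq> M)"
    using thick[unfolded thick_def, THEN spec, of U] by (elim mp) (rule conjI)
  then obtain M1 M2 M3 where M: "M1 \<noteq> M2" "M1 \<noteq> M3" "M2 \<noteq> M3"
      "\<forall>M\<in>{M1, M2, M3}. msing M \<and> U \<subseteq> M"
    by (elim exE conjE)
  have "\<exists>N\<in>{M1, M2, M3}. N \<noteq> M \<and> N \<noteq> M'" using M(1-3) by auto
  then show ?thesis using M(4) that by blast
qed

lemma hyperplane_swap:
  assumes "sing M" "sing H" "H \<subseteq> M" "a \<in> M" "M \<subseteq> join a H" "a \<notin> H" "x \<in> M" "x \<notin> H"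
  shows "M \<subseteq> join x H"
proof (cases "x = a")
  case True then show ?thesis using assms by blast
next
  case False
  have "x \<in> join a H" using assms by blast
  then obtain w where w: "w \<in> H" "x \<in> ln a w" "w \<noteq> a"
    using join_memE[of x a H] False assms sing_co[OF assms(1)] by (metis subsetD)
  have "co a w" using w assms sing_co[OF assms(1)] by blast
  then have "a \<in> ln x w" using ln_eq[of "ln a w" x w] ln_props[of a w] w assms by metis
  then have "a \<in> join x H" using join_memI[of w H a x] w by blast
  moreover have cx: "co x w" if "w \<in> H" for w using that assms sing_co[OF assms(1)] by blast
  moreover have "sing (join x H)" using join_subspace[of H x] assms cx sing_P by blast
  ultimately show ?thesis
    using join_least[OF sing_subspace, of "join x H" a H] join_base[of x H] assms sing_co[OF assms(1)] by blast
qed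

text \<open>If \<open>a\<close> is collinear to all of \<open>U\<close>, enlarge \<open>U\<close> to
  a hyperplane \<open>H\<close> of a maximal singular subspace through \<open>a\<close>, with
  \<open>a\<close> outside \<open>H\<close>. Another maximal \<open>N\<close> through
  \<open>H\<close> misses \<open>a\<close>, so by maximality it has a point not collinear to
  \<open>a\<close>. Otherwise a point of \<open>U\<close> itself will do. Most opposite points below
  come from this lemma.\<close>

lemma ex_perp_opp:
  assumes U: "sing U" and a: "a \<in> P" "a \<notin> U"
  obtains d where "\<And>u. u \<in> U \<Longrightarrow> co d u" "opp d a"
proof (cases "\<exists>u\<in>U. \<not> co u a")
  case True
  then show ?thesis using that U a sing_co sing_P unfolding opp_def by blast
next
  case False
  have "clique (insert a U)" unfolding clique_def using U False co_sym co_refl a(1) sing_co by blast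
  then obtain M where M: "msing M" "insert a U \<subseteq> M" by (rule ex_msing)
  have sM: "sing M" using M msing_sing by blast
  obtain H where H: "H \<subseteq> M \<and> a \<notin> H" "subspace \<Delta> H" "U \<subseteq> H"
      "\<And>V. V \<subseteq> M \<and> a \<notin> V \<Longrightarrow> subspace \<Delta> V \<Longrightarrow> H \<subseteq> V \<Longrightarrow> V = H"
    by (rule maximal_subspace_Zorn[of "\<lambda>H. H \<subseteq> M \<and> a \<notin> H" U])
      (use M a sing_subspace[OF U] in auto)
  have sH: "sing H" using H sM clique_subset unfolding sing_iff by blast
  have "M \<subseteq> join a H"
  proof
    fix x assume x: "x \<in> M"
    show "x \<in> join a H"
    proof (cases "x \<in> H")
      case True then show ?thesis using join_base[of a H] H(1) M sing_co[OF sM] by blast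
    next
      case False
      have cx: "\<And>w. w \<in> H \<Longrightarrow> co x w" using x H(1) sing_co[OF sM] by blast
      have sJ: "sing (join x H)" by (rule join_subspace[OF sH False cx sing_P[OF sM x]])
      have "join x H \<subseteq> M" by (rule join_least[OF sing_subspace[OF sM] x]) (use H(1) False cx in auto)
      moreover have "join x H \<noteq> H" using join_self[of x H] False by blast
      ultimately have "a \<in> join x H"
        using H(4)[of "join x H"] sing_subspace[OF sJ] join_base[OF False cx] by blast
      then show ?thesis
      proof (cases "a = x")
        case True then show ?thesis using join_self by simp
      next
        case ne: False
        with \<open>a \<in> join x H\<close> obtain w where w: "w \<in> H" "a \<in> ln x w" "w \<noteq> x"
          using join_memE[OF _ False cx] by metis
        have "x \<in> ln a w" using ln_eq[of "ln x w" a w] ln_props[of x w] w cx H(1) by metis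
        then show ?thesis using join_memI w by blast
      qed
    qed
  qed
  then obtain N where N: "msing N" "H \<subseteq> N" "N \<noteq> M"
    using thick_hyperplane[OF M(1) sH _ _ _ \<open>M \<subseteq> join a H\<close>] M(2) H(1) by (metis insert_subset)
  have aN: "a \<notin> N"
  proof
    assume "a \<in> N"
    have "join a H \<subseteq> N"
      by (rule join_least) (use N \<open>a \<in> N\<close> msing_sing sing_subspace H(1) sing_co[OF sM] M in auto)
    then show False using \<open>M \<subseteq> join a H\<close> msing_eq[OF M(1) msing_sing[OF N(1)]] N(3) by blast
  qed
  then obtain d where d: "d \<in> N" "\<not> co a d" using msing_absorb[OF N(1)] a(1) by blast
  then have "opp d a" using co_sym a(1) sing_P msing_sing N(1) unfolding opp_def by blast
  moreover have "co d u" if "u \<in> U" for u using that d N(2) H(3) sing_co[OF msing_sing[OF N(1)]] by blast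
  ultimately show ?thesis using that by blast
qed

text \<open>Let \<open>U\<close> be maximal among the singular subspaces of
  \<open>perps {m, z}\<close> that contain \<open>D\<close>. Its joins with \<open>m\<close> and
  with \<open>z\<close> are maximal singular, and the points outside \<open>U\<close> of a third
  maximal singular subspace through \<open>U\<close> are opposite both.\<close>

lemma ex_opp_opp:
  assumes D: "sing D" and m: "\<And>d. d \<in> D \<Longrightarrow> co m d" and z: "\<And>d. d \<in> D \<Longrightarrow> co z d" and mz: "opp m z"
  obtains t where "\<And>d. d \<in> D \<Longrightarrow> co t d" "opp t m" "opp t z"
proof -
  have Z1: "D \<subseteq> perps {m, z} \<and> clique D"
    using m z sing_clique D co_P unfolding perps_def by blast
  have Z2: "\<Union>C \<subseteq> perps {m, z} \<and> clique (\<Union>C)"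
    if "\<And>U. U \<in> C \<Longrightarrow> U \<subseteq> perps {m, z} \<and> clique U"
      "\<And>U V. U \<in> C \<Longrightarrow> V \<in> C \<Longrightarrow> U \<subseteq> V \<or> V \<subseteq> U" for C
    using that chain_clique[of C] by blast
  obtain U where U: "U \<subseteq> perps {m, z} \<and> clique U" "subspace \<Delta> U" "D \<subseteq> U"
      "\<And>V. V \<subseteq> perps {m, z} \<and> clique V \<Longrightarrow> subspace \<Delta> V \<Longrightarrow> U \<subseteq> V \<Longrightarrow> V = U"
  proof (rule maximal_subspace_Zorn[of "\<lambda>U. U \<subseteq> perps {m, z} \<and> clique U" D, OF Z1 sing_subspace[OF D] Z2], goal_cases)
    case (1 C) then show ?case by blast
  next
    case (2 C U V) then show ?case by blast
  next
    case (3 M) show ?case by (rule 3(1)[OF 3(2-5)])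
  qed
  have sU: "sing U" using U unfolding sing_iff by blast
  have cU: "co m w" "co z w" if "w \<in> U" for w using U(1) that unfolding perps_def by auto
  have mz': "m \<in> P" "z \<in> P" "\<not> co m z" "\<not> co z m" using mz oppD by blast+
  have nU: "m \<notin> U" "z \<notin> U" using cU mz' by blast+
  have sm: "sing (join m U)" and sz: "sing (join z U)"
    using join_subspace[OF sU] nU cU mz' by blast+
  \<comment> \<open>A larger singular subspace would contain some \<open>w\<close> off the join. The
    point of the line \<open>p w\<close> collinear to \<open>q\<close> lies in
    \<open>perps {p, q}\<close> and is collinear to \<open>U\<close>, so it belongs to
    \<open>U\<close> by maximality, and this puts \<open>w\<close> into the join.\<close>
  have max: "msing (join p U)"
    if p: "p \<in> P" "\<not> co p q" "q \<in> P" "p \<notin> U" and cp: "\<And>w. w \<in> U \<Longrightarrow> co p w"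
      and cq: "\<And>w. w \<in> U \<Longrightarrow> co q w"
      and pq: "perps {p, q} = perps {m, z}" for p q
  proof -
    have sJ: "sing (join p U)" using join_subspace[OF sU p(4) cp p(1)] .
    have "V = join p U" if V: "sing V" "join p U \<subseteq> V" for V
    proof (rule ccontr)
      assume "V \<noteq> join p U"
      then obtain w where w: "w \<in> V" "w \<notin> join p U" using V by blast
      have pV: "p \<in> V" "U \<subseteq> V" using join_self[of p U] join_base[OF p(4) cp] V by blast+
      have pw: "co p w" "p \<noteq> w" using sing_co V w pV join_self[of p U] by blast+
      obtain v where v: "v \<in> ln p w" "co q v" using perp_meets[of q] ln_props pw p by metis
      have vp: "v \<noteq> p" using v p co_sym by blast
      have vV: "v \<in> V" using ln_sub[OF sing_subspace[OF V(1)] pV(1) w(1) pw] v by blast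
      have "v \<in> perps {p, q}" using v pV vV sing_co[OF V(1)] co_P unfolding perps_def by blast
      then have vm: "v \<in> perps {m, z}" using pq by blast
      have cl: "clique (insert v U)"
        by (rule clique_subset[OF sing_clique[OF V(1)]]) (use vV pV in blast)
      have "insert v U \<subseteq> perps {m, z}" using vm U(1) by blast
      then have "span \<Delta> (insert v U) = U"
        using U(4)[of "span \<Delta> (insert v U)"] span_perps clique_span[OF cl] sing_subspace[OF sing_span[OF cl]]
          span_subset[of "insert v U"] by blast
      then have "v \<in> U" using span_subset[of "insert v U"] by blast
      moreover have "w \<in> ln p v" using ln_move[OF pw v(1) vp] ln_props(3)[OF pw] by simp
      ultimately show False using join_memI w(2) by blast
    qed
    then show ?thesis using sJ unfolding maximal_singular_subspace_def by blast
  qed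
  have Mm: "msing (join m U)" by (rule max[of m z]) (use mz' nU cU in auto)
  have Mz: "msing (join z U)" by (rule max[of z m]) (use mz' nU cU in \<open>auto simp: insert_commute\<close>)
  obtain N where N: "msing N" "U \<subseteq> N" "N \<noteq> join m U" "N \<noteq> join z U"
    using thick_hyperplane[OF Mm sU join_base[OF nU(1) cU(1)] join_self nU(1), of "join z U"] by blast
  have "N \<noteq> U" using msing_eq[OF N(1) sm] join_base[OF nU(1) cU(1)] N by blast
  then obtain t where t: "t \<in> N" "t \<notin> U" using N by blast
  have tP: "t \<in> P" using t sing_P msing_sing N by blast
  \<comment> \<open>If \<open>t\<close> were collinear to \<open>p\<close>, it would lie in
    \<open>join p U\<close>; exchanging \<open>p\<close> for \<open>t\<close> then shows that
    \<open>N\<close> contains this join, so both are equal.\<close>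
  have no: "\<not> co t p"
    if p: "p \<notin> U" "\<And>w. w \<in> U \<Longrightarrow> co p w" "msing (join p U)" "N \<noteq> join p U" for p
  proof
    assume tp: "co t p"
    have sp: "sing (join p U)" using p msing_sing by blast
    have "co t x" if "x \<in> join p U" for x
      using that
    proof (rule join_memE[OF _ p(1,2)])
      assume "x = p" then show ?thesis using tp by blast
    next
      fix w assume w: "w \<in> U" "x \<in> ln p w" "w \<noteq> p"
      then have "co t w" using t N(2) sing_co[OF msing_sing[OF N(1)]] by blast
      then show ?thesis using ln_perp[of p w t x] tp w p(2) by blast
    qed
    then have "t \<in> join p U" using msing_absorb[OF p(3)] tP by blast
    then have "join p U \<subseteq> join t U"
      using hyperplane_swap[OF sp sU join_base[OF p(1,2)] join_self _ p(1), of t] t by blast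
    moreover have "join t U \<subseteq> N"
      by (rule join_least) (use t N msing_sing sing_subspace sing_co in blast)+
    ultimately show False using msing_eq[OF p(3) msing_sing[OF N(1)]] p(4) by blast
  qed
  have "opp t m" "opp t z"
    using no[OF nU(1) cU(1) Mm N(3)] no[OF nU(2) cU(2) Mz N(4)] tP mz' unfolding opp_def by auto
  moreover have "co t d" if "d \<in> D" for d using that t U(3) N(2) sing_co[OF msing_sing[OF N(1)]] by blast
  ultimately show ?thesis using that by blast
qed

end

section \<open>Sections and planes\<close>

context thick_polar_space
begin

text \<open>Slides \<open>d\<close> along its line through \<open>x\<close> into the perp of
  \<open>x'\<close>. No point collinear to \<open>x\<close> can tell \<open>d\<close> from
  \<open>d'\<close>, so configurations around \<open>x\<close> can be moved into the section of
  \<open>x\<close> and \<open>x'\<close> with their collinearities and oppositions intact.\<close>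

lemma proj:
  assumes "co x d" "x \<noteq> d" "opp x x'"
  obtains d' where "d' \<in> ln x d" "co x' d'" "d' \<noteq> x" "co x d'" "d' \<in> P"
    "\<And>q. co q x \<Longrightarrow> co q d' \<longleftrightarrow> co q d"
proof -
  obtain d' where d': "d' \<in> ln x d" "co x' d'"
    using perp_meets ln_props(1)[OF assms(1,2)] oppD(2)[OF assms(3)] by blast
  have ne: "d' \<noteq> x" using d' oppD[OF assms(3)] by blast
  have c: "co x d'" using ln_co[OF assms(1,2) ln_props(2)[OF assms(1,2)] d'(1)] .
  have d: "d \<in> ln x d'" using ln_move[OF assms(1,2) d'(1) ne] ln_props(3)[OF assms(1,2)] by simp
  have "co q d' \<longleftrightarrow> co q d" if q: "co q x" for q
    using ln_perp[OF assms(1,2) q _ d'(1)] ln_perp[OF c ne[symmetric] q _ d] by blast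
  then show ?thesis using that d' ne c co_P by blast
qed

text \<open>Nondegeneracy of the section of two opposite points: a point collinear to
  \<open>u\<close> and opposite \<open>e\<close> is slid into the perp of \<open>w\<close>.\<close>

lemma section_separates:
  assumes "opp u w" "co u e" "co w e"
  obtains d where "co u d" "co w d" "\<not> co d e"
proof -
  have e: "e \<in> P" "e \<notin> {u}" using assms co_P oppD by blast+
  obtain d where d: "\<And>x. x \<in> {u} \<Longrightarrow> co d x" "opp d e"
    using ex_perp_opp[OF point_sing[OF oppD(1)[OF assms(1)]] e] by blast
  have ud: "co u d" using d co_sym by blast
  have "u \<noteq> d" using d(2) assms(2) oppD by blast
  then obtain d' where "co w d'" "co u d'" "\<And>q. co q u \<Longrightarrow> co q d' \<longleftrightarrow> co q d"
    using proj[OF ud _ assms(1)] by metis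
  then show ?thesis using that[of d'] d(2) assms(2) co_sym oppD(4) by blast
qed

text \<open>If \<open>c\<close> and \<open>c'\<close> are collinear, the line \<open>x c\<close>
  misses \<open>c'\<close>, so some point collinear to the whole line is opposite \<open>c'\<close>;
  it is then slid into the section. If they are not collinear, \<open>c\<close> itself
  serves.\<close>

lemma section_separates_in_perp:
  assumes "opp x a" "co x c" "co a c" "co x c'" "co a c'" "c \<noteq> c'"
  obtains y where "co x y" "co a y" "co c y" "\<not> co c' y"
proof (cases "co c c'")
  case False
  then show ?thesis using that[of c] assms co_refl co_P co_sym by blast
next
  case True
  have xc: "x \<noteq> c" using assms oppD by blast
  have n: "c' \<notin> ln x c"
  proof
    assume "c' \<in> ln x c"
    then show False
      using line_opp_unique[OF ln_props(1,2)[OF assms(2) xc], of a c c'] ln_props(3)[OF assms(2) xc]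
        assms oppD by blast
  qed
  obtain d where d: "\<And>y. y \<in> ln x c \<Longrightarrow> co d y" "opp d c'"
    using ex_perp_opp[OF line_sing[OF ln_props(1)[OF assms(2) xc]] co_P(2)[OF assms(4)] n] by blast
  have dx: "co x d" "co c d" using d(1) ln_props[OF assms(2) xc] co_sym by blast+
  have "x \<noteq> d" using d(2) assms(4) oppD by blast
  then obtain d' where "co a d'" "co x d'" "\<And>q. co q x \<Longrightarrow> co q d' \<longleftrightarrow> co q d"
    using proj[OF dx(1) _ assms(1)] by metis
  then show ?thesis using that[of d'] dx d(2) assms co_sym oppD(4) by blast
qed

text \<open>A point coplanar with the line \<open>x c\<close> is slid into the perp of
  \<open>x'\<close> and then into that of \<open>c'\<close>, which gives \<open>v\<close>. A point
  collinear to the line and opposite \<open>v\<close> is treated likewise and gives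
  \<open>v1\<close>; both slides keep it off the perp of \<open>v\<close>.\<close>

lemma quad:
  assumes x: "opp x x'" and c: "opp c c'"
    and co: "co x c" "co x' c" "co x c'" "co x' c'"
  obtains v v1 where "opp v v1" "co x v" "co x' v" "co c v" "co c' v"
    "co x v1" "co x' v1" "co c v1" "co c' v1"
proof -
  have xc: "x \<noteq> c" using co x oppD by blast
  note l = ln_props[OF co(1) xc]
  have cx: "co c x" using co co_sym by blast
  obtain f where f: "f \<in> P" "f \<notin> ln x c" "\<And>y. y \<in> ln x c \<Longrightarrow> co f y" using ex_coplanar[OF l(1)] by blast
  have fx: "co x f" "co c f" "x \<noteq> f" using f l co_sym by blast+
  obtain f' where f': "co x' f'" "f' \<noteq> x" "co x f'" "f' \<in> ln x f" "\<And>q. co q x \<Longrightarrow> co q f' \<longleftrightarrow> co q f"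
    using proj[OF fx(1,3) x] by blast
  have cf': "co c f'" using f'(5)[OF cx] fx by blast
  have "c \<noteq> f'" using ln_move[OF fx(1,3) f'(4,2)] ln_props(3)[OF fx(1,3)] f(2) by metis
  then obtain v where v: "co c' v" "v \<noteq> c" "co c v" "\<And>q. co q c \<Longrightarrow> co q v \<longleftrightarrow> co q f'"
    using proj[OF cf' _ c] by metis
  have xv: "co x v" "co x' v" using v(4) co f' by blast+
  have "v \<notin> ln x c"
    using line_opp_unique[OF l(1,2), of x' v c] l(3) xv co v(2) oppD[OF x] by blast
  then obtain d where d: "\<And>y. y \<in> ln x c \<Longrightarrow> co d y" "opp d v"
    using ex_perp_opp[OF line_sing[OF l(1)] co_P(2)[OF xv(1)]] by blast
  have dx: "co x d" "co c d" using d l co_sym by blast+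
  have "x \<noteq> d" using d(2) xv oppD by blast
  then obtain d' where d': "co x' d'" "co x d'" "\<And>q. co q x \<Longrightarrow> co q d' \<longleftrightarrow> co q d"
    using proj[OF dx(1) _ x] by metis
  have vd': "\<not> co v d'" using d'(3)[of v] xv co_sym d(2) oppD by blast
  have cd': "co c d'" using d'(3)[OF cx] dx by blast
  have "c \<noteq> d'" using vd' v co_sym by blast
  then obtain v1 where v1: "co c' v1" "co c v1" "\<And>q. co q c \<Longrightarrow> co q v1 \<longleftrightarrow> co q d'"
    using proj[OF cd' _ c] by metis
  have "co x v1" "co x' v1" using v1(3) co d' by blast+
  moreover have "opp v v1" using v1 v co_sym vd' co_P unfolding opp_def by blast
  ultimately show ?thesis using that v xv v1 by blast
qed

text \<open>The connectedness on which everything rests, with a bound of three steps. If both common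
  neighbours \<open>v\<close>, \<open>v1\<close> from \<open>quad\<close> fall into the perp of
  \<open>p\<close>, the path uses a third point of the line \<open>c v\<close> and its projection
  onto the line \<open>c' v1\<close>.\<close>

lemma complement_connected:
  assumes x: "opp x x'" and p: "p \<in> P" "\<not> co p c" "\<not> co p c'"
    and co: "co x c" "co x' c" "co x c'" "co x' c'"
  obtains c1 c2 where "co c c1" "co c1 c2" "co c2 c'" "co x c1" "co x' c1" "co x c2" "co x' c2"
    "\<not> co p c1" "\<not> co p c2"
proof (cases "co c c'")
  case True then show ?thesis using that[of c c'] co p co_refl co_P by blast
next
  case False
  then have cc: "opp c c'" using co co_P unfolding opp_def by blast
  obtain v v1 where v: "opp v v1" "co x v" "co x' v" "co c v" "co c' v"
    "co x v1" "co x' v1" "co c v1" "co c' v1" using quad[OF x cc co] by blast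
  have sy: "co v c'" "co v1 c'" "co v v" "co v1 v1" using v co_sym co_refl co_P by blast+
  consider "\<not> co p v" | "\<not> co p v1" | "co p v" "co p v1" by blast
  then show ?thesis
  proof cases
    case 1 then show ?thesis using that[of v v] v sy by blast
  next
    case 2 then show ?thesis using that[of v1 v1] v sy by blast
  next
    case 3
    have cv: "c \<noteq> v" "c' \<noteq> v1" using 3 p by blast+
    note l = ln_props[OF v(4) cv(1)] and m = ln_props[OF v(9) cv(2)]
    obtain c2 where c2: "c2 \<in> ln c v" "c2 \<noteq> c" "c2 \<noteq> v" using third_point[OF l(1)] by blast
    have pc2: "\<not> co p c2" using perp_line[OF l(1) l(3) c2(1) c2(3)[symmetric] 3(1), of c] l p by blast
    obtain w where w: "w \<in> ln c' v1" "co c2 w" using perp_meets[OF line_P[OF l(1) c2(1)] m(1)] by blast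
    \<comment> \<open>\<open>v1\<close> is collinear to \<open>c\<close> but not to
      \<open>v\<close>, so \<open>c\<close> is its only neighbour on the line
      \<open>c v\<close>.\<close>
    have wv1: "w \<noteq> v1"
    proof
      assume "w = v1"
      then have "co v1 c2" "co v1 c" using w v co_sym by blast+
      then have "co v1 v" using perp_line[OF l(1) l(2) c2(1) c2(2)[symmetric] _ _ l(3)] by blast
      then show False using v(1) oppD by blast
    qed
    have pw: "\<not> co p w" using perp_line[OF m(1) m(3) w(1) wv1[symmetric] 3(2), of c'] m p by blast
    have "co x c2" "co x' c2" using ln_perp[OF v(4) cv(1) _ _ c2(1)] co v by blast+
    moreover have "co x w" "co x' w" using ln_perp[OF v(9) cv(2) _ _ w(1)] co v by blast+
    moreover have "co c c2" "co w c'" using line_co l m c2 w by blast+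
    ultimately show ?thesis using that[of c2 w] w pc2 pw by blast
  qed
qed

text \<open>On a path in the section that avoids the perp of \<open>c\<close>, every proper edge
  spans a line with a point in that perp, which is a second point of \<open>T\<close>. So a
  condition that defines a subspace need only be checked on a hyperplane of the section and at one
  further point.\<close>

lemma section_generated:
  assumes T: "subspace \<Delta> T" and x: "opp x x'" and c: "co x c" "co x' c"
    and d: "co x d" "co x' d" "d \<in> T" "\<not> co c d"
    and H: "\<And>y. co x y \<Longrightarrow> co x' y \<Longrightarrow> co c y \<Longrightarrow> y \<in> T"
    and e: "co x e" "co x' e"
  shows "e \<in> T"
proof -
  have cP: "c \<in> P" using c co_P by blast
  have step: "e2 \<in> T" if "e1 \<in> T" "\<not> co c e1" "co e1 e2" "co x e1" "co x' e1" "co x e2" "co x' e2" for e1 e2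
  proof (cases "e1 = e2")
    case True then show ?thesis using that by blast
  next
    case False
    note l = ln_props[OF that(3) False]
    obtain f where f: "f \<in> ln e1 e2" "co c f" using perp_meets[OF cP l(1)] by blast
    have "co x f" "co x' f" using ln_perp[OF that(3) False _ _ f(1)] that by blast+
    then have "f \<in> T" using H f by blast
    moreover have "f \<noteq> e1" using f that by blast
    ultimately show ?thesis using subspaceD[OF T l(1) l(2) f(1)] that l by blast
  qed
  show ?thesis
  proof (cases "co c e")
    case True then show ?thesis using H e by blast
  next
    case False
    obtain c1 c2 where "co d c1" "co c1 c2" "co c2 e" "co x c1" "co x' c1" "co x c2" "co x' c2"
      "\<not> co c c1" "\<not> co c c2"
      using complement_connected[OF x cP d(4) False d(1,2) e] by blast
    then show ?thesis using step d e by metis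
  qed
qed

section \<open>Planes and their intersections with lines and perps\<close>

definition plane :: "'a set \<Rightarrow> bool" where
  "plane \<pi> \<longleftrightarrow> (\<exists>x l. l \<in> L \<and> x \<in> P \<and> x \<notin> l \<and> (\<forall>y\<in>l. co x y) \<and> \<pi> = join x l)"

lemma planeI: "l \<in> L \<Longrightarrow> x \<notin> l \<Longrightarrow> (\<And>y. y \<in> l \<Longrightarrow> co x y) \<Longrightarrow> plane (join x l)"
proof -
  assume *: "l \<in> L" "x \<notin> l" "\<And>y. y \<in> l \<Longrightarrow> co x y"
  then have "x \<in> P" using third_point[of l] co_P by blast
  then show ?thesis unfolding plane_def using * by (intro exI[of _ x] exI[of _ l]) simp
qed

lemma plane_sing: assumes "plane \<pi>" shows "sing \<pi>"
proof -
  obtain x l where "l \<in> L" "x \<in> P" "x \<notin> l" "\<And>y. y \<in> l \<Longrightarrow> co x y" "\<pi> = join x l"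
    using assms unfolding plane_def by blast
  then show ?thesis using join_subspace[OF line_sing] by blast
qed

lemma plane_co: "plane \<pi> \<Longrightarrow> x \<in> \<pi> \<Longrightarrow> y \<in> \<pi> \<Longrightarrow> co x y"
  using sing_co plane_sing by blast

lemma plane_P: "plane \<pi> \<Longrightarrow> x \<in> \<pi> \<Longrightarrow> x \<in> P"
  using sing_P plane_sing by blast

lemma plane_ln:
  assumes "plane \<pi>" "x \<in> \<pi>" "y \<in> \<pi>" "x \<noteq> y"
  shows "ln x y \<in> L" "x \<in> ln x y" "y \<in> ln x y" "ln x y \<subseteq> \<pi>" "co x y"
  using ln_props[OF plane_co[OF assms(1-3)] assms(4)] plane_co[OF assms(1-3)]
    ln_sub[OF sing_subspace[OF plane_sing[OF assms(1)]] assms(2,3) plane_co[OF assms(1-3)] assms(4)]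
  by blast+

lemma line_in_join:
  assumes W: "sing W" and x: "x \<notin> W" "\<And>w. w \<in> W \<Longrightarrow> co x w" "x \<in> P"
    and k: "k \<in> L" "k \<subseteq> join x W"
  shows "k \<inter> W \<noteq> {}"
proof -
  have sJ: "sing (join x W)" by (rule join_subspace[OF W x])
  obtain p1 where p1: "p1 \<in> k" "p1 \<noteq> x" using third_point[OF k(1)] by blast
  obtain w1 where w1: "w1 \<in> W" "p1 \<in> ln x w1" "ln x p1 = ln x w1" "w1 \<noteq> x"
    using join_memE[OF _ x(1,2)] p1 k by (metis subsetD)
  note l1 = ln_props[OF x(2)[OF w1(1)] w1(4)[symmetric]]
  show ?thesis
  proof (cases "x \<in> k")
    case True
    then have "k = ln x w1" using ln_eq[OF k(1) True p1(1)] p1 w1 by simp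
    then show ?thesis using l1 w1 by blast
  next
    case False
    obtain p2 where p2: "p2 \<in> k" "p2 \<noteq> p1" using third_point[OF k(1)] by blast
    have "p2 \<noteq> x" using p2 False by blast
    then obtain w2 where w2: "w2 \<in> W" "p2 \<in> ln x w2" "w2 \<noteq> x"
      using join_memE[OF _ x(1,2)] p2 k by (metis subsetD)
    note l2 = ln_props[OF x(2)[OF w2(1)] w2(3)[symmetric]]
    have ne: "ln x w1 \<noteq> ln x w2"
      using line_unique[OF k(1) l1(1), of p1 p2] p1 p2 w1 w2 l1 False by metis
    then have w12: "w1 \<noteq> w2" by blast
    note m = ln_props[OF sing_co[OF W w1(1) w2(1)] w12]
    have mW: "ln w1 w2 \<subseteq> W" by (rule ln_sub[OF sing_subspace[OF W] w1(1) w2(1) sing_co[OF W w1(1) w2(1)] w12])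
    have "ln x w1 \<union> ln x w2 \<subseteq> join x W" using join_memI w1(1) w2(1) by blast
    then have "clique (ln x w1 \<union> ln x w2)" using clique_subset sing_clique[OF sJ] by blast
    then have "k \<inter> ln w1 w2 \<noteq> {}"
      using veblen[OF l1(1) l2(1) k(1) m(1) _ ne l1(2) l2(2) False] mW x(1) l1 l2 m p1 p2 w1 w2 by blast
    then show ?thesis using mW by blast
  qed
qed

lemma join_rebase:
  assumes W: "sing W" and x: "x \<notin> W" "\<And>w. w \<in> W \<Longrightarrow> co x w" "x \<in> P"
    and p: "p \<in> join x W" "p \<notin> W"
  shows "join p W = join x W"
proof -
  have sJ: "sing (join x W)" by (rule join_subspace[OF W x])
  have WJ: "W \<subseteq> join x W" by (rule join_base[OF x(1,2)])
  have cp: "co p w" if "w \<in> W" for w using sing_co[OF sJ p(1)] WJ that by blast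
  have "join x W \<subseteq> join p W"
    by (rule hyperplane_swap[OF sJ W WJ join_self subset_refl x(1) p])
  moreover have "join p W \<subseteq> join x W"
    by (rule join_least[OF sing_subspace[OF sJ] p(1) WJ p(2) cp])
  ultimately show ?thesis by blast
qed

text \<open>Frees \<open>plane\<close> from the presentation in its definition. If \<open>k\<close>
  differs from the original line \<open>l\<close>, the two meet in a point \<open>r\<close> by
  \<open>line_in_join\<close>, and the plane is regenerated from points \<open>r'\<close> of
  \<open>l\<close> and \<open>q\<close> of \<open>k\<close> other than \<open>r\<close>.\<close>

lemma plane_rebase:
  assumes pi: "plane \<pi>" and k: "k \<in> L" "k \<subseteq> \<pi>" and p: "p \<in> \<pi>" "p \<notin> k"
  shows "\<pi> = join p k"
proof -
  obtain x l where x: "l \<in> L" "x \<in> P" "x \<notin> l" "\<And>y. y \<in> l \<Longrightarrow> co x y" "\<pi> = join x l"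
    using pi unfolding plane_def by blast
  have lpi: "l \<subseteq> \<pi>" using join_base x by blast
  have co: "co a b" if "a \<in> \<pi>" "b \<in> \<pi>" for a b using plane_co[OF pi that] .
  have subs: "subspace \<Delta> \<pi>" using pi plane_sing sing_subspace by blast
  show ?thesis
  proof (cases "k = l")
    case True then show ?thesis using join_rebase[OF line_sing[OF x(1)] x(3,4,2)] p x(5) by simp
  next
    case False
    obtain r where r: "r \<in> k" "r \<in> l" using line_in_join[OF line_sing[OF x(1)] x(3,4,2) k(1)] k x(5) by blast
    obtain r' where r': "r' \<in> l" "r' \<noteq> r" using third_point[OF x(1)] by blast
    have r'k: "r' \<notin> k" using line_unique[OF k(1) x(1) r(1) _ r(2) r'(1)] r' False by blast
    obtain q where q: "q \<in> k" "q \<noteq> r" using third_point[OF k(1)] by blast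
    have ql: "q \<notin> l" using line_unique[OF k(1) x(1) r(1) q(1) r(2)] q(2) False by blast
    have ck: "co r' w" if "w \<in> k" for w using co that k r' lpi by blast
    have r'P: "r' \<in> P" using r' x line_P by blast
    have sJ: "sing (join r' k)" by (rule join_subspace[OF line_sing[OF k(1)] r'k ck r'P])
    have kJ: "k \<subseteq> join r' k" by (rule join_base[OF r'k ck])
    have "l \<subseteq> join r' k"
      using subspaceD[OF sing_subspace[OF sJ] x(1) r'(1) r(2) join_self] kJ r r' by blast
    then have "join q l \<subseteq> join r' k"
      using join_least[OF sing_subspace[OF sJ], of q l] kJ q ql co lpi k by blast
    moreover have "join q l = \<pi>"
      using join_rebase[OF line_sing[OF x(1)] x(3,4,2), of q] q ql k x(5) by blast
    moreover have "join r' k \<subseteq> \<pi>"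
      by (rule join_least[OF subs _ k(2) r'k ck]) (use r' lpi in blast)
    ultimately have "\<pi> = join r' k" by blast
    then show ?thesis using join_rebase[OF line_sing[OF k(1)] r'k ck r'P] p by simp
  qed
qed

lemma plane_meet:
  assumes pi: "plane \<pi>" and k: "k \<in> L" "k \<subseteq> \<pi>" and m: "m \<in> L" "m \<subseteq> \<pi>"
  obtains p where "p \<in> k" "p \<in> m"
proof (cases "m \<subseteq> k")
  case True then show ?thesis using third_point[OF m(1)] that by blast
next
  case False
  then obtain p where p: "p \<in> m" "p \<notin> k" by blast
  have ck: "co p w" if "w \<in> k" for w using plane_co[OF pi] p m k that by blast
  have "\<pi> = join p k" using plane_rebase[OF pi k] p m by blast
  then have "m \<inter> k \<noteq> {}" using line_in_join[OF line_sing[OF k(1)] p(2) ck _ m(1)] m p line_P by blast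
  then show ?thesis using that by blast
qed

lemma plane_off_line:
  assumes pi: "plane \<pi>" and k: "k \<in> L" "k \<subseteq> \<pi>"
  obtains p where "p \<in> \<pi>" "p \<notin> k"
proof -
  obtain x l where x: "l \<in> L" "x \<in> P" "x \<notin> l" "\<And>y. y \<in> l \<Longrightarrow> co x y" "\<pi> = join x l"
    using pi unfolding plane_def by blast
  have "x \<in> \<pi>" "l \<subseteq> \<pi>" using join_self join_base x by blast+
  moreover have "k \<noteq> l \<or> x \<notin> k" using x by blast
  moreover have "k = l" if "l \<subseteq> k"
  proof -
    obtain a where a: "a \<in> l" using third_point[OF x(1)] by blast
    obtain b where b: "b \<in> l" "b \<noteq> a" using third_point[OF x(1)] by blast
    show ?thesis using line_unique[OF k(1) x(1), of a b] a b that by blast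
  qed
  ultimately show ?thesis using that by blast
qed

lemma plane_cover:
  assumes "plane \<pi>" "k \<in> L" "k \<subseteq> \<pi>" "p \<in> \<pi>" "p \<notin> k" "\<And>y. y \<in> k \<Longrightarrow> co q y" "co q p" "x \<in> \<pi>"
  shows "co q x"
proof -
  have ck: "co p w" if "w \<in> k" for w using plane_co[OF assms(1)] that assms by blast
  have "x \<in> join p k" using plane_rebase[OF assms(1-5)] assms(8) by blast
  then show ?thesis
  proof (rule join_memE[OF _ assms(5) ck])
    fix w assume w: "w \<in> k" "x \<in> ln p w" "w \<noteq> p"
    then show ?thesis using ln_perp[OF ck[OF w(1)] w(3)[symmetric]] assms by blast
  qed (use assms in auto)
qed

text \<open>The point \<open>p\<close> has a neighbour on each of two lines of the plane; the second
  line is chosen to miss the neighbour \<open>q\<close> found on the first, so the two are distinct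
  and span \<open>k\<close>.\<close>

lemma plane_perp:
  assumes pi: "plane \<pi>" and p: "p \<in> P"
  obtains k where "k \<in> L" "k \<subseteq> \<pi>" "\<And>y. y \<in> k \<Longrightarrow> co p y"
proof -
  obtain x l where x: "l \<in> L" "x \<in> P" "x \<notin> l" "\<And>y. y \<in> l \<Longrightarrow> co x y" "\<pi> = join x l"
    using pi unfolding plane_def by blast
  have lpi: "l \<subseteq> \<pi>" "x \<in> \<pi>" using join_base join_self x by blast+
  obtain q where q: "q \<in> l" "co p q" using perp_meets[OF p x(1)] by blast
  obtain r where r: "r \<in> l" "r \<noteq> q" using third_point[OF x(1)] by blast
  have xr: "x \<noteq> r" "x \<in> \<pi>" "r \<in> \<pi>" using r x(3) lpi by blast+
  note m = plane_ln[OF pi xr(2,3,1)]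
  obtain q2 where q2: "q2 \<in> ln x r" "co p q2" using perp_meets[OF p m(1)] by blast
  have qm: "q \<notin> ln x r" using line_unique[OF m(1) x(1) _ m(3) q(1) r(1) r(2)[symmetric]] m(2) x(3) by metis
  then have ne: "q \<noteq> q2" using q2 by blast
  have qpi: "q \<in> \<pi>" "q2 \<in> \<pi>" using q lpi q2 m by blast+
  note k = plane_ln[OF pi qpi ne]
  show ?thesis by (rule that[OF k(1,4)]) (use ln_perp[OF k(5) ne q(2) q2(2)] in blast)
qed

lemma plane_perp_exact:
  assumes "plane \<pi>" "k \<in> L" "k \<subseteq> \<pi>" "\<And>y. y \<in> k \<Longrightarrow> co p y" "x \<in> \<pi>" "\<not> co p x" "y \<in> \<pi>" "co p y"
  shows "y \<in> k"
  using plane_cover[OF assms(1-3,7) _ assms(4,8,5)] assms(6) by blast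

lemma plane_perp_line:
  assumes "plane \<pi>" "p \<in> P" "x \<in> \<pi>" "\<not> co p x"
  shows "{y \<in> \<pi>. co p y} \<in> L"
proof -
  obtain k where k: "k \<in> L" "k \<subseteq> \<pi>" "\<And>y. y \<in> k \<Longrightarrow> co p y" using plane_perp[OF assms(1,2)] by blast
  then have "{y \<in> \<pi>. co p y} = k" using plane_perp_exact[OF assms(1) k assms(3,4)] by blast
  then show ?thesis using k by simp
qed

lemma ex_plane:
  assumes "l \<in> L" obtains \<pi> where "plane \<pi>" "l \<subseteq> \<pi>"
proof -
  obtain f where f: "f \<in> P" "f \<notin> l" "\<And>y. y \<in> l \<Longrightarrow> co f y" using ex_coplanar[OF assms] by blast
  show ?thesis using that[OF planeI[OF assms f(2,3)] join_base[OF f(2,3)]] by blast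
qed

lemma line_subset_eq: "k \<in> L \<Longrightarrow> l \<in> L \<Longrightarrow> k \<subseteq> l \<Longrightarrow> k = l"
  using third_point line_unique by (metis subsetD)

end

section \<open>Extending a map of a cone\<close>

context thick_polar_space
begin

text \<open>For collinear \<open>x\<close> and \<open>y\<close> every point of the line
  \<open>u x\<close> is collinear to every point of the line \<open>u y\<close>. So a map that keeps
  each line through \<open>u\<close> preserves collinearity on the cone.\<close>

lemma cone_co:
  assumes "co u x" "co u y" "co x y" "x \<noteq> u \<Longrightarrow> x' \<in> ln u x" "y \<noteq> u \<Longrightarrow> y' \<in> ln u y"
    "x = u \<Longrightarrow> x' = u" "y = u \<Longrightarrow> y' = u"
  shows "co x' y'"
proof -
  have ux: "co u x'" using assms ln_props[OF assms(1)] line_co by metis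
  have "co y x'"
    using assms ln_perp[OF assms(1), of y x'] co_sym by metis
  then show ?thesis using assms ln_perp[OF assms(2), of x' y'] ux co_sym by metis
qed

end

text \<open>The inverse \<open>g'\<close> is a parameter with the same conditions as
  \<open>g\<close>, so that exchanging \<open>a\<close> with \<open>b\<close> and \<open>g\<close>
  with \<open>g'\<close> yields another instance; the inverse of the extension arises in this way.
  Both maps are constrained on the cone of \<open>u\<close> only.\<close>

locale cone_extension = thick_polar_space \<Delta> n for \<Delta> :: "'a geometry" and n +
  fixes u a b :: 'a and g g' :: "'a \<Rightarrow> 'a"
  assumes ua: "opp u a" and ub: "opp u b"
    and g_u: "g u = u" "g' u = u"
    and g_inv: "co u x \<Longrightarrow> g' (g x) = x" "co u x \<Longrightarrow> g (g' x) = x"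
    and g_ln: "co u x \<Longrightarrow> x \<noteq> u \<Longrightarrow> g x \<in> ln u x" "co u x \<Longrightarrow> x \<noteq> u \<Longrightarrow> g' x \<in> ln u x"
    and g_line: "l \<in> L \<Longrightarrow> (\<And>x. x \<in> l \<Longrightarrow> co u x) \<Longrightarrow> g ` l \<in> L"
      "l \<in> L \<Longrightarrow> (\<And>x. x \<in> l \<Longrightarrow> co u x) \<Longrightarrow> g' ` l \<in> L"
    and g_section: "co u c \<Longrightarrow> co a c \<Longrightarrow> co b (g c)"
begin

lemma g_co_u: "co u x \<Longrightarrow> co u (g x)" "co u x \<Longrightarrow> co u (g' x)"
  using g_ln g_u ln_co ln_props(2) by metis+

lemma g_inj: "co u x \<Longrightarrow> co u y \<Longrightarrow> g x = g y \<Longrightarrow> x = y"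
  using g_inv by metis

lemma g_co: "co u x \<Longrightarrow> co u y \<Longrightarrow> co (g x) (g y) \<longleftrightarrow> co x y"
proof
  assume *: "co u x" "co u y" "co x y"
  show "co (g x) (g y)" by (rule cone_co[OF *]) (use g_ln g_u * in auto)
next
  assume *: "co u x" "co u y" "co (g x) (g y)"
  have "co (g' (g x)) (g' (g y))"
    by (rule cone_co[OF g_co_u(1)[OF *(1)] g_co_u(1)[OF *(2)] *(3)])
      (use g_ln g_u g_co_u * in auto)
  then show "co x y" using g_inv * by simp
qed

text \<open>\<open>lift x w x' w'\<close> says that moving from \<open>x\<close> to the collinear point \<open>x'\<close> forces the image to
  move from \<open>w\<close> to \<open>w'\<close>. The extension of \<open>g\<close> is obtained by lifting paths that start at \<open>a\<close> to
  paths that start at \<open>b\<close>; the point is that the result does not depend on the path.\<close>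

definition rel :: "'a \<Rightarrow> 'a \<Rightarrow> bool" where
  "rel x w \<longleftrightarrow> opp u x \<and> opp u w \<and> (\<forall>c. co u c \<longrightarrow> co x c \<longrightarrow> co w (g c))"

definition lift :: "'a \<Rightarrow> 'a \<Rightarrow> 'a \<Rightarrow> 'a \<Rightarrow> bool" where
  "lift x w x' w' \<longleftrightarrow> rel x w \<and> rel x' w' \<and> (x = x' \<and> w = w' \<or>
     x \<noteq> x' \<and> co x x' \<and> w \<noteq> w' \<and> co w w' \<and> (\<exists>c. c \<in> ln x x' \<and> co u c \<and> g c \<in> ln w w'))"

lemma relD: "rel x w \<Longrightarrow> opp u x" "rel x w \<Longrightarrow> opp u w"
    "rel x w \<Longrightarrow> co u c \<Longrightarrow> co x c \<Longrightarrow> co w (g c)"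
  unfolding rel_def by blast+

text \<open>\<open>rel\<close> demands one inclusion of sections. Equality follows because each line
  through \<open>u\<close> in the cone has exactly one point collinear to \<open>x\<close>, and its
  image has exactly one collinear to \<open>w\<close>.\<close>

lemma rel_iff:
  assumes r: "rel x w" and c: "co u c" shows "co w (g c) \<longleftrightarrow> co x c"
proof
  assume w: "co w (g c)"
  note wu = oppD[OF relD(2)[OF r]]
  have cu: "u \<noteq> c" using w wu g_u by metis
  note l = ln_props[OF c cu]
  obtain e where e: "e \<in> ln u c" "co x e"
    using perp_meets[OF _ l(1)] oppD(2)[OF relD(1)[OF r]] by blast
  have eu: "e \<noteq> u" "co u e" using e oppD[OF relD(1)[OF r]] line_co l by blast+
  have leq: "ln u e = ln u c" using ln_move[OF c cu e(1) eu(1)] .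
  have "co w (g e)" using relD(3)[OF r eu(2) e(2)] .
  moreover have "g e \<in> ln u c" "g c \<in> ln u c" using g_ln c cu eu leq by metis+
  ultimately have "g e = g c" using line_opp_unique[OF l(1,2), of w] wu w by blast
  then show "co x c" using g_inj eu c e by blast
qed (use relD(3)[OF r c] in blast)

lemma rel_ab: "rel a b"
  unfolding rel_def using ua ub g_section by blast

lemma lift_rel: "lift x w x' w' \<Longrightarrow> rel x w" "lift x w x' w' \<Longrightarrow> rel x' w'"
  unfolding lift_def by blast+

lemma lift_refl: "rel x w \<Longrightarrow> lift x w x w"
  unfolding lift_def by blast

lemma lift_sym: "lift x w x' w' \<Longrightarrow> lift x' w' x w"
  unfolding lift_def using co_sym ln_sym by metis

lemma lift_co: "lift x w x' w' \<Longrightarrow> co x x'"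
  unfolding lift_def using co_refl relD(1) oppD(2) by metis

text \<open>The line \<open>x x'\<close> meets the cone in one point \<open>c\<close>, so
  \<open>w'\<close> is sought on the line from \<open>w\<close> to \<open>g c\<close>. One point
  \<open>d\<close> of the section of \<open>x'\<close> pins it down, and
  \<open>section_generated\<close> extends the required collinearities to the whole section.\<close>

lemma lift_ex:
  assumes r: "rel x w" and x': "opp u x'" "co x x'"
  obtains w' where "lift x w x' w'"
proof (cases "x = x'")
  case True then show ?thesis using that lift_refl r by blast
next
  case False
  note xu = oppD[OF relD(1)[OF r]] and wu = oppD[OF relD(2)[OF r]] and x'u = oppD[OF x'(1)]
  note l = ln_props[OF x'(2) False]
  obtain c where c: "c \<in> ln x x'" "co u c" using perp_meets[OF xu(1) l(1)] by blast
  have xc: "co x c" "co x' c" "co c x'" using line_co[OF l(1)] l c by blast+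
  have cne: "c \<noteq> x" "c \<noteq> x'" using c xu x'u by blast+
  \<comment> \<open>Being collinear to \<open>x'\<close> but not to \<open>c\<close>, the point
    \<open>d\<close> is not collinear to \<open>x\<close>. Hence \<open>g d\<close> singles out a
    point of the line \<open>w (g c)\<close> other than \<open>w\<close> and
    \<open>g c\<close>.\<close>
  obtain d where d: "co u d" "co x' d" "\<not> co d c" using section_separates[OF x'(1) c(2) xc(2)] by blast
  have xd: "\<not> co x d"
  proof
    assume "co x d"
    then have "co d x" "co d x'" using d co_sym by blast+
    then show False using ln_perp[OF x'(2) False] c d by blast
  qed
  have wc: "co w (g c)" using relD(3)[OF r c(2) xc(1)] .
  have gcu: "co u (g c)" "co u (g d)" using g_co_u c d by blast+
  have wne: "w \<noteq> g c" using gcu wu by blast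
  note k = ln_props[OF wc wne]
  have nd: "\<not> co w (g d)" "\<not> co (g d) (g c)" using rel_iff[OF r d(1)] xd g_co[OF d(1) c(2)] d(3) by blast+
  obtain w' where w': "w' \<in> ln w (g c)" "co (g d) w'" using perp_meets[OF co_P(2)[OF gcu(2)] k(1)] by blast
  have ne: "w' \<noteq> w" "w' \<noteq> g c" using w' nd co_sym by blast+
  have uw': "opp u w'"
    using perp_line[OF k(1) w'(1) k(3) ne(2), of u w] k gcu wu co_P(2)[OF w'(2)] unfolding opp_def by blast
  let ?T = "{y. co u y \<and> co w' (g y)}"
  have T: "subspace \<Delta> ?T"
  proof (rule subspaceI)
    show "?T \<subseteq> P" using co_P by blast
  next
    fix m y1 y2 z assume m: "m \<in> L" "y1 \<in> m" "y2 \<in> m" "y1 \<in> ?T" "y2 \<in> ?T" "y1 \<noteq> y2" "z \<in> m"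
    have um: "co u y" if "y \<in> m" for y using perp_line[OF m(1-3,6)] m that by blast
    have "g ` m \<in> L" using g_line(1)[OF m(1) um] .
    moreover have "g y1 \<noteq> g y2" using g_inj m by blast
    ultimately have "co w' (g z)" using perp_line[of "g ` m" "g y1" "g y2" w' "g z"] m by blast
    then show "z \<in> ?T" using um m by blast
  qed
  have "co w' (g e)" if e: "co u e" "co x' e" for e
  proof -
    have "e \<in> ?T"
    proof (rule section_generated[OF T x'(1) c(2) xc(2) d(1,2) _ _ _ e])
      show "d \<in> ?T" using d(1) w'(2) co_sym by blast
      show "\<not> co c d" using d(3) co_sym by blast
      fix y assume y: "co u y" "co x' y" "co c y"
      have "co y x" using perp_line[OF l(1) l(3) c(1) cne(2)[symmetric] _ _ l(2), of y] y co_sym by blast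
      then have "co w (g y)" using relD(3)[OF r y(1)] co_sym by blast
      moreover have "co (g c) (g y)" using g_co[OF c(2) y(1)] y by blast
      ultimately have "co (g y) w'" using ln_perp[OF wc wne _ _ w'(1)] co_sym by blast
      then show "y \<in> ?T" using y co_sym by blast
    qed
    then show ?thesis by blast
  qed
  then have r': "rel x' w'" unfolding rel_def using x' uw' by blast
  have "ln w w' = ln w (g c)" using ln_move[OF wc wne w'(1) ne(1)] .
  then have "lift x w x' w'" unfolding lift_def
    using r r' False x' ne line_co[OF k(1) k(2) w'(1)] c k by blast
  then show ?thesis by (rule that)
qed

text \<open>Both points have the same section with \<open>u\<close>. If they were distinct, the cone
  point \<open>e\<close> of their line would be collinear to this entire section, which contains
  \<open>e\<close>, contrary to \<open>section_separates\<close>.\<close>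

lemma rel_unique:
  assumes "rel x w1" "rel x w2" "co w1 w2" shows "w1 = w2"
proof (rule ccontr)
  assume ne: "w1 \<noteq> w2"
  note u1 = relD(2)[OF assms(1)] and l = ln_props[OF assms(3) ne]
  obtain e where e: "e \<in> ln w1 w2" "co u e" using perp_meets[OF oppD(1)[OF u1] l(1)] by blast
  have we: "co w1 e" using line_co[OF l(1)] l e by blast
  obtain d where d: "co u d" "co w1 d" "\<not> co d e" using section_separates[OF u1 e(2) we] by blast
  have "co x (g' d)" using rel_iff[OF assms(1) g_co_u(2)[OF d(1)]] g_inv d by simp
  then have "co w2 d" using rel_iff[OF assms(2) g_co_u(2)[OF d(1)]] g_inv d by simp
  then show False using ln_perp[OF assms(3) ne _ _ e(1), of d] d co_sym by blast
qed

lemma lift_point: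
  assumes "lift x w x' w'" "x \<noteq> x'"
  obtains c where "c \<in> ln x x'" "co u c" "co x c" "c \<noteq> x" "co w (g c)" "w \<noteq> g c" "w' \<in> ln w (g c)"
    "co x x'" "co w' (g c)"
proof -
  have *: "co x x'" "w \<noteq> w'" "co w w'" "rel x w" using assms unfolding lift_def by auto
  obtain c where c: "c \<in> ln x x'" "co u c" "g c \<in> ln w w'" using assms unfolding lift_def by auto
  note k = ln_props[OF *(3,2)]
  have "co x c" "c \<noteq> x" "co w (g c)" "co w' (g c)"
    using ln_props[OF *(1) assms(2)] line_co c k oppD[OF relD(1)[OF *(4)]] by blast+
  moreover have wn: "w \<noteq> g c" using g_co_u(1)[OF c(2)] oppD[OF relD(2)[OF *(4)]] by blast
  moreover have "w' \<in> ln w (g c)" using ln_move[OF *(3,2) c(3)] wn k by metis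
  ultimately show ?thesis using that c * by blast
qed

lemma lift_unique:
  assumes "lift x w x' w1" "lift x w x' w2" shows "w1 = w2"
proof (cases "x = x'")
  case True then show ?thesis using assms unfolding lift_def by blast
next
  case False
  obtain c1 where c1: "c1 \<in> ln x x'" "co u c1" "w1 \<in> ln w (g c1)" "co w (g c1)" "w \<noteq> g c1" "co x x'"
    using lift_point[OF assms(1) False] by metis
  obtain c2 where c2: "c2 \<in> ln x x'" "co u c2" "w2 \<in> ln w (g c2)"
    using lift_point[OF assms(2) False] by metis
  have "\<not> co u x" using oppD relD(1) lift_rel(1) assms by blast
  then have "c1 = c2"
    using line_opp_unique[OF ln_props(1,2)[OF c1(6) False]] c1 c2 by blast
  then have "co w1 w2" using ln_co[OF c1(4,5)] c1 c2 by blast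
  then show ?thesis using rel_unique lift_rel(2) assms by blast
qed

text \<open>The direct lift \<open>v\<close> of \<open>x''\<close> is compared with
  \<open>w''\<close>; by \<open>rel_unique\<close> their collinearity suffices. In a proper triangle
  \<open>c1\<close>, \<open>c2\<close>, \<open>c3\<close> lie on the line in which the plane meets
  the cone. Its image under \<open>g\<close> is a line, and \<open>w'\<close>, \<open>w''\<close>
  and \<open>v\<close> lie in the singular subspace spanned by this line and
  \<open>w\<close>.\<close>

lemma lift_triangle:
  assumes l1: "lift x w x' w'" and l2: "lift x' w' x'' w''" and co: "co x x''"
  shows "lift x w x'' w''"
proof -
  have r: "rel x w" "rel x' w'" "rel x'' w''" using l1 l2 lift_rel by blast+
  note xu = oppD[OF relD(1)[OF r(1)]]
  obtain v where v: "lift x w x'' v" using lift_ex[OF r(1) relD(1)[OF r(3)] co] by blast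
  consider "x = x'" | "x' = x''" | "x = x''" | "x \<noteq> x'" "x' \<noteq> x''" "x \<noteq> x''" by blast
  then show ?thesis
  proof cases
    case 1 then show ?thesis using l1 l2 unfolding lift_def by blast
  next
    case 2 then show ?thesis using l1 l2 unfolding lift_def by blast
  next
    case 3
    then have "w'' = w" using lift_unique[OF lift_sym[OF l1]] l2 by blast
    then show ?thesis using 3 lift_refl r by blast
  next
    case 4
    obtain c1 where c1: "c1 \<in> ln x x'" "co u c1" "co x c1" "c1 \<noteq> x" "co w (g c1)" "w \<noteq> g c1" "w' \<in> ln w (g c1)" "co x x'" "co w' (g c1)"
      using lift_point[OF l1 4(1)] .
    obtain c2 where c2: "c2 \<in> ln x' x''" "co u c2" "co x' c2" "c2 \<noteq> x'" "co w' (g c2)" "w' \<noteq> g c2" "w'' \<in> ln w' (g c2)" "co x' x''"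
      using lift_point[OF l2 4(2)] by metis
    obtain c3 where c3: "c3 \<in> ln x x''" "co u c3" "co x c3" "c3 \<noteq> x" "co w (g c3)" "w \<noteq> g c3" "v \<in> ln w (g c3)"
      using lift_point[OF v 4(3)] by metis
    note m1 = ln_props[OF c1(8) 4(1)] and m2 = ln_props[OF c2(8) 4(2)] and m3 = ln_props[OF co 4(3)]
    have x'u: "\<not> co u x'" using oppD relD(1) r by blast
    have "co v w''"
    proof (cases "x'' \<in> ln x x'")
      case True
      have e: "ln x x'' = ln x x'" "ln x' x'' = ln x x'" using ln_eq[OF m1(1)] m1 True 4 by blast+
      then have eq: "c3 = c1" "c2 = c1" using line_opp_unique[OF m1(1,2) xu(3)] c1 c2 c3 by blast+
      have "ln w' (g c1) = ln w (g c1)"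
        using ln_eq[OF ln_props(1)[OF c1(5,6)] c1(7) ln_props(3)[OF c1(5,6)]] c2(6) eq by blast
      then show ?thesis using ln_co[OF c1(5,6)] c2(7) c3(7) eq by simp
    next
      case False
      have cx: "co x'' y" if "y \<in> ln x x'" for y
        using ln_perp[OF c1(8) 4(1) _ _ that] co c2(8) co_sym by blast
      let ?\<pi> = "join x'' (ln x x')"
      have pi: "plane ?\<pi>" using planeI[OF m1(1) False cx] .
      have in_pi: "x'' \<in> ?\<pi>" "ln x x' \<subseteq> ?\<pi>" using join_self join_base[OF False cx] by blast+
      have sub: "ln x' x'' \<subseteq> ?\<pi>" "ln x x'' \<subseteq> ?\<pi>" using plane_ln(4)[OF pi] in_pi m1 4 by blast+
      have c13: "c1 \<noteq> c3"
      proof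
        assume "c1 = c3"
        then have "ln x x' = ln x x''" using line_unique[OF m1(1) m3(1) m1(2) c1(1) m3(2)] c3 by blast
        then show False using False m3 by blast
      qed
      have "c1 \<in> ?\<pi>" "c2 \<in> ?\<pi>" "c3 \<in> ?\<pi>" using in_pi sub c1 c2 c3 by blast+
      note k = plane_ln[OF pi this(1,3) c13]
      have uk: "co u y" if "y \<in> ln c1 c3" for y using ln_perp[OF k(5) c13 c1(2) c3(2) that] .
      have "c2 \<in> ln c1 c3"
        using plane_perp_exact[OF pi k(1,4) uk _ xu(3)] in_pi m1 \<open>c2 \<in> ?\<pi>\<close> c2(2) by blast
      then have g2: "g c1 \<in> g ` ln c1 c3" "g c2 \<in> g ` ln c1 c3" "g c3 \<in> g ` ln c1 c3" using k by blast+
      have gL: "g ` ln c1 c3 \<in> L" using g_line(1)[OF k(1) uk] .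
      have g13: "g c1 \<noteq> g c3" using g_inj c1 c3 c13 by blast
      have "clique {w, g c1, g c3}"
        unfolding clique_def using c1(5) c3(5) line_co[OF gL] g2 co_sym co_refl co_P(1)[OF c1(5)] by auto
      then have U: "sing (span \<Delta> {w, g c1, g c3})" (is "sing ?U") by (rule sing_span)
      note sU = sing_subspace[OF U]
      have in_U: "w \<in> ?U" "g c1 \<in> ?U" "g c3 \<in> ?U" using span_subset[of "{w, g c1, g c3}"] by blast+
      have "g c2 \<in> ?U" using subspaceD[OF sU gL g2(1,3) in_U(2,3) g13 g2(2)] .
      moreover have "w' \<in> ?U" using ln_sub[OF sU in_U(1,2) c1(5,6)] c1(7) by blast
      ultimately have "w'' \<in> ?U" using ln_sub[OF sU _ _ c2(5,6)] c2(7) by blast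
      moreover have "v \<in> ?U" using ln_sub[OF sU in_U(1,3) c3(5,6)] c3(7) by blast
      ultimately show ?thesis using sing_co[OF U] by blast
    qed
    then have "v = w''" using rel_unique[OF lift_rel(2)[OF v] r(3)] by blast
    then show ?thesis using v by blast
  qed
qed

text \<open>A bad point is not reached from \<open>a\<close> by a path of length two outside \<open>u\<^sup>\<bottom>\<close>. In a symplectic
  space these are the other points of the hyperbolic line through \<open>a\<close> and \<open>u\<close>.\<close>

definition bad :: "'a \<Rightarrow> bool" where
  "bad x \<longleftrightarrow> (\<forall>y. co a y \<longrightarrow> co x y \<longrightarrow> co u y)"

definition near :: "'a \<Rightarrow> 'a \<Rightarrow> bool" where
  "near x w \<longleftrightarrow> (\<exists>y v. lift a b y v \<and> lift y v x w)"

lemma near_rel: "near x w \<Longrightarrow> rel x w"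
  unfolding near_def using lift_rel by blast

lemma near_not_bad: "near x w \<Longrightarrow> \<not> bad x"
  unfolding near_def bad_def using lift_co lift_rel relD(1) oppD(3) co_sym by metis

lemma near_ex: assumes "opp u x" "\<not> bad x" obtains w where "near x w"
proof -
  obtain y where y: "co a y" "co x y" "\<not> co u y" using assms unfolding bad_def by blast
  then have uy: "opp u y" using oppD(1)[OF assms(1)] co_P unfolding opp_def by blast
  obtain v where v: "lift a b y v" using lift_ex[OF rel_ab uy y(1)] .
  obtain w where "lift y v x w" using lift_ex[OF lift_rel(2)[OF v] assms(1) co_sym[OF y(2)]] .
  then show ?thesis using that v unfolding near_def by blast
qed

lemma near_move:
  assumes "lift a b y v" "lift y v x w" "lift a b z t" "co y z" "co z x"
  shows "lift z t x w"
proof -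
  have "lift z t y v" using lift_sym[OF lift_triangle[OF lift_sym[OF assms(1)] assms(3,4)]] .
  then show ?thesis using lift_triangle assms(2,5) by blast
qed

text \<open>If \<open>a\<close> and \<open>x\<close> are opposite, the midpoints of the two paths
  lie in their section and outside the cone of \<open>u\<close>. This set is connected, and moving
  the midpoint to a collinear one changes the path by two triangles.\<close>

lemma near_unique:
  assumes "near x w1" "near x w2" shows "w1 = w2"
proof -
  obtain y1 v1 where 1: "lift a b y1 v1" "lift y1 v1 x w1" using assms(1) unfolding near_def by blast
  obtain y2 v2 where 2: "lift a b y2 v2" "lift y2 v2 x w2" using assms(2) unfolding near_def by blast
  show ?thesis
  proof (cases "co a x")
    case True
    show ?thesis using lift_unique[OF lift_triangle[OF 1 True] lift_triangle[OF 2 True]] .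
  next
    case False
    then have ax: "opp a x" using oppD(2)[OF ua] co_P(2)[OF lift_co[OF 1(2)]] unfolding opp_def by blast
    have "\<not> co u y1" "\<not> co u y2" using 1 2 lift_rel relD(1) oppD(3) by blast+
    moreover have c: "co a y1" "co a y2" "co x y1" "co x y2" using 1 2 lift_co co_sym by blast+
    ultimately obtain c1 c2 where p: "co y1 c1" "co c1 c2" "co c2 y2" "co a c1" "co x c1" "co a c2" "co x c2"
      "\<not> co u c1" "\<not> co u c2"
      using complement_connected[OF ax oppD(1)[OF ua]] by metis
    have "opp u c1" "opp u c2" using p oppD(1)[OF ua] co_P unfolding opp_def by blast+
    then obtain t1 t2 where t: "lift a b c1 t1" "lift a b c2 t2" using lift_ex[OF rel_ab] p by metis
    have "lift c1 t1 x w1" using near_move[OF 1 t(1)] p co_sym by blast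
    then have "lift c2 t2 x w1" using near_move[OF t(1) _ t(2)] p co_sym by blast
    then have "lift y2 v2 x w1" using near_move[OF t(2) _ 2(1)] p c co_sym by blast
    then show ?thesis using lift_unique 2 by blast
  qed
qed

lemma near_edge_common:
  assumes "near x w" "lift x w x' w'" "co a y" "co x y" "co x' y" "\<not> co u y"
  shows "near x' w'"
proof -
  have uy: "opp u y" using assms oppD(1)[OF ua] co_P unfolding opp_def by blast
  obtain v where v: "lift a b y v" using lift_ex[OF rel_ab uy assms(3)] .
  obtain w2 where w2: "lift y v x w2"
    using lift_ex[OF lift_rel(2)[OF v] relD(1)[OF near_rel[OF assms(1)]] co_sym[OF assms(4)]] .
  then have "w2 = w" using near_unique[OF _ assms(1)] v unfolding near_def by blast
  then have "lift y v x' w'" using lift_triangle[OF _ assms(2)] w2 co_sym[OF assms(5)] by blast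
  then show ?thesis using v unfolding near_def by blast
qed

text \<open>The reason is that the hyperplane \<open>u\<^sup>\<bottom>\<close> of the polar space \<open>{a, x}\<^sup>\<bottom>\<close> can be the perp of at
  most one of its points.\<close>

lemma ex_common:
  assumes x: "opp u x" "opp u x'" "opp u x''" "co x x'" "co x x''" "co x' x''"
    and ne: "x \<noteq> x'" "x'' \<notin> ln x x'" and good: "\<not> bad x"
    and no: "\<And>y. co a y \<Longrightarrow> co x y \<Longrightarrow> co x' y \<Longrightarrow> co u y"
  shows "\<exists>y. co a y \<and> co x y \<and> co x'' y \<and> \<not> co u y"
proof (rule ccontr)
  assume "\<not> ?thesis"
  then have no'': "co u y" if "co a y" "co x y" "co x'' y" for y using that by blast
  note m = ln_props[OF x(4) ne(1)]
  have ne'': "x \<noteq> x''" using ne m by blast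
  note m'' = ln_props[OF x(5) ne'']
  note aP = oppD(2)[OF ua] and uP = oppD(1)[OF ua] and xu = oppD[OF x(1)]
  have nax: "\<not> co a x" using no[of x] xu co_refl co_sym x(4) by blast
  have ax: "opp a x" using nax aP xu unfolding opp_def by blast
  obtain c where c: "c \<in> ln x x'" "co a c" using perp_meets[OF aP m(1)] by blast
  obtain c'' where c'': "c'' \<in> ln x x''" "co a c''" using perp_meets[OF aP m''(1)] by blast
  have xc: "co x c" "co x' c" "co x c''" "co x'' c''" using line_co m m'' c c'' by blast+
  have ucc: "co u c" "co u c''" using no[OF c(2)] no''[OF c''(2)] xc by blast+
  have cx: "c \<noteq> x" "c'' \<noteq> x" using ucc xu by blast+
  have cc: "c'' \<noteq> c"
    using line_unique[OF m(1) m''(1) m(2) c(1) m''(2)] c'' cx m'' ne(2) by metis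
  \<comment> \<open>Inside the section of \<open>a\<close> and \<open>x\<close>, the perps of
    \<open>c\<close> and \<open>c''\<close> lie in that of \<open>u\<close> (\<open>A\<close>,
    \<open>B\<close>). As \<open>x\<close> is good, the latter is not the whole section, and
    \<open>section_generated\<close> puts it into the perp of \<open>c\<close> (\<open>C\<close>).
    So the perp of \<open>c''\<close> lies in the perp of \<open>c\<close>, which
    \<open>section_separates_in_perp\<close> forbids.\<close>
  have A: "co u y" if y: "co a y" "co x y" "co c y" for y
    using no[OF y(1,2)] perp_line[OF m(1) m(2) c(1) cx(1)[symmetric] _ _ m(3), of y] y co_sym by blast
  have B: "co u y" if y: "co a y" "co x y" "co c'' y" for y
    using no''[OF y(1,2)] perp_line[OF m''(1) m''(2) c''(1) cx(2)[symmetric] _ _ m''(3), of y] y co_sym by blast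
  obtain y0 where y0: "co a y0" "co x y0" "\<not> co u y0" using good unfolding bad_def by blast
  have C: "co c y" if y: "co a y" "co x y" "co u y" for y
  proof (rule ccontr)
    assume n: "\<not> co c y"
    have "y0 \<in> perp \<Delta> u"
      by (rule section_generated[OF perp_subspace[OF uP] ax c(2) xc(1) y(1,2) _ n _ y0(1,2)])
        (use y A in \<open>auto simp: perp_def\<close>)
    then show False using y0 unfolding perp_def by blast
  qed
  obtain y where "co x y" "co a y" "co c'' y" "\<not> co c y"
    using section_separates_in_perp[OF oppD(6)[OF ax] xc(3) c''(2) xc(1) c(2) cc] by blast
  then show False using B C by blast
qed

text \<open>Each point of the section of a bad point with \<open>u\<close> is collinear to
  \<open>a\<close> (\<open>S\<close>). Two collinear bad points therefore share their section with
  \<open>u\<close>, and the cone point \<open>e\<close> of their line would be collinear to all of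
  it.\<close>

lemma bad_unique:
  assumes x: "opp u x1" "opp u x2" "bad x1" "bad x2" "co x1 x2"
  shows "x1 = x2"
proof (rule ccontr)
  assume ne: "x1 \<noteq> x2"
  note l = ln_props[OF x(5) ne]
  have S: "co a c" if "opp u x" "bad x" "co u c" "co x c" for x c
  proof -
    have xc: "x \<noteq> c" using that oppD by blast
    note m = ln_props[OF that(4) xc]
    obtain e where e: "e \<in> ln x c" "co a e" using perp_meets[OF oppD(2)[OF ua] m(1)] by blast
    have "co u e" using that(2) e line_co m unfolding bad_def by blast
    then have "e = c" using line_opp_unique[OF m(1,2) oppD(3)[OF that(1)]] e m that by blast
    then show ?thesis using e by blast
  qed
  obtain e where e: "e \<in> ln x1 x2" "co u e" using perp_meets[OF oppD(1)[OF ua] l(1)] by blast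
  have "co x1 e" using line_co l e by blast
  then obtain d where d: "co u d" "co x1 d" "\<not> co d e" using section_separates[OF x(1) e(2)] by blast
  have ud: "u \<noteq> d" using d x(1) oppD by blast
  note k = ln_props[OF d(1) ud]
  obtain d2 where d2: "d2 \<in> ln u d" "co x2 d2" using perp_meets[OF oppD(2)[OF x(2)] k(1)] by blast
  have "co a d2" using S[OF x(2,4) _ d2(2)] line_co k d2 by blast
  moreover have "co a d" using S[OF x(1,3) d(1,2)] .
  ultimately have "d2 = d" using line_opp_unique[OF k(1,2)] oppD(4)[OF ua] d2 k by blast
  then show False using ln_perp[OF x(5) ne _ _ e(1), of d] d d2 co_sym by blast
qed

text \<open>If \<open>a\<close>, \<open>x\<close>, \<open>x'\<close> have no common neighbour off
  the cone, the edge is replaced by a detour over a point \<open>h\<close> coplanar with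
  \<open>x\<close> and \<open>x'\<close> and opposite \<open>u\<close>. Since \<open>x\<close> and
  \<open>x'\<close> are good, \<open>ex_common\<close> provides such neighbours for both new edges,
  and the triangle closes up.\<close>

lemma near_edge:
  assumes n: "near x w" and gd: "\<not> bad x'" and l: "lift x w x' w'"
  shows "near x' w'"
proof (cases "\<exists>y. co a y \<and> co x y \<and> co x' y \<and> \<not> co u y")
  case True then show ?thesis using near_edge_common[OF n l] by blast
next
  case False
  then have no: "\<And>y. co a y \<Longrightarrow> co x y \<Longrightarrow> co x' y \<Longrightarrow> co u y" by blast
  show ?thesis
  proof (cases "x = x'")
    case True then show ?thesis using l n unfolding lift_def by blast
  next
    case ne: False
    have r: "rel x w" "rel x' w'" using l lift_rel by blast+
    note xo = relD(1)[OF r(1)] and x'o = relD(1)[OF r(2)]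
    note uP = oppD(1)[OF ua] and xx' = lift_co[OF l]
    note m = ln_props[OF xx' ne]
    obtain f where f: "f \<in> P" "f \<notin> ln x x'" "\<And>y. y \<in> ln x x' \<Longrightarrow> co f y" using ex_coplanar[OF m(1)] by blast
    have xf: "co x f" "x \<noteq> f" using f m co_sym by blast+
    note k = ln_props[OF xf]
    obtain e where e: "e \<in> ln x f" "co u e" using perp_meets[OF uP k(1)] by blast
    obtain f1 where f1: "f1 \<in> ln x f" "f1 \<noteq> x" "f1 \<noteq> e" using third_point[OF k(1)] by blast
    have uf1: "\<not> co u f1" using line_opp_unique[OF k(1,2) oppD(3)[OF xo]] e f1 by blast
    have f1m: "co f1 y" if "y \<in> ln x x'" for y
      using ln_perp[OF xf, of y f1] f that line_co[OF m(1)] m(2) f1(1) co_sym by blast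
    have f1n: "f1 \<notin> ln x x'" using line_unique[OF k(1) m(1) k(2) f1(1) m(2)] f1(2) f(2) k(3) by blast
    obtain c where c: "c \<in> ln x x'" "co u c" using perp_meets[OF uP m(1)] by blast
    have cf1: "co c f1" "c \<noteq> f1" using f1m[OF c(1)] co_sym c uf1 by blast+
    note j = ln_props[OF cf1]
    \<comment> \<open>The line from \<open>f1\<close> to the cone point \<open>c\<close> of
      \<open>x x'\<close> has a further point off the cone; two collinear points opposite
      \<open>u\<close> are not both bad.\<close>
    obtain f2 where f2: "f2 \<in> ln c f1" "f2 \<noteq> c" "f2 \<noteq> f1" using third_point[OF j(1)] by blast
    have uf2: "\<not> co u f2" using line_opp_unique[OF j(1,3) uf1] c f2 j by blast
    have f2m: "co f2 y" if "y \<in> ln x x'" for y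
      using ln_perp[OF cf1, of y f2] f1m that line_co[OF m(1)] c(1) f2(1) co_sym by blast
    have f2n: "f2 \<notin> ln x x'" using line_unique[OF j(1) m(1) j(2) f2(1) c(1)] f2(2) f1n j(3) by blast
    have o: "opp u f1" "opp u f2" using uf1 uf2 uP line_P[OF k(1) f1(1)] line_P[OF j(1) f2(1)] unfolding opp_def by blast+
    have "f1 \<noteq> f2" "co f1 f2" using f2 line_co j by blast+
    then have "\<not> bad f1 \<or> \<not> bad f2" using bad_unique[OF o] by blast
    then obtain h where h: "opp u h" "\<not> bad h" "h \<notin> ln x x'" "co h x" "co h x'"
      using o f1n f2n f1m f2m m by blast
    have hs: "co x h" "co x' h" using h co_sym by blast+
    obtain y1 where y1: "co a y1" "co x y1" "co h y1" "\<not> co u y1"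
      using ex_common[OF xo x'o h(1) xx' hs ne h(3) near_not_bad[OF n]] no by metis
    obtain y2 where y2: "co a y2" "co x' y2" "co h y2" "\<not> co u y2"
      using ex_common[OF x'o xo h(1) co_sym[OF xx'] hs(2,1) ne[symmetric] _ gd] no h(3) ln_sym by metis
    obtain v where v: "lift x w h v" using lift_ex[OF r(1) h(1) hs(1)] .
    have nh: "near h v" using near_edge_common[OF n v y1] .
    have "lift h v x' w'" using lift_triangle[OF lift_sym[OF v] l h(5)] .
    then show ?thesis using near_edge_common[OF nh _ y2(1,3,2,4)] by blast
  qed
qed

text \<open>Paths of length two never end in a bad point, so its image is taken along one more edge
  from a neighbour that already has one.\<close>

definition far :: "'a \<Rightarrow> 'a \<Rightarrow> bool" where
  "far x w \<longleftrightarrow> (\<exists>x' w'. near x' w' \<and> lift x' w' x w)"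

definition ext_rel :: "'a \<Rightarrow> 'a \<Rightarrow> bool" where
  "ext_rel x w \<longleftrightarrow> (if bad x then far x w else near x w)"

text \<open>Two collinear good neighbours of \<open>x\<close> give the same value by a triangle. If
  they are opposite, a point \<open>x3\<close> collinear to \<open>x\<close> and to both links them;
  it is good because \<open>x\<close> is a collinear bad point.\<close>

lemma far_unique:
  assumes b: "bad x" and "far x w" "far x v" shows "w = v"
proof -
  have main: "w = v" if m: "near x1 w1" "lift x1 w1 x w" "near x2 w2" "lift x2 w2 x v" "co x1 x2" for x1 w1 w x2 w2 v
  proof -
    obtain w3 where w3: "lift x1 w1 x2 w3"
      using lift_ex[OF near_rel[OF m(1)] relD(1)[OF near_rel[OF m(3)]] m(5)] .
    then have "w3 = w2" using near_unique near_edge[OF m(1) near_not_bad[OF m(3)]] m(3) by blast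
    then have "lift x1 w1 x v" using lift_triangle w3 m lift_co by blast
    then show ?thesis using lift_unique m by blast
  qed
  obtain x1 w1 where 1: "near x1 w1" "lift x1 w1 x w" using assms unfolding far_def by blast
  obtain x2 w2 where 2: "near x2 w2" "lift x2 w2 x v" using assms unfolding far_def by blast
  show ?thesis
  proof (cases "co x1 x2")
    case True then show ?thesis using main 1 2 by blast
  next
    case False
    have xx: "co x x1" "co x x2" "co x1 x" "co x2 x" using lift_co 1 2 co_sym by blast+
    have o: "opp x1 x2" using False co_P xx unfolding opp_def by blast
    have ne: "x \<noteq> x1" using b 1 near_not_bad by blast
    have xu: "opp u x" using 1 lift_rel relD by blast
    note l = ln_props[OF xx(1) ne]
    obtain f where f: "f \<in> P" "f \<notin> ln x x1" "\<And>y. y \<in> ln x x1 \<Longrightarrow> co f y" using ex_coplanar[OF l(1)] by blast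
    have f1: "co x1 f" "x1 \<noteq> f" "co x f" using f l co_sym by blast+
    \<comment> \<open>Sliding \<open>f\<close> into the perp of \<open>x2\<close> gives a point
      collinear to \<open>x\<close>, \<open>x1\<close> and \<open>x2\<close>. So every point of the
      line from \<open>x\<close> to it is collinear to \<open>x1\<close> and \<open>x2\<close>, and
      a third one is off the cone.\<close>
    obtain e where e: "e \<in> ln x1 f" "co x2 e" "e \<noteq> x1" "co x1 e" "e \<in> P" "\<And>q. co q x1 \<Longrightarrow> co q e \<longleftrightarrow> co q f"
      using proj[OF f1(1,2) o] by metis
    have xe: "co x e" "x \<noteq> e"
      using e(6)[OF xx(1)] f1 ln_move[OF f1(1,2) e(1,3)] ln_props(3)[OF f1(1,2)] f(2) ln_sym by metis+
    note k = ln_props[OF xe]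
    obtain s where s: "s \<in> ln x e" "co u s" using perp_meets[OF oppD(1)[OF xu] k(1)] by blast
    obtain x3 where x3: "x3 \<in> ln x e" "x3 \<noteq> x" "x3 \<noteq> s" using third_point[OF k(1)] by blast
    have "\<not> co u x3" using line_opp_unique[OF k(1,2) oppD(3)[OF xu]] s x3 by blast
    then have ux3: "opp u x3" using oppD(1)[OF xu] line_P[OF k(1) x3(1)] unfolding opp_def by blast
    have c3: "co x3 x" "co x1 x3" "co x2 x3"
      using line_co k x3 ln_perp[OF xe xx(3) e(4) x3(1)] ln_perp[OF xe xx(4) e(2) x3(1)] by blast+
    have "\<not> bad x3" using bad_unique[OF ux3 xu _ b c3(1)] x3 by blast
    then obtain w3 where w3: "near x3 w3" using near_ex[OF ux3] by blast
    obtain z where z: "lift x3 w3 x z" using lift_ex[OF near_rel[OF w3] xu c3(1)] .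
    show ?thesis using main[OF 1 w3 z c3(2)] main[OF 2 w3 z c3(3)] by simp
  qed
qed

lemma ext_rel_unique: "ext_rel x w \<Longrightarrow> ext_rel x v \<Longrightarrow> w = v"
  unfolding ext_rel_def using far_unique near_unique by (auto split: if_splits)

lemma ext_rel_rel: "ext_rel x w \<Longrightarrow> rel x w"
  unfolding ext_rel_def far_def using near_rel lift_rel by (auto split: if_splits)

text \<open>A proper edge has at most one bad end. If this is its start, the lift is read backwards
  from the good end, and \<open>far_unique\<close> identifies the values.\<close>

lemma ext_rel_edge:
  assumes e: "ext_rel x w" and l: "lift x w x' w'" shows "ext_rel x' w'"
proof (cases "bad x")
  case False
  then have n: "near x w" using e unfolding ext_rel_def by simp
  then show ?thesis unfolding ext_rel_def far_def using near_edge[OF n _ l] l by auto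
next
  case True
  have o: "opp u x" "opp u x'" using l lift_rel relD(1) by blast+
  show ?thesis
  proof (cases "bad x'")
    case b: True
    then have "x = x'" using bad_unique[OF o True] lift_co[OF l] by blast
    then show ?thesis using l e unfolding lift_def by blast
  next
    case False
    then obtain w1 where w1: "near x' w1" using near_ex[OF o(2)] by blast
    obtain w2 where w2: "lift x' w1 x w2" using lift_ex[OF near_rel[OF w1] o(1) co_sym[OF lift_co[OF l]]] .
    then have "far x w2" using w1 unfolding far_def by blast
    then have "w2 = w" using far_unique[OF True] e True unfolding ext_rel_def by simp
    then have "w' = w1" using lift_unique[OF l] lift_sym[OF w2] by blast
    then show ?thesis using w1 False unfolding ext_rel_def by simp
  qed
qed

lemma ext_rel_ex:
  assumes o: "opp u x" obtains w where "ext_rel x w"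
proof (cases "bad x")
  case False then show ?thesis using near_ex[OF o] that unfolding ext_rel_def by auto
next
  case True
  obtain y where y: "co x y" "y \<noteq> x" using ex_neighbour[OF oppD(2)[OF o]] by blast
  note k = ln_props[OF y(1) y(2)[symmetric]]
  obtain s where s: "s \<in> ln x y" "co u s" using perp_meets[OF oppD(1)[OF o] k(1)] by blast
  obtain x' where x': "x' \<in> ln x y" "x' \<noteq> x" "x' \<noteq> s" using third_point[OF k(1)] by blast
  have "\<not> co u x'" using line_opp_unique[OF k(1,2) oppD(3)[OF o]] s x' by blast
  then have o': "opp u x'" using oppD(1)[OF o] line_P[OF k(1) x'(1)] unfolding opp_def by blast
  have c: "co x' x" using line_co k x' by blast
  have "\<not> bad x'" using bad_unique[OF o' o _ True c] x' by blast
  then obtain w' where w': "near x' w'" using near_ex[OF o'] by blast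
  obtain w where "lift x' w' x w" using lift_ex[OF near_rel[OF w'] o c] .
  then show ?thesis using that w' True unfolding ext_rel_def far_def by auto
qed

lemma ext_rel_base: "ext_rel a b"
proof -
  have "near a b" unfolding near_def using lift_refl rel_ab by blast
  then show ?thesis unfolding ext_rel_def using near_not_bad by simp
qed

text \<open>The last branch is the identity outside the carrier, as \<open>permutes\<close> in
  \<open>collineation\<close> demands.\<close>

definition ext :: "'a \<Rightarrow> 'a" where
  "ext x = (if co u x then g x else if x \<in> P then THE w. ext_rel x w else x)"

lemma ext_cone: "co u x \<Longrightarrow> ext x = g x"
  unfolding ext_def by simp

lemma ext_opp: assumes "ext_rel x w" shows "ext x = w"
proof -
  have "opp u x" using ext_rel_rel relD(1) assms by blast
  then have "ext x = (THE w. ext_rel x w)" unfolding ext_def opp_def by simp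
  also have "\<dots> = w" using ext_rel_unique assms by blast
  finally show ?thesis .
qed

lemma ext_line:
  assumes l: "l \<in> L" "x \<in> l" "opp u x" and x': "x' \<in> l" and c: "c \<in> l" "co u c"
    and w: "ext_rel x w"
  shows "ext x' \<in> ln w (g c)" "co w (g c)" "w \<noteq> g c"
proof -
  note r = ext_rel_rel[OF w]
  show wc: "co w (g c)" "w \<noteq> g c"
    using relD(3)[OF r c(2)] line_co l c g_co_u(1)[OF c(2)] oppD[OF relD(2)[OF r]] by blast+
  show "ext x' \<in> ln w (g c)"
  proof (cases "x' = x \<or> x' = c")
    case True
    then show ?thesis using ext_opp[OF w] ext_cone[OF c(2)] ln_props[OF wc] by auto
  next
    case False
    have "\<not> co u x'" using line_opp_unique[OF l(1,2) oppD(3)[OF l(3)]] x' c False by blast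
    then have o: "opp u x'" using oppD(1)[OF l(3)] line_P[OF l(1) x'] unfolding opp_def by blast
    obtain w' where w': "lift x w x' w'" using lift_ex[OF r o line_co[OF l(1,2) x']] .
    obtain c1 where c1: "c1 \<in> ln x x'" "co u c1" "w' \<in> ln w (g c1)"
      using lift_point[OF w'] False by metis
    have "c1 \<in> l" using c1 ln_eq[OF l(1,2) x'] False by metis
    then have "c1 = c" using line_opp_unique[OF l(1,2) oppD(3)[OF l(3)]] c c1 by blast
    then show ?thesis using ext_opp[OF ext_rel_edge[OF w w']] c1 by simp
  qed
qed

end

text \<open>Only the section condition is not symmetric in form; it passes to \<open>g'\<close>
  because \<open>rel_iff\<close> turns the inclusion of sections into an equality.\<close>

sublocale cone_extension \<subseteq> inverse: cone_extension \<Delta> n u b a g' g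
proof unfold_locales
  fix c assume c: "co u c" "co b c"
  have "co b (g (g' c))" using c g_inv by simp
  then show "co a (g' c)" using rel_iff[OF rel_ab g_co_u(2)[OF c(1)]] by blast
qed (use ua ub g_u g_inv g_ln g_line in auto)

context cone_extension
begin

lemma rel_inverse: "rel x w \<Longrightarrow> inverse.rel w x"
  unfolding inverse.rel_def
  using relD(1,2) rel_iff[of x w "g' _"] g_co_u(2) g_inv(2) by metis

lemma lift_inverse:
  assumes "lift x w x' w'" shows "inverse.lift w x w' x'"
proof (cases "x = x'")
  case True then show ?thesis using assms rel_inverse unfolding lift_def inverse.lift_def by blast
next
  case False
  then obtain c where "c \<in> ln x x'" "co u c" "g c \<in> ln w w'" using assms unfolding lift_def by blast
  then have "g c \<in> ln w w' \<and> co u (g c) \<and> g' (g c) \<in> ln x x'" using g_co_u g_inv by simp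
  then show ?thesis
    using assms rel_inverse False unfolding lift_def inverse.lift_def by blast
qed

lemma near_inverse: "near x w \<Longrightarrow> inverse.ext_rel w x"
  unfolding near_def
  using lift_inverse inverse.ext_rel_edge inverse.ext_rel_base by blast

lemma ext_rel_inverse: "ext_rel x w \<Longrightarrow> inverse.ext_rel w x"
  unfolding ext_rel_def far_def
  using near_inverse lift_inverse inverse.ext_rel_edge by (auto split: if_splits) blast

lemma ext_inverse: "inverse.ext (ext x) = x"
proof -
  consider "co u x" | "opp u x" | "x \<notin> P" using oppD(1)[OF ua] unfolding opp_def by blast
  then show ?thesis
  proof cases
    case 1
    then show ?thesis using ext_cone inverse.ext_cone[OF g_co_u(1)[OF 1]] g_inv by simp
  next
    case 2
    then obtain w where w: "ext_rel x w" by (rule ext_rel_ex)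
    then show ?thesis using ext_opp inverse.ext_opp[OF ext_rel_inverse[OF w]] by simp
  next
    case 3
    then have "\<not> co u x" using co_P by blast
    then show ?thesis using 3 unfolding ext_def inverse.ext_def by simp
  qed
qed

end

context cone_extension
begin

text \<open>\<open>ext_line\<close> places the image inside a line; the same statement for the
  inverse extension shows that it fills this line.\<close>

lemma ext_image_line: assumes l: "l \<in> L" shows "ext ` l \<in> L"
proof (cases "\<forall>x\<in>l. co u x")
  case True
  then have "ext ` l = g ` l" using ext_cone by simp
  then show ?thesis using g_line(1)[OF l] True by simp
next
  case False
  then obtain x where x: "x \<in> l" "\<not> co u x" by blast
  then have o: "opp u x" using oppD(1)[OF ua] line_P[OF l] unfolding opp_def by blast
  obtain c where c: "c \<in> l" "co u c" using perp_meets[OF oppD(1)[OF ua] l] by blast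
  obtain w where w: "ext_rel x w" using ext_rel_ex[OF o] .
  note e = ext_line[OF l x(1) o _ c w]
  have wc: "co w (g c)" "w \<noteq> g c" using e[OF x(1)] by blast+
  note m = ln_props[OF wc]
  have "ln x c = l" using ln_eq[OF l x(1) c(1)] x c by blast
  then have inv: "inverse.ext y \<in> l" if "y \<in> ln w (g c)" for y
    using inverse.ext_line(1)[OF m(1,2) relD(2)[OF ext_rel_rel[OF w]] that m(3) g_co_u(1)[OF c(2)]
        ext_rel_inverse[OF w]] g_inv(1)[OF c(2)] by simp
  have "ext ` l = ln w (g c)"
  proof
    show "ext ` l \<subseteq> ln w (g c)" using e(1) by blast
    show "ln w (g c) \<subseteq> ext ` l"
    proof
      fix y assume "y \<in> ln w (g c)"
      then have "inverse.ext y \<in> l" "ext (inverse.ext y) = y" using inv inverse.ext_inverse by blast+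
      then show "y \<in> ext ` l" by (metis imageI)
    qed
  qed
  then show ?thesis using m by simp
qed

end

context cone_extension
begin

lemma ext_collineation: "collineation \<Delta> ext"
proof -
  have bij: "\<exists>!x. ext x = y" for y
    using ext_inverse inverse.ext_inverse by metis
  have out: "ext x = x" if "x \<notin> P" for x using that co_P unfolding ext_def by auto
  then have "ext permutes P" unfolding permutes_def using bij by blast
  moreover have "bij_betw ((`) ext) L L"
    unfolding bij_betw_def
  proof
    have "inj ext" by (metis injI ext_inverse)
    then show "inj_on ((`) ext) L" using inj_image_eq_iff by (metis inj_onI)
    show "(`) ext ` L = L"
    proof
      show "(`) ext ` L \<subseteq> L" using ext_image_line by blast
      show "L \<subseteq> (`) ext ` L"
      proof
        fix l assume "l \<in> L"
        then have "inverse.ext ` l \<in> L" "ext ` inverse.ext ` l = l"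
          using inverse.ext_image_line inverse.ext_inverse by (auto simp: image_image)
        then show "l \<in> (`) ext ` L" by (metis imageI)
      qed
    qed
  qed
  ultimately show ?thesis unfolding collineation_def by blast
qed

lemma ext_base: "ext a = b"
  using ext_opp ext_rel_base by blast

end

section \<open>Dualities between opposite planes\<close>

context thick_polar_space
begin

definition trace :: "'a set \<Rightarrow> 'a \<Rightarrow> 'a set" where
  "trace \<rho> x = {r \<in> \<rho>. co x r}"

definition opp_planes :: "'a set \<Rightarrow> 'a set \<Rightarrow> bool" where
  "opp_planes \<pi> \<rho> \<longleftrightarrow> plane \<pi> \<and> plane \<rho> \<and> (\<forall>p\<in>\<pi>. \<exists>r\<in>\<rho>. \<not> co p r) \<and> (\<forall>r\<in>\<rho>. \<exists>p\<in>\<pi>. \<not> co r p)"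

text \<open>A duality onto \<open>\<rho>\<close> followed by the inverse of a duality from
  \<open>\<pi>\<close> to \<open>\<rho>\<close>, so points go to points. The plane of
  \<open>x\<close> is no argument since only the trace counts; this helps to compare maps of
  different planes.\<close>

definition transfer :: "'a set \<Rightarrow> 'a set \<Rightarrow> 'a \<Rightarrow> 'a" where
  "transfer \<rho> \<pi> x = (THE z. z \<in> \<pi> \<and> trace \<rho> z = trace \<rho> x)"

lemma opp_planes_plane: "opp_planes \<pi> \<rho> \<Longrightarrow> plane \<pi>" "opp_planes \<pi> \<rho> \<Longrightarrow> plane \<rho>"
  unfolding opp_planes_def by blast+

lemma trace_line:
  assumes "opp_planes \<pi> \<rho>" "x \<in> \<pi>" shows "trace \<rho> x \<in> L" "trace \<rho> x \<subseteq> \<rho>"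
proof -
  obtain r where "r \<in> \<rho>" "\<not> co x r" using assms unfolding opp_planes_def by blast
  then show "trace \<rho> x \<in> L" unfolding trace_def
    using plane_perp_line[OF opp_planes_plane(2)[OF assms(1)] plane_P[OF opp_planes_plane(1)[OF assms(1)] assms(2)]]
    by blast
  show "trace \<rho> x \<subseteq> \<rho>" unfolding trace_def by blast
qed

lemma dual_line:
  assumes "opp_planes \<pi> \<rho>" "r \<in> \<rho>" shows "{y \<in> \<pi>. co r y} \<in> L"
proof -
  obtain p where "p \<in> \<pi>" "\<not> co r p" using assms unfolding opp_planes_def by blast
  then show ?thesis
    using plane_perp_line[OF opp_planes_plane(1)[OF assms(1)] plane_P[OF opp_planes_plane(2)[OF assms(1)] assms(2)]]
    by blast
qed

text \<open>On the line joining two points with equal traces some point is collinear to a further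
  point \<open>r\<close> of \<open>\<rho>\<close>, hence to all of \<open>\<rho>\<close>.\<close>

lemma trace_inj:
  assumes o: "opp_planes \<pi> \<rho>" and x: "x \<in> \<pi>" "z \<in> \<pi>" "trace \<rho> x = trace \<rho> z"
  shows "x = z"
proof (rule ccontr)
  assume ne: "x \<noteq> z"
  note pl = opp_planes_plane[OF o] and t = trace_line[OF o x(1)]
  obtain r where r: "r \<in> \<rho>" "r \<notin> trace \<rho> x" using plane_off_line[OF pl(2) t] by blast
  note k = plane_ln[OF pl(1) x(1,2) ne]
  obtain y where y: "y \<in> ln x z" "co r y" using perp_meets[OF plane_P[OF pl(2) r(1)] k(1)] by blast
  have "co y s" if "s \<in> trace \<rho> x" for s
  proof -
    have "co s x" "co s z" using that x(3) co_sym unfolding trace_def by blast+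
    then show ?thesis using ln_perp[OF k(5) ne _ _ y(1)] co_sym by blast
  qed
  then have "co y s" if "s \<in> \<rho>" for s
    using plane_cover[OF pl(2) t r _ co_sym[OF y(2)] that] by blast
  moreover have "y \<in> \<pi>" using y k by blast
  ultimately show False using o unfolding opp_planes_def by blast
qed

lemma trace_surj:
  assumes o: "opp_planes \<pi> \<rho>" and l: "l \<in> L" "l \<subseteq> \<rho>"
  obtains x where "x \<in> \<pi>" "trace \<rho> x = l"
proof -
  note pl = opp_planes_plane[OF o]
  obtain r1 where r1: "r1 \<in> l" using third_point[OF l(1)] by blast
  obtain r2 where r2: "r2 \<in> l" "r2 \<noteq> r1" using third_point[OF l(1)] by blast
  have "{y \<in> \<pi>. co r1 y} \<in> L" "{y \<in> \<pi>. co r2 y} \<in> L" using dual_line[OF o] r1 r2 l by blast+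
  then obtain x where x: "x \<in> {y \<in> \<pi>. co r1 y}" "x \<in> {y \<in> \<pi>. co r2 y}"
    using plane_meet[OF pl(1), of "{y \<in> \<pi>. co r1 y}" "{y \<in> \<pi>. co r2 y}"] by blast
  then have c: "co x r1" "co x r2" "x \<in> \<pi>" using co_sym by blast+
  have "l \<subseteq> trace \<rho> x"
    using perp_line[OF l(1) r1 r2(1) r2(2)[symmetric] c(1,2)] l(2) unfolding trace_def by blast
  then have "l = trace \<rho> x" using line_subset_eq[OF l(1) trace_line(1)[OF o c(3)]] by blast
  then show ?thesis using that c by blast
qed

lemma transfer_props:
  assumes "opp_planes \<pi> \<rho>" "opp_planes \<pi>' \<rho>" "x \<in> \<pi>"
  shows "transfer \<rho> \<pi>' x \<in> \<pi>'" "trace \<rho> (transfer \<rho> \<pi>' x) = trace \<rho> x"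
proof -
  obtain z where z: "z \<in> \<pi>'" "trace \<rho> z = trace \<rho> x"
    using trace_surj[OF assms(2) trace_line[OF assms(1,3)]] .
  then have "\<exists>!z. z \<in> \<pi>' \<and> trace \<rho> z = trace \<rho> x" using trace_inj[OF assms(2)] by metis
  then have "transfer \<rho> \<pi>' x \<in> \<pi>' \<and> trace \<rho> (transfer \<rho> \<pi>' x) = trace \<rho> x"
    unfolding transfer_def by (rule theI')
  then show "transfer \<rho> \<pi>' x \<in> \<pi>'" "trace \<rho> (transfer \<rho> \<pi>' x) = trace \<rho> x" by auto
qed

lemma transfer_eq:
  assumes "opp_planes \<pi>' \<rho>" "z \<in> \<pi>'" "trace \<rho> z = trace \<rho> x"
  shows "transfer \<rho> \<pi>' x = z"
  unfolding transfer_def using assms trace_inj[OF assms(1)] by (intro the_equality) auto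

lemma transfer_bij:
  assumes "opp_planes \<pi> \<rho>" "opp_planes \<pi>' \<rho>"
  shows "bij_betw (transfer \<rho> \<pi>') \<pi> \<pi>'"
  by (rule bij_betwI[of _ _ _ "transfer \<rho> \<pi>"])
    (use transfer_props[OF assms] transfer_props[OF assms(2,1)] transfer_eq[OF assms(1)] transfer_eq[OF assms(2)] in auto)

text \<open>\<open>k\<close> is cut out of \<open>\<pi>\<close> by the perp of one point of
  \<open>\<rho>\<close>, namely the common point \<open>r\<close> of the traces of two points of
  \<open>k\<close>. Its image is cut out of \<open>\<pi>'\<close> by the same
  \<open>r\<close>.\<close>

lemma transfer_image_line:
  assumes o: "opp_planes \<pi> \<rho>" "opp_planes \<pi>' \<rho>" and k: "k \<in> L" "k \<subseteq> \<pi>"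
  shows "transfer \<rho> \<pi>' ` k \<in> L" "transfer \<rho> \<pi>' ` k \<subseteq> \<pi>'"
proof -
  show sub: "transfer \<rho> \<pi>' ` k \<subseteq> \<pi>'" using transfer_props[OF o] k by blast
  note pl = opp_planes_plane[OF o(1)]
  obtain x1 where x1: "x1 \<in> k" using third_point[OF k(1)] by blast
  obtain x2 where x2: "x2 \<in> k" "x2 \<noteq> x1" using third_point[OF k(1)] by blast
  have x\<pi>: "x1 \<in> \<pi>" "x2 \<in> \<pi>" using x1 x2 k by blast+
  obtain r where r: "r \<in> trace \<rho> x1" "r \<in> trace \<rho> x2"
    using plane_meet[OF pl(2) trace_line[OF o(1) x\<pi>(1)] trace_line[OF o(1) x\<pi>(2)]] .
  then have rr: "r \<in> \<rho>" "co r x1" "co r x2" using co_sym unfolding trace_def by blast+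
  have "k \<subseteq> {y \<in> \<pi>. co r y}"
    using perp_line[OF k(1) x1 x2(1) x2(2)[symmetric] rr(2,3)] k(2) by blast
  then have k_eq: "k = {y \<in> \<pi>. co r y}" using line_subset_eq[OF k(1) dual_line[OF o(1) rr(1)]] by blast
  have "transfer \<rho> \<pi>' ` k = {y \<in> \<pi>'. co r y}"
  proof
    show "transfer \<rho> \<pi>' ` k \<subseteq> {y \<in> \<pi>'. co r y}"
    proof
      fix z assume "z \<in> transfer \<rho> \<pi>' ` k"
      then obtain x where x: "x \<in> \<pi>" "co r x" "z = transfer \<rho> \<pi>' x" using k_eq by blast
      then have "r \<in> trace \<rho> x" using rr co_sym unfolding trace_def by blast
      then have "r \<in> trace \<rho> z" using transfer_props[OF o x(1)] x(3) by simp
      then show "z \<in> {y \<in> \<pi>'. co r y}" using transfer_props[OF o x(1)] x(3) co_sym unfolding trace_def by blast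
    qed
    show "{y \<in> \<pi>'. co r y} \<subseteq> transfer \<rho> \<pi>' ` k"
    proof
      fix z assume z: "z \<in> {y \<in> \<pi>'. co r y}"
      let ?x = "transfer \<rho> \<pi> z"
      have x: "?x \<in> \<pi>" "trace \<rho> ?x = trace \<rho> z" using transfer_props[OF o(2,1)] z by blast+
      have "r \<in> trace \<rho> z" using z rr co_sym unfolding trace_def by blast
      then have "r \<in> trace \<rho> ?x" using x by simp
      then have "?x \<in> k" using k_eq x co_sym unfolding trace_def by blast
      moreover have "z = transfer \<rho> \<pi>' ?x" using transfer_eq[OF o(2), of z ?x] z x by simp
      ultimately show "z \<in> transfer \<rho> \<pi>' ` k" by blast
    qed
  qed
  then show "transfer \<rho> \<pi>' ` k \<in> L" using dual_line[OF o(2) rr(1)] by simp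
qed

text \<open>A point of \<open>\<pi>\<close> collinear to all of \<open>\<rho>\<close> is on
  \<open>u q\<close> because of \<open>b\<close>, equals \<open>u\<close> because of
  \<open>k\<close>, and is excluded by \<open>y\<close>. Dually, \<open>u\<close> and
  \<open>q\<close> force a point of \<open>\<rho>\<close> to be \<open>b\<close>, and
  \<open>e\<close> excludes it.\<close>

lemma opp_planesI:
  assumes pi: "plane \<pi>" "u \<in> \<pi>" "q \<in> \<pi>" "e \<in> \<pi>" "u \<noteq> q"
    and rho: "plane \<rho>" "b \<in> \<rho>" "y \<in> \<rho>" "k \<in> \<rho>" "b \<noteq> k"
    and co: "co b u" "co b q" "\<not> co b e" "co k u" "\<not> co k q" "\<not> co y u"
  shows "opp_planes \<pi> \<rho>"
proof -
  note m = plane_ln[OF pi(1,2,3,5)] and h = plane_ln[OF rho(1,2,4,5)]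
  have bm: "co b x" if "x \<in> ln u q" for x using ln_perp[OF m(5) pi(5) co(1,2) that] .
  have uh: "co u x" if "x \<in> ln b k" for x
    using ln_perp[OF h(5) rho(5) _ _ that] co co_sym by blast
  have "\<exists>r\<in>\<rho>. \<not> co p r" if p: "p \<in> \<pi>" for p
  proof (rule ccontr)
    assume "\<not> ?thesis"
    then have a: "co b p" "co k p" "co y p" using rho co_sym by blast+
    have "p \<in> ln u q" by (rule plane_perp_exact[OF pi(1) m(1,4) bm pi(4) co(3) p a(1)])
    then have "p = u" using line_opp_unique[OF m(1,3) co(5)] m(2) a(2) co(4) by blast
    then show False using a co by blast
  qed
  moreover have "\<exists>p\<in>\<pi>. \<not> co r p" if r: "r \<in> \<rho>" for r
  proof (rule ccontr)
    assume "\<not> ?thesis"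
    then have a: "co u r" "co q r" "co r e" using pi co_sym by blast+
    have "r \<in> ln b k"
      by (rule plane_perp_exact[OF rho(1) h(1,4) uh rho(3) _ r a(1)]) (use co co_sym in auto)
    moreover have "\<not> co q k" "co q b" using co co_sym by blast+
    ultimately have "r = b" using line_opp_unique[OF h(1,3)] h(2) a(2) by blast
    then show False using a co by blast
  qed
  ultimately show ?thesis using pi rho unfolding opp_planes_def by blast
qed

definition elation :: "'a \<Rightarrow> 'a set \<Rightarrow> 'a set \<Rightarrow> ('a \<Rightarrow> 'a) \<Rightarrow> bool" where
  "elation u A \<pi> \<sigma> \<longleftrightarrow> plane \<pi> \<and> A \<in> L \<and> u \<in> A \<and> A \<subseteq> \<pi> \<and> bij_betw \<sigma> \<pi> \<pi> \<and>
     (\<forall>l\<in>L. l \<subseteq> \<pi> \<longrightarrow> \<sigma> ` l \<in> L) \<and> (\<forall>x\<in>A. \<sigma> x = x) \<and> (\<forall>x\<in>\<pi>. x \<noteq> u \<longrightarrow> \<sigma> x \<in> ln u x)"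

text \<open>\<open>\<rho>\<close> is spanned by \<open>b\<close>, \<open>y\<close>,
  \<open>k\<close>. As \<open>b\<close> and \<open>y\<close> are collinear to both \<open>q\<close>
  and \<open>z\<close>, these two points will have the same trace \<open>b y\<close>, so a transfer
  takes \<open>q\<close> to \<open>z\<close>. The other conditions serve \<open>opp_planesI\<close>,
  and \<open>k\<close> on \<open>u t\<close> ties \<open>\<rho>\<close> to the plane of
  \<open>u\<close>, \<open>b\<close>, \<open>t\<close>.\<close>

lemma ex_transfer_plane:
  assumes u: "co b u" "co q u" "co z u" and q: "co b q" "co b z" "opp q z" "q \<noteq> u"
    and n: "u \<notin> ln b q" "b \<noteq> q" and t: "co t u" "co t b" "opp t q" "opp t z"
  obtains \<rho> y k where "plane \<rho>" "b \<in> \<rho>" "y \<in> \<rho>" "k \<in> \<rho>" "b \<noteq> k" "k \<in> ln u t" "co k u"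
    "\<not> co k q" "\<not> co k z" "\<not> co y u" "co q y" "co z y" "b \<noteq> y"
proof -
  note l = ln_props[OF q(1) n(2)]
  obtain d where d: "\<And>p. p \<in> ln b q \<Longrightarrow> co d p" "opp d u"
    using ex_perp_opp[OF line_sing[OF l(1)] co_P(2)[OF u(1)] n(1)] by blast
  have qd: "co q d" "q \<noteq> d" using d(1)[OF l(3)] co_sym d(2) u(2) oppD by blast+
  have ub: "co u b" "co u q" "co u t" using u t co_sym by blast+
  obtain y where y: "co z y" "co q y" "\<And>p. co p q \<Longrightarrow> co p y \<longleftrightarrow> co p d"
    using proj[OF qd q(3)] by metis
  have yb: "co b y" using y(3)[OF q(1)] d(1)[OF l(2)] co_sym by blast
  have yu: "\<not> co y u" using y(3)[OF ub(2)] oppD(4)[OF d(2)] co_sym[of y u] by blast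
  have ut: "u \<noteq> t" using u t(3) co_sym oppD by blast
  note m = ln_props[OF ub(3) ut]
  obtain k where k: "k \<in> ln u t" "co y k" using perp_meets[OF co_P(2)[OF yb] m(1)] by blast
  have ku: "k \<noteq> u" "co k u" using k yu line_co[OF m(1)] m by blast+
  have no: "\<not> co k p" if "co p u" "opp t p" for p
    using perp_line[OF m(1) m(2) k(1) ku(1)[symmetric] that(1) _ m(3)] that co_sym oppD by blast
  have kq: "\<not> co k q" "\<not> co k z" using no u t by blast+
  have bk: "co b k" using perp_line[OF m(1-3) ut u(1) co_sym[OF t(2)] k(1)] .
  have bnk: "b \<noteq> k" using kq q by blast
  note h = ln_props[OF bk bnk]
  have yn: "y \<notin> ln b k" using ln_perp[OF bk bnk ub(1) co_sym[OF ku(2)]] yu co_sym by blast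
  have yc: "co y p" if "p \<in> ln b k" for p using ln_perp[OF bk bnk co_sym[OF yb] k(2) that] .
  show ?thesis
    by (rule that[OF planeI[OF h(1) yn yc] _ _ _ bnk k(1) ku(2) kq yu y(2,1)])
      (use join_self join_base[OF yn yc] h yn in blast)+
qed

text \<open>The elation is the composition \<open>\<pi> \<rightarrow> \<rho> \<rightarrow> \<pi>' \<rightarrow> \<rho>' \<rightarrow> \<pi>\<close> of four dualities between opposite
  planes. It fixes \<open>\<pi> \<inter> \<pi>' = ln u e\<close> pointwise; it fixes each line through \<open>u\<close> because
  \<open>\<rho>\<close> and \<open>\<rho>'\<close> meet the plane spanned by \<open>u\<close>, \<open>b\<close> and \<open>t\<close> in lines. On the line
  \<open>ln u x0\<close> the composition does not depend on \<open>\<pi>\<close>.\<close>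

lemma ex_elations:
  assumes u: "co u x0" "u \<noteq> x0" "x0' \<in> ln u x0" "x0' \<noteq> u"
    and z: "co u z" "\<not> co z x0" and b: "co b u" "co b x0" "co b z" "b \<noteq> u"
  shows "\<exists>\<tau>. \<forall>\<pi> e. plane \<pi> \<and> u \<in> \<pi> \<and> x0 \<in> \<pi> \<and> e \<in> \<pi> \<and> e \<noteq> u \<and> co z e \<and> \<not> co b e \<longrightarrow>
    (\<exists>\<sigma>. elation u (ln u e) \<pi> \<sigma> \<and> \<sigma> x0 = x0' \<and> (\<forall>x\<in>ln u x0. \<sigma> x = \<tau> x))"
proof -
  note m = ln_props[OF u(1,2)]
  have zP: "z \<in> P" using z co_P by blast
  have zu: "co z u" using z co_sym by blast
  have x0': "co x0' u" "co b x0'" "ln u x0' = ln u x0"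
    using line_co[OF m(1) u(3) m(2)] perp_line[OF m(1-3) u(2) b(1,2) u(3)] ln_move[OF u(1,2,3,4)] by auto
  have nz': "\<not> co z x0'" using perp_line[OF m(1,2) u(3) u(4)[symmetric] zu _ m(3)] z(2) by blast
  have o: "opp x0 z" "opp x0' z" using z(2) nz' co_sym co_P zP u(1) x0' unfolding opp_def by blast+
  have bm: "b \<notin> ln u x0"
    using perp_line[OF m(1,2) _ b(4)[symmetric] zu co_sym[OF b(3)] m(3)] z(2) by blast
  have ub: "co u b" "u \<noteq> b" using b co_sym by blast+
  note D = ln_props[OF ub]
  have "co x0 p" "co z p" if "p \<in> ln u b" for p
    using ln_perp[OF ub _ _ that] co_sym[OF u(1)] co_sym[OF b(2)] co_sym[OF b(3)] zu by blast+
  \<comment> \<open>\<open>t\<close> has to be opposite \<open>x0\<close>, \<open>x0'\<close> and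
    \<open>z\<close>, so that one line \<open>u t\<close> supplies both \<open>k\<close> and
    \<open>k'\<close>. Opposition to \<open>x0'\<close> follows from that to \<open>x0\<close>, as
    both are on a line through \<open>u\<close>.\<close>
  then obtain t where t: "\<And>d. d \<in> ln u b \<Longrightarrow> co t d" "opp t x0" "opp t z"
    using ex_opp_opp[OF line_sing[OF D(1)] _ _ o(1)] by blast
  have tt: "co t u" "co t b" using t(1) D by blast+
  have tx0': "opp t x0'"
    using perp_line[OF m(1,2) u(3) u(4)[symmetric] tt(1) _ m(3)] t(2) oppD co_P(1)[OF x0'(1)]
    unfolding opp_def by blast
  have nb: "u \<notin> ln b q" "b \<noteq> q" if "q \<in> ln u x0" "q \<noteq> u" for q
  proof -
    show bq: "b \<noteq> q" using bm that by blast
    have c: "co b q" using perp_line[OF m(1-3) u(2) b(1,2) that(1)] .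
    show "u \<notin> ln b q"
      using line_unique[OF ln_props(1)[OF c bq] m(1) _ ln_props(3)[OF c bq] m(2) that(1)]
        ln_props(2)[OF c bq] bm that(2) by blast
  qed
  obtain \<rho> y k where r: "plane \<rho>" "b \<in> \<rho>" "y \<in> \<rho>" "k \<in> \<rho>" "b \<noteq> k" "k \<in> ln u t" "co k u"
    "\<not> co k x0" "\<not> co k z" "\<not> co y u" "co x0 y" "co z y" "b \<noteq> y"
    using ex_transfer_plane[OF b(1) co_sym[OF u(1)] zu b(2,3) o(1) u(2)[symmetric] nb[OF m(3) u(2)[symmetric]] tt t(2,3)] .
  obtain \<rho>' y' k' where r': "plane \<rho>'" "b \<in> \<rho>'" "y' \<in> \<rho>'" "k' \<in> \<rho>'" "b \<noteq> k'" "k' \<in> ln u t" "co k' u"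
    "\<not> co k' x0'" "\<not> co k' z" "\<not> co y' u" "co x0' y'" "co z y'" "b \<noteq> y'"
    using ex_transfer_plane[OF b(1) x0'(1) zu x0'(2) b(3) o(2) u(4) nb[OF u(3,4)] tt tx0' t(3)] .
  \<comment> \<open>Only the line \<open>u z\<close> and the two auxiliary planes occur here: for
    every \<open>\<pi>\<close> the intermediate point falls on \<open>ln u z\<close>, although
    \<open>\<pi>'\<close> varies with \<open>e\<close>.\<close>
  define \<tau> where "\<tau> x = (THE x'. x' \<in> ln u x0 \<and> (\<exists>w\<in>ln u z. trace \<rho> w = trace \<rho> x \<and> trace \<rho>' w = trace \<rho>' x'))" for x
  have main: "\<exists>\<sigma>. elation u (ln u e) \<pi> \<sigma> \<and> \<sigma> x0 = x0' \<and> (\<forall>x\<in>ln u x0. \<sigma> x = \<tau> x)"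
    if pi: "plane \<pi>" "u \<in> \<pi>" "x0 \<in> \<pi>" and e: "e \<in> \<pi>" "e \<noteq> u" "co z e" "\<not> co b e" for \<pi> e
  proof -
    note A = plane_ln[OF pi(1,2) e(1) e(2)[symmetric]]
    have m\<pi>: "ln u x0 \<subseteq> \<pi>" using plane_ln(4)[OF pi u(2)] .
    have zA: "z \<notin> ln u e" using plane_co[OF pi(1) _ pi(3)] A z(2) by blast
    have zAc: "co z x" if "x \<in> ln u e" for x using ln_perp[OF A(5) e(2)[symmetric] zu e(3) that] .
    define \<pi>' where "\<pi>' = join z (ln u e)"
    have pi': "plane \<pi>'" unfolding \<pi>'_def by (rule planeI[OF A(1) zA zAc])
    have A\<pi>': "ln u e \<subseteq> \<pi>'" "z \<in> \<pi>'" unfolding \<pi>'_def using join_base[OF zA zAc] join_self by blast+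
    have u\<pi>': "u \<in> \<pi>'" "e \<in> \<pi>'" using A A\<pi>' by blast+
    have uz: "u \<noteq> z" using zA A by blast
    note m' = plane_ln[OF pi' u\<pi>'(1) A\<pi>'(2) uz]
    have x0'\<pi>: "x0' \<in> \<pi>" using m\<pi> u by blast
    have o1: "opp_planes \<pi> \<rho>"
      by (rule opp_planesI[OF pi e(1) u(2) r(1-5) b(1,2) e(4) r(7,8,10)])
    have o2: "opp_planes \<pi>' \<rho>"
      by (rule opp_planesI[OF pi' u\<pi>'(1) A\<pi>'(2) u\<pi>'(2) uz r(1-5) b(1,3) e(4) r(7,9,10)])
    have o3: "opp_planes \<pi> \<rho>'"
      by (rule opp_planesI[OF pi(1,2) x0'\<pi> e(1) u(4)[symmetric] r'(1-5) b(1) x0'(2) e(4) r'(7,8,10)])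
    have o4: "opp_planes \<pi>' \<rho>'"
      by (rule opp_planesI[OF pi' u\<pi>'(1) A\<pi>'(2) u\<pi>'(2) uz r'(1-5) b(1,3) e(4) r'(7,9,10)])
    define f where "f = transfer \<rho> \<pi>'"
    define f' where "f' = transfer \<rho>' \<pi>"
    define \<sigma> where "\<sigma> = f' \<circ> f"
    have f: "f x \<in> \<pi>'" "trace \<rho> (f x) = trace \<rho> x" if "x \<in> \<pi>" for x
      unfolding f_def using transfer_props[OF o1 o2 that] by auto
    have f': "f' x \<in> \<pi>" "trace \<rho>' (f' x) = trace \<rho>' x" if "x \<in> \<pi>'" for x
      unfolding f'_def using transfer_props[OF o4 o3 that] by auto
    have s: "\<sigma> x \<in> \<pi>" "trace \<rho>' (\<sigma> x) = trace \<rho>' (f x)" if "x \<in> \<pi>" for x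
      unfolding \<sigma>_def using f'[OF f(1)[OF that]] by auto
    have bij: "bij_betw \<sigma> \<pi> \<pi>" unfolding \<sigma>_def f_def f'_def
      by (rule bij_betw_trans[OF transfer_bij[OF o1 o2] transfer_bij[OF o4 o3]])
    have lin: "\<sigma> ` l \<in> L" if "l \<in> L" "l \<subseteq> \<pi>" for l unfolding \<sigma>_def f_def f'_def image_comp[symmetric]
      using transfer_image_line(1)[OF o4 o3 transfer_image_line[OF o1 o2 that]] .
    have axis: "\<sigma> x = x" if "x \<in> ln u e" for x
    proof -
      have "x \<in> \<pi>" "x \<in> \<pi>'" using that A A\<pi>' by blast+
      then show ?thesis unfolding \<sigma>_def f_def f'_def o_def using transfer_eq[OF o2, of x x] transfer_eq[OF o3, of x x] by simp
    qed
    have bt: "b \<notin> ln u t" "u \<noteq> t"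
    proof -
      show ut: "u \<noteq> t" using t(2) u(1) oppD by blast
      show "b \<notin> ln u t"
        using ln_move[OF co_sym[OF tt(1)] ut _ b(4)] ln_props(3)[OF co_sym[OF tt(1)] ut]
          ln_perp[OF ub co_sym[OF u(1)] co_sym[OF b(2)], of t] t(2) oppD co_sym by metis
    qed
    note lt = ln_props[OF co_sym[OF tt(1)] bt(2)]
    have bltc: "co b x" if "x \<in> ln u t" for x using perp_line[OF lt bt(2) b(1) co_sym[OF tt(2)] that] .
    define h where "h = join b (ln u t)"
    have h: "plane h" "b \<in> h" "ln u t \<subseteq> h" unfolding h_def
      using planeI[OF lt(1) bt(1) bltc] join_self join_base[OF bt(1) bltc] by blast+
    have hk: "k \<in> h" "k' \<in> h" "u \<in> h" using h(3) r(6) r'(6) lt by blast+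
    note B = plane_ln[OF h(1,2) hk(1) r(5)] and B' = plane_ln[OF h(1,2) hk(2) r'(5)]
    \<comment> \<open>The trace of \<open>x\<close> meets \<open>b k\<close> in \<open>t1\<close>,
      and the line \<open>u t1\<close> meets \<open>b k'\<close> in \<open>t2\<close>. All of
      \<open>u t1\<close> is collinear to \<open>x\<close> and \<open>f x\<close>, so
      \<open>t2\<close> is in the second trace of \<open>f x\<close>, which is that of
      \<open>\<sigma> x\<close>. The points of \<open>\<pi>\<close> collinear to \<open>t2\<close>
      form the line \<open>u x\<close>.\<close>
    have center: "\<sigma> x \<in> ln u x" if x: "x \<in> \<pi>" "x \<noteq> u" for x
    proof -
      have "ln b k \<subseteq> \<rho>" using plane_ln(4)[OF r(1,2,4,5)] .
      then obtain t1 where t1: "t1 \<in> trace \<rho> x" "t1 \<in> ln b k"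
        using plane_meet[OF r(1) trace_line[OF o1 x(1)] B(1)] by blast
      have t1x: "t1 \<in> \<rho>" "co x t1" "co (f x) t1" using t1(1) f(2)[OF x(1)] unfolding trace_def by blast+
      have t1u: "co u t1" using ln_perp[OF B(5) r(5) ub(1) co_sym[OF r(7)] t1(2)] .
      have ut1: "u \<noteq> t1" using plane_co[OF r(1) r(3) t1x(1)] r(10) by blast
      have t1h: "t1 \<in> h" using t1(2) B by blast
      note l1 = plane_ln[OF h(1) hk(3) t1h ut1]
      obtain t2 where t2: "t2 \<in> ln u t1" "t2 \<in> ln b k'" using plane_meet[OF h(1) l1(1,4) B'(1,4)] .
      have t2r: "t2 \<in> \<rho>'" using t2 plane_ln(4)[OF r'(1,2,4,5)] by blast
      have t2c: "co x t2" "co (f x) t2" "co t2 u"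
        using ln_perp[OF t1u ut1 plane_co[OF pi(1) x(1) pi(2)] t1x(2) t2(1)]
          ln_perp[OF t1u ut1 plane_co[OF pi' f(1)[OF x(1)] u\<pi>'(1)] t1x(3) t2(1)]
          line_co[OF l1(1) t2(1) l1(2)] by auto
      then have "t2 \<in> trace \<rho>' (f x)" using t2r unfolding trace_def by blast
      then have "co t2 (\<sigma> x)" using s(2)[OF x(1)] co_sym unfolding trace_def by blast
      then show ?thesis
        using ln_eq[OF dual_line[OF o3 t2r], of u x] t2c pi(2) x s(1)[OF x(1)] co_sym by auto
    qed
    have el: "elation u (ln u e) \<pi> \<sigma>"
      unfolding elation_def using pi A bij lin axis center by blast
    have fx0: "f x0 = z"
    proof -
      have "trace \<rho> x0 = ln b y" "trace \<rho> z = ln b y"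
        using ln_eq[OF trace_line(1)[OF o1 pi(3)], of b y] ln_eq[OF trace_line(1)[OF o2 A\<pi>'(2)], of b y]
          r b co_sym unfolding trace_def by auto
      then show ?thesis unfolding f_def using transfer_eq[OF o2 A\<pi>'(2)] by simp
    qed
    have "trace \<rho>' x0' = ln b y'" "trace \<rho>' z = ln b y'"
      using ln_eq[OF trace_line(1)[OF o3 x0'\<pi>], of b y'] ln_eq[OF trace_line(1)[OF o4 A\<pi>'(2)], of b y']
        r' b x0' co_sym unfolding trace_def by auto
    then have sx0: "\<sigma> x0 = x0'" unfolding \<sigma>_def f'_def using fx0 transfer_eq[OF o3 x0'\<pi>] by simp
    have "\<sigma> x = \<tau> x" if x: "x \<in> ln u x0" for x
    proof -
      have x\<pi>: "x \<in> \<pi>" using x m\<pi> by blast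
      have "co b x" using perp_line[OF m(1-3) u(2) b(1,2) x] .
      then have "b \<in> trace \<rho> x" using r(2) co_sym unfolding trace_def by blast
      then have bf: "co b (f x)" using f(2)[OF x\<pi>] co_sym unfolding trace_def by blast
      have bm': "co b p" if "p \<in> ln u z" for p using ln_perp[OF m'(5) uz b(1,3) that] .
      \<comment> \<open>Since \<open>b\<close> lies in \<open>\<rho>\<close>, collinearity to
        \<open>b\<close> is preserved by \<open>f\<close>, and the points of \<open>\<pi>'\<close>
        collinear to \<open>b\<close> are those of \<open>ln u z\<close>.\<close>
      have fm: "f x \<in> ln u z" by (rule plane_perp_exact[OF pi' m'(1,4) bm' u\<pi>'(2) e(4) f(1)[OF x\<pi>] bf])
      have sm: "\<sigma> x \<in> ln u x0"
      proof (cases "x = u")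
        case True then show ?thesis using axis A(2) m by simp
      next
        case False then show ?thesis using center[OF x\<pi>] ln_move[OF u(1,2) x] by simp
      qed
      have "\<tau> x = \<sigma> x" unfolding \<tau>_def
      proof (rule the_equality)
        show "\<sigma> x \<in> ln u x0 \<and> (\<exists>w\<in>ln u z. trace \<rho> w = trace \<rho> x \<and> trace \<rho>' w = trace \<rho>' (\<sigma> x))"
          using sm fm f(2)[OF x\<pi>] s(2)[OF x\<pi>] by metis
        fix x' assume "x' \<in> ln u x0 \<and> (\<exists>w\<in>ln u z. trace \<rho> w = trace \<rho> x \<and> trace \<rho>' w = trace \<rho>' x')"
        then obtain w where w: "x' \<in> ln u x0" "w \<in> ln u z" "trace \<rho> w = trace \<rho> x" "trace \<rho>' w = trace \<rho>' x'" by blast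
        have "w = f x" using trace_inj[OF o2 _ f(1)[OF x\<pi>]] w m' f(2)[OF x\<pi>] by auto
        then show "x' = \<sigma> x" using trace_inj[OF o3 _ s(1)[OF x\<pi>]] w m\<pi> s(2)[OF x\<pi>] by auto
      qed
      then show ?thesis by simp
    qed
    then show ?thesis using el sx0 by blast
  qed
  show ?thesis by (rule exI[of _ \<tau>], intro allI impI, elim conjE, rule main)
qed

end

section \<open>Elations of planes\<close>

context thick_polar_space
begin

lemma elationD:
  assumes "elation u A \<pi> \<sigma>"
  shows "plane \<pi>" "A \<in> L" "u \<in> A" "A \<subseteq> \<pi>" "bij_betw \<sigma> \<pi> \<pi>" "u \<in> \<pi>" "\<sigma> u = u"
    "\<And>l. l \<in> L \<Longrightarrow> l \<subseteq> \<pi> \<Longrightarrow> \<sigma> ` l \<in> L"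
    "\<And>x. x \<in> A \<Longrightarrow> \<sigma> x = x" "\<And>x. x \<in> \<pi> \<Longrightarrow> x \<noteq> u \<Longrightarrow> \<sigma> x \<in> ln u x"
    "\<And>x. x \<in> \<pi> \<Longrightarrow> \<sigma> x \<in> \<pi>" "\<And>x y. x \<in> \<pi> \<Longrightarrow> y \<in> \<pi> \<Longrightarrow> \<sigma> x = \<sigma> y \<Longrightarrow> x = y"
    "\<And>x. x \<in> \<pi> \<Longrightarrow> x \<noteq> u \<Longrightarrow> \<sigma> x \<noteq> u \<and> ln u (\<sigma> x) = ln u x"
proof -
  show *: "plane \<pi>" "A \<in> L" "u \<in> A" "A \<subseteq> \<pi>" "bij_betw \<sigma> \<pi> \<pi>" "u \<in> \<pi>" "\<sigma> u = u"
    "\<And>l. l \<in> L \<Longrightarrow> l \<subseteq> \<pi> \<Longrightarrow> \<sigma> ` l \<in> L"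
    "\<And>x. x \<in> A \<Longrightarrow> \<sigma> x = x" "\<And>x. x \<in> \<pi> \<Longrightarrow> x \<noteq> u \<Longrightarrow> \<sigma> x \<in> ln u x"
    using assms unfolding elation_def by auto
  show "\<And>x. x \<in> \<pi> \<Longrightarrow> \<sigma> x \<in> \<pi>" using *(5) by (rule bij_betw_apply)
  show i: "\<And>x y. x \<in> \<pi> \<Longrightarrow> y \<in> \<pi> \<Longrightarrow> \<sigma> x = \<sigma> y \<Longrightarrow> x = y"
    using *(5) unfolding bij_betw_def by (meson inj_onD)
  fix x assume x: "x \<in> \<pi>" "x \<noteq> u"
  then have "\<sigma> x \<noteq> u" using i[of x u] * by auto
  then show "\<sigma> x \<noteq> u \<and> ln u (\<sigma> x) = ln u x"
    using ln_move[OF plane_co[OF *(1) *(6) x(1)] x(2)[symmetric] *(10)[OF x]] by blast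
qed

lemma elation_id: "plane \<pi> \<Longrightarrow> A \<in> L \<Longrightarrow> u \<in> A \<Longrightarrow> A \<subseteq> \<pi> \<Longrightarrow> elation u A \<pi> (\<lambda>x. x)"
  unfolding elation_def using plane_ln(3) by (auto simp: bij_betw_def)

lemma elation_determined_off_line:
  assumes e: "elation u A \<pi> \<sigma>1" "elation u A \<pi> \<sigma>2"
    and x0: "x0 \<in> \<pi>" "x0 \<notin> A" "\<sigma>1 x0 = \<sigma>2 x0" and y: "y \<in> \<pi>" "y \<notin> ln u x0"
  shows "\<sigma>1 y = \<sigma>2 y"
proof (cases "y \<in> A")
  case True then show ?thesis using elationD(9)[OF e(1)] elationD(9)[OF e(2)] by simp
next
  case yA: False
  note E = elationD[OF e(1)] and E' = elationD[OF e(2)]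
  have ux0: "u \<noteq> x0" using x0 E(3) by blast
  note m = plane_ln[OF E(1,6) x0(1) ux0]
  have xy: "x0 \<noteq> y" using y m by blast
  note k = plane_ln[OF E(1) x0(1) y(1) xy]
  obtain c where c: "c \<in> ln x0 y" "c \<in> A" using plane_meet[OF E(1) k(1,4) E(2,4)] .
  have cu: "c \<noteq> u" using ln_eq[OF k(1), of u x0] c(1) k(2,3) ux0 y(2) by blast
  have c\<pi>: "c \<in> \<pi>" using c E by blast
  define z where "z = \<sigma>1 x0"
  have z: "z \<in> \<pi>" "z \<noteq> c" "z \<notin> A"
  proof -
    show "z \<in> \<pi>" unfolding z_def using E(11) x0 by blast
    show "z \<notin> A" unfolding z_def
    proof
      assume "\<sigma>1 x0 \<in> A"
      then have "\<sigma>1 (\<sigma>1 x0) = \<sigma>1 x0" using E(9) by blast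
      then show False using E(12)[OF E(11)[OF x0(1)] x0(1)] \<open>\<sigma>1 x0 \<in> A\<close> x0 by simp
    qed
    then show "z \<noteq> c" using c by blast
  qed
  note h = plane_ln[OF E(1) c\<pi> z(1) z(2)[symmetric]]
  have im: "\<sigma> y \<in> ln c z" if e: "elation u A \<pi> \<sigma>" "\<sigma> x0 = z" for \<sigma>
  proof -
    note F = elationD[OF e(1)]
    have "z \<in> \<sigma> ` ln x0 y" "c \<in> \<sigma> ` ln x0 y" "\<sigma> y \<in> \<sigma> ` ln x0 y"
      using e(2) F(9)[OF c(2)] c(1) k by (metis imageI)+
    then show ?thesis using ln_eq[OF F(8)[OF k(1,4)], of c z] z(2) by blast
  qed
  have un: "u \<notin> ln c z"
  proof
    assume "u \<in> ln c z"
    then have "ln c z = A" using line_unique[OF h(1) E(2), of c u] h c E(3) cu by blast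
    then show False using h z by blast
  qed
  have uy: "u \<noteq> y" using yA E by blast
  note g = plane_ln[OF E(1,6) y(1) uy]
  have s: "\<sigma>1 y \<in> ln c z" "\<sigma>2 y \<in> ln c z" "\<sigma>1 y \<in> ln u y" "\<sigma>2 y \<in> ln u y"
    using im[OF e(1)] im[OF e(2)] x0(3) z_def E(10)[OF y(1)] E'(10)[OF y(1)] uy by auto
  show ?thesis using line_unique[OF h(1) g(1), of "\<sigma>1 y" "\<sigma>2 y"] s un g by blast
qed

lemma elation_determined:
  assumes e: "elation u A \<pi> \<sigma>1" "elation u A \<pi> \<sigma>2"
    and x0: "x0 \<in> \<pi>" "x0 \<notin> A" "\<sigma>1 x0 = \<sigma>2 x0" and y: "y \<in> \<pi>"
  shows "\<sigma>1 y = \<sigma>2 y"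
proof (cases "y \<in> ln u x0 \<and> y \<notin> A")
  case False
  then show ?thesis
    using elation_determined_off_line[OF e x0 y] elationD(9)[OF e(1)] elationD(9)[OF e(2)] by metis
next
  case True
  note E = elationD[OF e(1)]
  have ux0: "u \<noteq> x0" using x0 E(3) by blast
  note m = plane_ln[OF E(1,6) x0(1) ux0]
  obtain c where c: "c \<in> A" "c \<noteq> u" using third_point[OF E(2)] by blast
  have cx: "c \<noteq> x0" "c \<in> \<pi>" using c x0 E by blast+
  note k = plane_ln[OF E(1) cx(2) x0(1) cx(1)]
  obtain y' where y': "y' \<in> ln c x0" "y' \<noteq> c" "y' \<noteq> x0" using third_point[OF k(1)] by blast
  have cm: "c \<notin> ln u x0" using line_unique[OF m(1) E(2) m(2) _ E(3) c(1)] c(2) x0(2) m(3) by blast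
  have y'A: "y' \<notin> A" using line_unique[OF k(1) E(2) y'(1) k(2) _ c(1)] y' x0 k by blast
  have y'm: "y' \<notin> ln u x0" using line_unique[OF k(1) m(1) y'(1) k(3) _ m(3)] y' k(2) cm by blast
  have y'\<pi>: "y' \<in> \<pi>" using y' k by blast
  have eq: "\<sigma>1 y' = \<sigma>2 y'" by (rule elation_determined_off_line[OF e x0 y'\<pi> y'm])
  have uy: "u \<noteq> y" "u \<noteq> y'" using True E y'A by blast+
  note g = plane_ln[OF E(1,6) y'\<pi> uy(2)]
  have "y \<notin> ln u y'"
    using line_unique[OF g(1) m(1) g(2) _ m(2)] True uy(1) y'm g(3) by blast
  then show ?thesis using elation_determined_off_line[OF e y'\<pi> y'A eq y] by blast
qed

text \<open>Elations with the same center but possibly different axes: if they agreed at \<open>x0\<close> but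
  not at another point of \<open>ln u x0\<close>, then \<open>\<sigma>2\<inverse> \<circ> \<sigma>1\<close> would fix a line through \<open>x0\<close> pointwise,
  and the points where that line meets the two axes would force both elations to be trivial.\<close>

lemma elation_agree:
  assumes e: "elation u A1 \<pi> \<sigma>1" "elation u A2 \<pi> \<sigma>2"
    and x0: "x0 \<in> \<pi>" "x0 \<noteq> u" "\<sigma>1 x0 = \<sigma>2 x0" and x: "x \<in> ln u x0"
  shows "\<sigma>1 x = \<sigma>2 x"
proof -
  note E1 = elationD[OF e(1)] and E2 = elationD[OF e(2)]
  note m = plane_ln[OF E1(1,6) x0(1) x0(2)[symmetric]]
  have x\<pi>: "x \<in> \<pi>" using x m by blast
  have triv: "\<sigma> y = y" if "elation u A \<pi> \<sigma>" "p \<in> \<pi>" "p \<notin> A" "\<sigma> p = p" "y \<in> \<pi>" for \<sigma> A p y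
    using elation_determined[OF that(1) elation_id[OF elationD(1-4)[OF that(1)]] that(2,3) that(4) that(5)] .
  have on_axis: "y \<in> A" if "A \<in> L" "u \<in> A" "x0 \<in> A" "y \<in> ln u x0" for A y
    using ln_eq[OF that(1-3)] x0(2) that(4) by blast
  show ?thesis
  proof (cases "A1 = A2")
    case True
    then have e2: "elation u A1 \<pi> \<sigma>2" using e(2) by simp
    show ?thesis
    proof (cases "x0 \<in> A1")
      case False then show ?thesis by (rule elation_determined[OF e(1) e2 x0(1) _ x0(3) x\<pi>])
    next
      case xA: True
      have "x \<in> A1" by (rule on_axis[OF E1(2,3) xA x])
      then show ?thesis using E1(9) E2(9) True by simp
    qed
  next
    case ne: False
    have meet: "p = u" if "p \<in> A1" "p \<in> A2" for p
      using line_unique[OF E1(2) E2(2) that(1) E1(3) that(2) E2(3)] ne by blast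
    consider "x0 \<in> A1" | "x0 \<in> A2" | "x0 \<notin> A1" "x0 \<notin> A2" by blast
    then show ?thesis
    proof cases
      case 1
      then have "\<sigma>2 x0 = x0" "x0 \<notin> A2" using E1(9)[OF 1] x0 meet by auto
      then show ?thesis using triv[OF e(2) x0(1) _ _ x\<pi>] E1(9) on_axis[OF E1(2,3) 1 x] by simp
    next
      case 2
      then have "\<sigma>1 x0 = x0" "x0 \<notin> A1" using E2(9)[OF 2] x0 meet by auto
      then show ?thesis using triv[OF e(1) x0(1) _ _ x\<pi>] E2(9) on_axis[OF E2(2,3) 2 x] by simp
    next
      case 3
      have F: "\<sigma>1 x = \<sigma>2 x"
        if l: "l \<in> L" "l \<subseteq> \<pi>" "u \<notin> l" "x0 \<in> l" "\<sigma>1 ` l = \<sigma>2 ` l" for l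
      proof -
        have same: "\<sigma>1 p = \<sigma>2 p" if p: "p \<in> l" for p
        proof (rule ccontr)
          assume n: "\<sigma>1 p \<noteq> \<sigma>2 p"
          have p\<pi>: "p \<in> \<pi>" "p \<noteq> u" using p l by blast+
          have s: "\<sigma>1 p \<in> \<sigma>1 ` l" "\<sigma>2 p \<in> \<sigma>1 ` l" "\<sigma>1 p \<in> ln u p" "\<sigma>2 p \<in> ln u p"
            using p l(5) E1(10)[OF p\<pi>] E2(10)[OF p\<pi>] by auto
          have "\<sigma>1 ` l = ln u p"
            using line_unique[OF E1(8)[OF l(1,2)] plane_ln(1)[OF E1(1,6) p\<pi>(1)] s(1,2,3,4) n] p\<pi>(2) by blast
          then have "u \<in> \<sigma>1 ` l" using plane_ln(2)[OF E1(1,6) p\<pi>(1)] p\<pi>(2) by blast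
          then obtain q where "q \<in> l" "\<sigma>1 q = u" by blast
          then have "q = u" using E1(12)[of q u] E1(6,7) l(2) by auto
          then show False using \<open>q \<in> l\<close> l(3) by blast
        qed
        obtain p1 where p1: "p1 \<in> l" "p1 \<in> A1" using plane_meet[OF E1(1) l(1,2) E1(2,4)] .
        obtain p2 where p2: "p2 \<in> l" "p2 \<in> A2" using plane_meet[OF E1(1) l(1,2) E2(2,4)] .
        have "\<sigma>2 p1 = p1" "\<sigma>1 p2 = p2" using same p1 p2 E1(9) E2(9) by metis+
        moreover have "p1 \<notin> A2" "p2 \<notin> A1" using meet p1 p2 l(3) by blast+
        ultimately have "\<sigma>2 x = x" "\<sigma>1 x = x" using triv[OF e(2), of p1] triv[OF e(1), of p2] p1 p2 l(2) x\<pi> by auto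
        then show ?thesis by simp
      qed
      show ?thesis
      proof (rule ccontr)
        assume n: "\<sigma>1 x \<noteq> \<sigma>2 x"
        have xu: "x \<noteq> u" using n E1(7) E2(7) by auto
        have xx0: "x \<noteq> x0" using n x0 by blast
        obtain s where s: "s \<in> \<pi>" "s \<notin> ln u x0" using plane_off_line[OF E1(1) m(1,4)] .
        have xs: "x \<noteq> s" using s x by blast
        note k = plane_ln[OF E1(1) x\<pi> s(1) xs]
        have km: "q = x" if "q \<in> ln x s" "q \<in> ln u x0" for q
          using line_unique[OF k(1) m(1) that(1) k(2) that(2) x] s k by blast
        have uk: "u \<notin> ln x s" using km[of u] m(2) xu by blast
        have sub: "\<sigma>1 ` ln x s \<subseteq> \<pi>" "\<sigma>2 ` ln x s \<subseteq> \<pi>" using k(4) E1(11) E2(11) by blast+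
        \<comment> \<open>A second point of agreement: the images of the line \<open>x s\<close>
          meet, the two preimages of the common point lie on one line through \<open>u\<close>, and
          hence they coincide in \<open>q\<close>. Thus the line \<open>x0 q\<close> has the same
          image under both elations, and \<open>F\<close> applies.\<close>
        obtain r where r: "r \<in> \<sigma>1 ` ln x s" "r \<in> \<sigma>2 ` ln x s"
          using plane_meet[OF E1(1) E1(8)[OF k(1,4)] sub(1) E2(8)[OF k(1,4)] sub(2)] .
        obtain q q' where q: "q \<in> ln x s" "r = \<sigma>1 q" "q' \<in> ln x s" "r = \<sigma>2 q'" using r by blast
        have q\<pi>: "q \<in> \<pi>" "q' \<in> \<pi>" "q \<noteq> u" "q' \<noteq> u" using q k uk by blast+
        have "ln u q = ln u q'" using E1(13)[OF q\<pi>(1,3)] E2(13)[OF q\<pi>(2,4)] q by simp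
        then have "q' \<in> ln u q" "u \<in> ln u q" "q \<in> ln u q" "ln u q \<in> L"
          using plane_ln[OF E1(1,6) q\<pi>(1) q\<pi>(3)[symmetric]] plane_ln(3)[OF E1(1,6) q\<pi>(2) q\<pi>(4)[symmetric]] by simp_all
        then have qq: "q' = q" using line_unique[OF k(1) _ q(1,3)] uk by metis
        have qm: "q \<notin> ln u x0" using km[OF q(1)] q qq n by auto
        have x0q: "x0 \<noteq> q" using qm m by blast
        note l = plane_ln[OF E1(1) x0(1) q\<pi>(1) x0q]
        have ul: "u \<notin> ln x0 q"
          using line_unique[OF l(1) m(1) _ l(2) m(2,3)] x0(2) l(3) qm by blast
        have "\<sigma>1 x0 \<noteq> \<sigma>1 q" using E1(12) x0(1) q\<pi>(1) x0q by blast
        then have "\<sigma>1 ` ln x0 q = \<sigma>2 ` ln x0 q"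
          using line_unique[OF E1(8)[OF l(1,4)] E2(8)[OF l(1,4)], of "\<sigma>1 x0" "\<sigma>1 q"] l(2,3) x0(3) q qq
          by (metis imageI)
        then show False using F[OF l(1,4) ul l(2)] n by blast
      qed
    qed
  qed
qed

text \<open>\<open>ex_elations\<close> wants \<open>b\<close> in the perp of \<open>z\<close>.
  Sliding \<open>d\<close> along its line through \<open>x0\<close> achieves this without changing
  its collinearity to neighbours of \<open>x0\<close>.\<close>

lemma project_to_section:
  assumes u: "co u x0" "u \<noteq> x0" and z: "co u z" "\<not> co z x0"
    and d: "\<And>p. p \<in> ln u x0 \<Longrightarrow> co d p" "d \<notin> ln u x0"
  obtains b where "co b u" "co b x0" "co b z" "b \<noteq> u" "\<And>e. co e x0 \<Longrightarrow> co b e \<longleftrightarrow> co d e"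
proof -
  note m = ln_props[OF u]
  have o: "opp x0 z" using z co_sym co_P u unfolding opp_def by blast
  have xd: "co x0 d" "x0 \<noteq> d" using d m co_sym by blast+
  obtain b where b: "co z b" "b \<noteq> x0" "co x0 b" "b \<in> ln x0 d" "\<And>q. co q x0 \<Longrightarrow> co q b \<longleftrightarrow> co q d"
    using proj[OF xd o] by metis
  have "b \<noteq> u"
  proof
    assume "b = u"
    then have "ln x0 u = ln x0 d" using ln_move[OF xd b(4,2)] by simp
    then have "d \<in> ln x0 u" using ln_props(3)[OF xd] by simp
    then show False using d(2) ln_sym by metis
  qed
  moreover have "co b u" using b(5)[OF u(1)] d(1)[OF m(2)] co_sym by blast
  moreover have "co b e \<longleftrightarrow> co d e" if "co e x0" for e using b(5)[OF that] co_sym by blast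
  ultimately show ?thesis using that b co_sym by blast
qed

text \<open>The prescribed axis determines the auxiliary points: \<open>z\<close> is collinear to
  all of \<open>A\<close> and opposite \<open>x0\<close>, while \<open>b\<close> is collinear to the
  line \<open>u x0\<close> but not to a further point \<open>a\<close> of \<open>A\<close>.\<close>

lemma ex_elation:
  assumes pi: "plane \<pi>" and A: "A \<in> L" "A \<subseteq> \<pi>" "u \<in> A"
    and x0: "x0 \<in> \<pi>" "x0 \<notin> A" "x0' \<in> ln u x0" "x0' \<noteq> u"
  obtains \<sigma> where "elation u A \<pi> \<sigma>" "\<sigma> x0 = x0'"
proof -
  have ux: "u \<in> \<pi>" "u \<noteq> x0" using A x0 by blast+
  note m = plane_ln[OF pi ux(1) x0(1) ux(2)]
  obtain z where z: "\<And>a. a \<in> A \<Longrightarrow> co z a" "opp z x0"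
    using ex_perp_opp[OF line_sing[OF A(1)] plane_P[OF pi x0(1)] x0(2)] by blast
  have uz: "co u z" "\<not> co z x0" using z A co_sym oppD by blast+
  obtain a where a: "a \<in> A" "a \<noteq> u" using third_point[OF A(1)] by blast
  have a\<pi>: "a \<in> \<pi>" using a A by blast
  have am: "a \<notin> ln u x0" using line_unique[OF m(1) A(1) m(2) _ A(3) a(1)] a(2) x0(2) m(3) by blast
  obtain d where d: "\<And>p. p \<in> ln u x0 \<Longrightarrow> co d p" "opp d a"
    using ex_perp_opp[OF line_sing[OF m(1)] plane_P[OF pi a\<pi>] am] by blast
  have dm: "d \<notin> ln u x0" using plane_co[OF pi _ a\<pi>] m(4) d(2) oppD by blast
  obtain b where b: "co b u" "co b x0" "co b z" "b \<noteq> u" "\<And>e. co e x0 \<Longrightarrow> co b e \<longleftrightarrow> co d e"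
    using project_to_section[OF m(5) ux(2) uz d(1) dm] by blast
  have ba: "\<not> co b a" using b(5)[OF plane_co[OF pi a\<pi> x0(1)]] d oppD by blast
  obtain \<tau> where "\<forall>\<pi> e. plane \<pi> \<and> u \<in> \<pi> \<and> x0 \<in> \<pi> \<and> e \<in> \<pi> \<and> e \<noteq> u \<and> co z e \<and> \<not> co b e \<longrightarrow>
    (\<exists>\<sigma>. elation u (ln u e) \<pi> \<sigma> \<and> \<sigma> x0 = x0' \<and> (\<forall>x\<in>ln u x0. \<sigma> x = \<tau> x))"
    using ex_elations[OF m(5) ux(2) x0(3,4) uz b(1-4)] by (elim exE)
  then obtain \<sigma> where "elation u (ln u a) \<pi> \<sigma>" "\<sigma> x0 = x0'"
    using pi ux x0 a\<pi> a(2) z(1)[OF a(1)] ba by blast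
  moreover have "ln u a = A" using ln_eq[OF A(1,3) a(1)] a(2) by blast
  ultimately show ?thesis using that by blast
qed

text \<open>As the planes are not collinear to each other, some point is collinear to their common
  line and opposite a point of each. One application of \<open>ex_elations\<close> then gives a
  \<open>\<tau>\<close> for both planes, and \<open>elation_agree\<close> passes from its special
  axes to the given ones.\<close>

lemma elation_coherent_opp:
  assumes m: "co u x0" "u \<noteq> x0" "x0' \<in> ln u x0" "x0' \<noteq> u"
    and e: "elation u A1 \<pi>1 \<sigma>1" "ln u x0 \<subseteq> \<pi>1" "\<sigma>1 x0 = x0'" "elation u A2 \<pi>2 \<sigma>2" "ln u x0 \<subseteq> \<pi>2" "\<sigma>2 x0 = x0'"
    and q: "q1 \<in> \<pi>1" "q2 \<in> \<pi>2" "\<not> co q1 q2" and x: "x \<in> ln u x0"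
  shows "\<sigma>1 x = \<sigma>2 x"
proof -
  note E1 = elationD[OF e(1)] and E2 = elationD[OF e(4)]
  note l = ln_props[OF m(1,2)]
  have x0p: "x0 \<in> \<pi>1" "x0 \<in> \<pi>2" using l e by blast+
  obtain z where z: "\<And>a. a \<in> {u} \<Longrightarrow> co z a" "opp z x0"
    using ex_perp_opp[OF point_sing[OF co_P(1)[OF m(1)]] co_P(2)[OF m(1)]] m(2) by blast
  have uz: "co u z" "\<not> co z x0" "co z u" using co_sym[OF z(1)] oppD(3)[OF z(2)] z(1) by simp_all
  have zP: "z \<in> P" using uz co_P by blast
  have axis: "\<exists>a. a \<in> \<pi> \<and> a \<noteq> u \<and> co z a \<and> a \<notin> ln u x0" if pi: "plane \<pi>" "ln u x0 \<subseteq> \<pi>" for \<pi>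
  proof -
    obtain k where k: "k \<in> L" "k \<subseteq> \<pi>" "\<And>y. y \<in> k \<Longrightarrow> co z y" using plane_perp[OF pi(1) zP] by blast
    obtain a where a: "a \<in> k" "a \<noteq> u" using third_point[OF k(1)] by blast
    have "a \<notin> ln u x0" using perp_line[OF l(1,2) _ a(2)[symmetric] uz(3) k(3)[OF a(1)] l(3)] uz(2) by blast
    then show ?thesis using a k by blast
  qed
  obtain a1 where a1: "a1 \<in> \<pi>1" "a1 \<noteq> u" "co z a1" "a1 \<notin> ln u x0" using axis[OF E1(1) e(2)] by blast
  obtain a2 where a2: "a2 \<in> \<pi>2" "a2 \<noteq> u" "co z a2" "a2 \<notin> ln u x0" using axis[OF E2(1) e(5)] by blast
  have ma: "co a1 p" "co a2 p" if "p \<in> ln u x0" for p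
    using plane_co[OF E1(1) a1(1)] plane_co[OF E2(1) a2(1)] that e by blast+
  have "\<not> co a1 a2"
  proof
    assume c: "co a1 a2"
    have "co q1 a2" using plane_cover[OF E1(1) l(1) e(2) a1(1,4) ma(2) co_sym[OF c] q(1)] co_sym by blast
    moreover have "co q1 p" if "p \<in> ln u x0" for p using plane_co[OF E1(1) q(1)] that e by blast
    ultimately show False using plane_cover[OF E2(1) l(1) e(5) a2(1,4) _ _ q(2)] q(3) by blast
  qed
  then have oa: "opp a1 a2" using co_P uz(1) a1(3) a2(3) unfolding opp_def by blast
  obtain d where d: "\<And>p. p \<in> ln u x0 \<Longrightarrow> co d p" "opp d a1" "opp d a2"
    using ex_opp_opp[OF line_sing[OF l(1)] ma oa] by blast
  have dm: "d \<notin> ln u x0" using ma(1) d(2) co_sym oppD by blast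
  obtain b where b: "co b u" "co b x0" "co b z" "b \<noteq> u" "\<And>e. co e x0 \<Longrightarrow> co b e \<longleftrightarrow> co d e"
    using project_to_section[OF m(1,2) uz(1,2) d(1) dm] by blast
  have ba: "\<not> co b a1" "\<not> co b a2" using b(5)[OF ma(1)[OF l(3)]] b(5)[OF ma(2)[OF l(3)]] d oppD by blast+
  obtain \<tau> where \<tau>: "\<forall>\<pi> e. plane \<pi> \<and> u \<in> \<pi> \<and> x0 \<in> \<pi> \<and> e \<in> \<pi> \<and> e \<noteq> u \<and> co z e \<and> \<not> co b e \<longrightarrow>
    (\<exists>\<sigma>. elation u (ln u e) \<pi> \<sigma> \<and> \<sigma> x0 = x0' \<and> (\<forall>x\<in>ln u x0. \<sigma> x = \<tau> x))"
    using ex_elations[OF m uz(1,2) b(1-4)] by (elim exE)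
  obtain s1 where s1: "elation u (ln u a1) \<pi>1 s1" "s1 x0 = x0'" "s1 x = \<tau> x"
    using \<tau>[rule_format, of \<pi>1 a1] E1(1,6) x0p(1) a1(1-3) ba(1) x by blast
  obtain s2 where s2: "elation u (ln u a2) \<pi>2 s2" "s2 x0 = x0'" "s2 x = \<tau> x"
    using \<tau>[rule_format, of \<pi>2 a2] E2(1,6) x0p(2) a2(1-3) ba(2) x by blast
  have "\<sigma>1 x = s1 x" using elation_agree[OF e(1) s1(1) x0p(1) m(2)[symmetric] _ x] e(3) s1(2) by simp
  moreover have "\<sigma>2 x = s2 x" using elation_agree[OF e(4) s2(1) x0p(2) m(2)[symmetric] _ x] e(6) s2(2) by simp
  ultimately show ?thesis using s1 s2 by simp
qed

text \<open>If the planes are collinear to each other, take a point \<open>d\<close> collinear to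
  the common line and to a third point \<open>c'\<close> of \<open>q1 q2\<close>, but not to
  \<open>q1\<close>. It is not collinear to \<open>q2\<close> either, so the plane of
  \<open>d\<close> and the common line can be compared with both.\<close>

lemma elation_coherent:
  assumes m: "co u x0" "u \<noteq> x0" "x0' \<in> ln u x0" "x0' \<noteq> u"
    and e: "elation u A1 \<pi>1 \<sigma>1" "ln u x0 \<subseteq> \<pi>1" "\<sigma>1 x0 = x0'" "elation u A2 \<pi>2 \<sigma>2" "ln u x0 \<subseteq> \<pi>2" "\<sigma>2 x0 = x0'"
    and x: "x \<in> ln u x0"
  shows "\<sigma>1 x = \<sigma>2 x"
proof -
  note E1 = elationD[OF e(1)] and E2 = elationD[OF e(4)]
  note l = ln_props[OF m(1,2)]
  have x0p: "x0 \<in> \<pi>1" "x0 \<in> \<pi>2" using l e by blast+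
  obtain q1 where q1: "q1 \<in> \<pi>1" "q1 \<notin> ln u x0" using plane_off_line[OF E1(1) l(1) e(2)] .
  obtain q2 where q2: "q2 \<in> \<pi>2" "q2 \<notin> ln u x0" using plane_off_line[OF E2(1) l(1) e(5)] .
  have qm: "co q1 p" "co q2 p" if "p \<in> ln u x0" for p
    using plane_co[OF E1(1) q1(1)] plane_co[OF E2(1) q2(1)] that e by blast+
  show ?thesis
  proof (cases "\<pi>1 = \<pi>2")
    case True
    then show ?thesis using elation_agree[OF e(1) _ x0p(1) m(2)[symmetric] _ x] e(3,4,6) by simp
  next
    case ne: False
    show ?thesis
    proof (cases "co q1 q2")
      case False then show ?thesis using elation_coherent_opp[OF m e q1(1) q2(1) _ x] by blast
    next
      case c: True
      have q2n: "q2 \<notin> \<pi>1"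
        using plane_rebase[OF E1(1) l(1) e(2) _ q2(2)] plane_rebase[OF E2(1) l(1) e(5) q2] ne by blast
      have q12: "q1 \<noteq> q2" using q1 q2n by blast
      note k = ln_props[OF c q12]
      obtain c' where c': "c' \<in> ln q1 q2" "c' \<noteq> q1" "c' \<noteq> q2" using third_point[OF k(1)] by blast
      have c'\<pi>: "c' \<notin> \<pi>1"
        using subspaceD[OF sing_subspace[OF plane_sing[OF E1(1)]] k(1,2) c'(1) q1(1) _ c'(2)[symmetric] k(3)] q2n by blast
      then have c'n: "c' \<notin> ln u x0" using e(2) by blast
      have c'm: "co c' p" if "p \<in> ln u x0" for p
        using ln_perp[OF c q12 _ _ c'(1)] qm[OF that] co_sym by blast
      let ?\<rho> = "join c' (ln u x0)"
      have rho: "plane ?\<rho>" "c' \<in> ?\<rho>" "ln u x0 \<subseteq> ?\<rho>"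
        using planeI[OF l(1) c'n c'm] join_self join_base[OF c'n c'm] by blast+
      have "q1 \<notin> ?\<rho>"
      proof
        assume "q1 \<in> ?\<rho>"
        then have "?\<rho> = \<pi>1" using plane_rebase[OF rho(1) l(1) rho(3) _ q1(2)] plane_rebase[OF E1(1) l(1) e(2) q1] by simp
        then show False using rho c'\<pi> by blast
      qed
      then obtain d where d: "\<And>p. p \<in> ?\<rho> \<Longrightarrow> co d p" "opp d q1"
        using ex_perp_opp[OF plane_sing[OF rho(1)] plane_P[OF E1(1) q1(1)]] by blast
      have dc: "co d c'" "\<And>p. p \<in> ln u x0 \<Longrightarrow> co d p" using d rho by blast+
      have dq: "\<not> co d q1" "\<not> co d q2"
        using d(2) oppD perp_line[OF k(1) c'(1) k(3) c'(3) dc(1) _ k(2)] by blast+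
      have dn: "d \<notin> ln u x0" using qm(1) dq co_sym by blast
      let ?\<pi> = "join d (ln u x0)"
      have p3: "plane ?\<pi>" "d \<in> ?\<pi>" "ln u x0 \<subseteq> ?\<pi>"
        using planeI[OF l(1) dn dc(2)] join_self join_base[OF dn dc(2)] by blast+
      have ud: "u \<noteq> d" "u \<in> ?\<pi>" "x0 \<in> ?\<pi>" using dn l p3 by blast+
      note A = plane_ln[OF p3(1) ud(2) p3(2) ud(1)]
      have "x0 \<notin> ln u d" using line_unique[OF A(1) l(1) A(2) _ l(2,3) m(2)] dn A(3) by blast
      then obtain \<sigma>3 where s3: "elation u (ln u d) ?\<pi> \<sigma>3" "\<sigma>3 x0 = x0'"
        using ex_elation[OF p3(1) A(1,4,2) ud(3) _ m(3,4)] by blast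
      have "\<sigma>1 x = \<sigma>3 x" "\<sigma>2 x = \<sigma>3 x"
        using elation_coherent_opp[OF m e(1-3) s3(1) p3(3) s3(2) q1(1) p3(2) _ x]
          elation_coherent_opp[OF m e(4-6) s3(1) p3(3) s3(2) q2(1) p3(2) _ x] dq co_sym by blast+
      then show ?thesis by simp
    qed
  qed
qed

section \<open>The map of the cone glued from elations\<close>

definition sect :: "'a \<Rightarrow> 'a \<Rightarrow> 'a \<Rightarrow> 'a" where
  "sect u a x = (THE y. y \<in> ln u x \<and> co a y)"

lemma sect_props:
  assumes "opp u a" "co u x" "x \<noteq> u"
  shows "sect u a x \<in> ln u x" "co a (sect u a x)" "sect u a x \<noteq> u" "\<And>y. y \<in> ln u x \<Longrightarrow> co a y \<Longrightarrow> y = sect u a x"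
proof -
  note l = ln_props[OF assms(2) assms(3)[symmetric]]
  obtain y where y: "y \<in> ln u x" "co a y" using perp_meets[OF oppD(2)[OF assms(1)] l(1)] by blast
  have un: "y' = y" if "y' \<in> ln u x" "co a y'" for y'
    using line_opp_unique[OF l(1,2) oppD(4)[OF assms(1)]] that y by blast
  have "sect u a x = y" unfolding sect_def using y un by blast
  moreover have "y \<noteq> u" using y oppD(4)[OF assms(1)] by blast
  ultimately show "sect u a x \<in> ln u x" "co a (sect u a x)" "sect u a x \<noteq> u"
    using y by simp_all
  show "y' = sect u a x" if "y' \<in> ln u x" "co a y'" for y'
    using un[OF that] \<open>sect u a x = y\<close> by simp
qed

lemma sect_cong: "ln u x = ln u y \<Longrightarrow> sect u a x = sect u a y"
  unfolding sect_def by simp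

text \<open>Well defined by \<open>elation_coherent\<close>: neither plane nor axis matters for the
  effect on the line \<open>u x\<close> once the image of one point other than \<open>u\<close> is
  prescribed. Quantifying over all elations avoids choosing a plane for each line.\<close>

definition cone_image :: "'a \<Rightarrow> 'a \<Rightarrow> 'a \<Rightarrow> 'a \<Rightarrow> 'a" where
  "cone_image u a b x = (if x = u then u else
     THE x'. \<exists>\<pi> A \<sigma>. elation u A \<pi> \<sigma> \<and> x \<in> \<pi> \<and> \<sigma> (sect u a x) = sect u b x \<and> \<sigma> x = x')"

lemma cone_image_eq:
  assumes o: "opp u a" "opp u b" and e: "elation u A \<pi> \<sigma>" "x \<in> \<pi>" "x \<noteq> u" "\<sigma> (sect u a x) = sect u b x"
  shows "cone_image u a b x = \<sigma> x"
proof -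
  note E = elationD[OF e(1)]
  have cx: "co u x" using plane_co[OF E(1,6) e(2)] .
  note sa = sect_props[OF o(1) cx e(3)] and sb = sect_props[OF o(2) cx e(3)]
  note l = ln_props[OF cx e(3)[symmetric]]
  have usa: "co u (sect u a x)" using line_co l sa by blast
  have leq: "ln u (sect u a x) = ln u x" using ln_move[OF cx e(3)[symmetric] sa(1,3)] .
  have "(THE x'. \<exists>\<pi> A \<sigma>. elation u A \<pi> \<sigma> \<and> x \<in> \<pi> \<and> \<sigma> (sect u a x) = sect u b x \<and> \<sigma> x = x') = \<sigma> x"
  proof (rule the_equality)
    show "\<exists>\<pi> A \<sigma>'. elation u A \<pi> \<sigma>' \<and> x \<in> \<pi> \<and> \<sigma>' (sect u a x) = sect u b x \<and> \<sigma>' x = \<sigma> x"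
      using e by blast
    fix x' assume "\<exists>\<pi> A \<sigma>. elation u A \<pi> \<sigma> \<and> x \<in> \<pi> \<and> \<sigma> (sect u a x) = sect u b x \<and> \<sigma> x = x'"
    then obtain \<pi>2 A2 \<sigma>2 where e2: "elation u A2 \<pi>2 \<sigma>2" "x \<in> \<pi>2" "\<sigma>2 (sect u a x) = sect u b x" "\<sigma>2 x = x'" by blast
    note E2 = elationD[OF e2(1)]
    have sub: "ln u x \<subseteq> \<pi>" "ln u x \<subseteq> \<pi>2"
      using plane_ln(4)[OF E(1,6) e(2) e(3)[symmetric]] plane_ln(4)[OF E2(1,6) e2(2) e(3)[symmetric]] by auto
    show "x' = \<sigma> x"
      using elation_coherent[OF usa sa(3)[symmetric] _ sb(3) e2(1) _ e2(3) e(1) _ e(4), of x] leq sb(1) sub l(3) e2(4) by simp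
  qed
  then show ?thesis unfolding cone_image_def using e(3) by simp
qed

text \<open>By definition each line through \<open>u\<close> could use its own elation. One elation
  serves the whole plane: its axis passes through the common point of the section lines
  \<open>\<alpha>\<close> and \<open>\<beta>\<close>, and it carries a further point of
  \<open>\<alpha>\<close> into \<open>\<beta>\<close>. If the lines are equal, it is the
  identity.\<close>

lemma cone_image_plane:
  assumes o: "opp u a" "opp u b" and pi: "plane \<pi>" "u \<in> \<pi>"
  obtains A \<sigma> where "elation u A \<pi> \<sigma>" "\<And>x. x \<in> \<pi> \<Longrightarrow> cone_image u a b x = \<sigma> x"
proof -
  define \<alpha> where "\<alpha> = {y \<in> \<pi>. co a y}"
  define \<beta> where "\<beta> = {y \<in> \<pi>. co b y}"
  have aL: "\<alpha> \<in> L" "\<alpha> \<subseteq> \<pi>" "u \<notin> \<alpha>" and bL: "\<beta> \<in> L" "\<beta> \<subseteq> \<pi>" "u \<notin> \<beta>"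
    unfolding \<alpha>_def \<beta>_def
    using plane_perp_line[OF pi(1) oppD(2)[OF o(1)] pi(2) oppD(4)[OF o(1)]]
      plane_perp_line[OF pi(1) oppD(2)[OF o(2)] pi(2) oppD(4)[OF o(2)]] oppD(4)[OF o(1)] oppD(4)[OF o(2)] by auto
  have s: "sect u a x \<in> \<alpha>" "sect u b x \<in> \<beta>" if x: "x \<in> \<pi>" "x \<noteq> u" for x
    using sect_props[OF o(1) plane_co[OF pi x(1)] x(2)] sect_props[OF o(2) plane_co[OF pi x(1)] x(2)]
      plane_ln(4)[OF pi x(1) x(2)[symmetric]] unfolding \<alpha>_def \<beta>_def by blast+
  obtain A \<sigma> where e: "elation u A \<pi> \<sigma>" "\<sigma> ` \<alpha> \<subseteq> \<beta>"
  proof (cases "\<alpha> = \<beta>")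
    case True
    obtain p where p: "p \<in> \<alpha>" using third_point[OF aL(1)] by blast
    then have "p \<in> \<pi>" "u \<noteq> p" using aL by blast+
    note l = plane_ln[OF pi this]
    show ?thesis using that[OF elation_id[OF pi(1) l(1,2,4)]] True by simp
  next
    case False
    obtain c where c: "c \<in> \<alpha>" "c \<in> \<beta>" using plane_meet[OF pi(1) aL(1,2) bL(1,2)] .
    have c\<pi>: "c \<in> \<pi>" "u \<noteq> c" using c aL by blast+
    note A = plane_ln[OF pi c\<pi>]
    obtain x0 where x0: "x0 \<in> \<alpha>" "x0 \<noteq> c" using third_point[OF aL(1)] by blast
    have x0A: "x0 \<notin> ln u c" using line_unique[OF A(1) aL(1) _ A(3) x0(1) c(1)] x0(2) A(2) aL(3) by blast
    have x0\<pi>: "x0 \<in> \<pi>" "u \<noteq> x0" using x0 aL by blast+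
    note m = plane_ln[OF pi x0\<pi>]
    obtain x1 where x1: "x1 \<in> ln u x0" "x1 \<in> \<beta>" using plane_meet[OF pi(1) m(1,4) bL(1,2)] .
    have x1u: "x1 \<noteq> u" using x1 bL by blast
    obtain \<sigma> where s: "elation u (ln u c) \<pi> \<sigma>" "\<sigma> x0 = x1"
      using ex_elation[OF pi(1) A(1,4,2) x0\<pi>(1) x0A x1(1) x1u] .
    note E = elationD[OF s(1)]
    have x1c: "x1 \<noteq> c" using line_unique[OF m(1) A(1) m(2) _ A(2,3)] c\<pi> x1 x0A m(3) by blast
    have "x1 \<in> \<sigma> ` \<alpha>" "c \<in> \<sigma> ` \<alpha>" using s(2) x0 E(9)[OF A(3)] c by (metis imageI)+
    then have "\<sigma> ` \<alpha> = \<beta>" using line_unique[OF E(8)[OF aL(1,2)] bL(1) _ _ x1(2) c(2) x1c] by blast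
    then show ?thesis using that[OF s(1)] by blast
  qed
  note E = elationD[OF e(1)]
  have "cone_image u a b x = \<sigma> x" if x: "x \<in> \<pi>" for x
  proof (cases "x = u")
    case True then show ?thesis using E(7) unfolding cone_image_def by simp
  next
    case False
    note cx = plane_co[OF pi x]
    note sa = sect_props[OF o(1) cx False] and sb = sect_props[OF o(2) cx False]
    have leq: "ln u (sect u a x) = ln u x" using ln_move[OF cx False[symmetric] sa(1,3)] .
    have sa\<pi>: "sect u a x \<in> \<pi>" using s(1)[OF x False] aL by blast
    have "\<sigma> (sect u a x) \<in> \<beta>" using e(2) s(1)[OF x False] by blast
    moreover have "\<sigma> (sect u a x) \<in> ln u x" using E(10)[OF sa\<pi> sa(3)] leq by simp
    ultimately have "\<sigma> (sect u a x) = sect u b x" using sb(4) unfolding \<beta>_def by blast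
    then show ?thesis using cone_image_eq[OF o e(1) x False] by blast
  qed
  then show ?thesis using that e(1) by blast
qed

lemma ex_plane_through:
  assumes "u \<in> P" "l \<in> L" "\<And>x. x \<in> l \<Longrightarrow> co u x"
  obtains \<pi> where "plane \<pi>" "u \<in> \<pi>" "l \<subseteq> \<pi>"
proof (cases "u \<in> l")
  case True then show ?thesis using ex_plane[OF assms(2)] that by blast
next
  case False
  show ?thesis using that[OF planeI[OF assms(2) False assms(3)] join_self join_base[OF False assms(3)]] by blast
qed

text \<open>The last property controls fixed points on root interiors: where the section points of
  \<open>a\<close> and \<open>b\<close> agree, the identity is an admissible elation.\<close>

theorem ex_central_collineation:
  assumes o: "opp u a" "opp u b"
  obtains \<theta> where "collineation \<Delta> \<theta>" "\<theta> a = b" "\<theta> u = u"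
    "\<And>x. co u x \<Longrightarrow> x \<noteq> u \<Longrightarrow> \<theta> x \<in> ln u x"
    "\<And>x. co u x \<Longrightarrow> x \<noteq> u \<Longrightarrow> sect u a x = sect u b x \<Longrightarrow> \<theta> x = x"
proof -
  let ?g = "cone_image u a b"
  have uP: "u \<in> P" using o oppD by blast
  have gu: "?g u = u" unfolding cone_image_def by simp
  have loc: "\<exists>A \<pi> \<sigma>. elation u A \<pi> \<sigma> \<and> x \<in> \<pi> \<and> (\<forall>y\<in>\<pi>. ?g y = \<sigma> y)" if x: "co u x" "x \<noteq> u" for x
  proof -
    note l = ln_props[OF x(1) x(2)[symmetric]]
    obtain \<pi> where pi: "plane \<pi>" "ln u x \<subseteq> \<pi>" using ex_plane[OF l(1)] .
    then have "u \<in> \<pi>" "x \<in> \<pi>" using l by blast+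
    then show ?thesis using cone_image_plane[OF o pi(1)] by metis
  qed
  have g_ln: "?g x \<in> ln u x" "?g x \<noteq> u" "ln u (?g x) = ln u x" "co u (?g x)" if x: "co u x" "x \<noteq> u" for x
  proof -
    obtain A \<pi> \<sigma> where e: "elation u A \<pi> \<sigma>" "x \<in> \<pi>" "?g x = \<sigma> x" using loc[OF x] by blast
    note E = elationD[OF e(1)]
    show "?g x \<in> ln u x" "?g x \<noteq> u" "ln u (?g x) = ln u x" "co u (?g x)"
      using E(10)[OF e(2) x(2)] E(13)[OF e(2) x(2)] e(3) plane_co[OF E(1,6) E(11)[OF e(2)]] by auto
  qed
  have inj: "inj_on ?g (perp \<Delta> u)"
  proof (rule inj_onI)
    fix x y assume xy: "x \<in> perp \<Delta> u" "y \<in> perp \<Delta> u" "?g x = ?g y"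
    then have c: "co u x" "co u y" unfolding perp_def by auto
    show "x = y"
    proof (cases "x = u \<or> y = u")
      case True then show ?thesis using xy(3) gu g_ln(2)[OF c(1)] g_ln(2)[OF c(2)] by metis
    next
      case False
      obtain A \<pi> \<sigma> where e: "elation u A \<pi> \<sigma>" "x \<in> \<pi>" "\<forall>y\<in>\<pi>. ?g y = \<sigma> y" using loc[OF c(1)] False by blast
      note E = elationD[OF e(1)]
      have "ln u x = ln u y" using g_ln(3)[OF c(1)] g_ln(3)[OF c(2)] False xy(3) by simp
      then have "y \<in> \<pi>" using plane_ln(4)[OF E(1,6) e(2)] ln_props(3)[OF c(2)] False by blast
      then show ?thesis using E(12)[OF e(2)] xy(3) e(2,3) by simp
    qed
  qed
  have surj: "\<exists>x. co u x \<and> ?g x = y" if y: "co u y" for y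
  proof (cases "y = u")
    case True then show ?thesis using gu y by blast
  next
    case False
    obtain A \<pi> \<sigma> where e: "elation u A \<pi> \<sigma>" "y \<in> \<pi>" "\<forall>y\<in>\<pi>. ?g y = \<sigma> y" using loc[OF y False] by blast
    note E = elationD[OF e(1)]
    have "\<sigma> ` \<pi> = \<pi>" using E(5) unfolding bij_betw_def by blast
    then have "y \<in> \<sigma> ` \<pi>" using e(2) by simp
    then obtain x where x: "x \<in> \<pi>" "y = \<sigma> x" by (rule imageE)
    then have "co u x" "?g x = y" using e(3) plane_co[OF E(1,6)] by simp_all
    then show ?thesis by blast
  qed
  define g' where "g' = inv_into (perp \<Delta> u) ?g"
  have g1: "g' (?g x) = x" if "co u x" for x
    unfolding g'_def using inv_into_f_f[OF inj] that unfolding perp_def by blast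
  have g2: "?g (g' y) = y" "co u (g' y)" if "co u y" for y
    using surj[OF that] g1 by auto
  have g'u: "g' u = u" using g1[of u] gu co_refl[OF uP] by simp
  have glin: "?g ` l \<in> L \<and> g' ` l \<in> L" if l: "l \<in> L" "\<And>x. x \<in> l \<Longrightarrow> co u x" for l
  proof -
    obtain \<pi> where pi: "plane \<pi>" "u \<in> \<pi>" "l \<subseteq> \<pi>" using ex_plane_through[OF uP l] .
    obtain A \<sigma> where e: "elation u A \<pi> \<sigma>" "\<And>x. x \<in> \<pi> \<Longrightarrow> ?g x = \<sigma> x" using cone_image_plane[OF o pi(1,2)] by blast
    note E = elationD[OF e(1)]
    have img: "?g ` k = \<sigma> ` k" if "k \<subseteq> \<pi>" for k using e(2) that by (intro image_cong) auto
    have g'\<pi>: "g' y \<in> \<pi>" if "y \<in> \<pi>" for y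
    proof -
      have "\<sigma> ` \<pi> = \<pi>" using E(5) unfolding bij_betw_def by blast
      then have "y \<in> \<sigma> ` \<pi>" using that by simp
      then obtain x where x: "x \<in> \<pi>" "y = \<sigma> x" by (rule imageE)
      then have "g' y = x" using g1[OF plane_co[OF pi(1,2) x(1)]] e(2) by auto
      then show ?thesis using x by simp
    qed
    obtain y1 where y1: "y1 \<in> l" using third_point[OF l(1)] by blast
    obtain y2 where y2: "y2 \<in> l" "y2 \<noteq> y1" using third_point[OF l(1)] by blast
    have x12: "g' y1 \<in> \<pi>" "g' y2 \<in> \<pi>" "g' y1 \<noteq> g' y2"
      using g'\<pi> y1 y2 pi(3) g2(1)[OF l(2)[OF y1]] g2(1)[OF l(2)[OF y2(1)]] by auto
    note k = plane_ln[OF pi(1) x12]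
    have "y1 \<in> \<sigma> ` ln (g' y1) (g' y2)" "y2 \<in> \<sigma> ` ln (g' y1) (g' y2)"
      using g2(1)[OF l(2)[OF y1]] g2(1)[OF l(2)[OF y2(1)]] e(2) x12 k by (metis imageI)+
    then have "\<sigma> ` ln (g' y1) (g' y2) = l"
      using line_unique[OF E(8)[OF k(1,4)] l(1) _ _ y1 y2(1) y2(2)[symmetric]] by simp
    then have "?g ` ln (g' y1) (g' y2) = l" using img[OF k(4)] by simp
    moreover have "g' ` ?g ` ln (g' y1) (g' y2) = ln (g' y1) (g' y2)"
    proof -
      have "g' (?g x) = x" if "x \<in> ln (g' y1) (g' y2)" for x using g1 plane_co[OF pi(1,2)] k(4) that by blast
      then show ?thesis by (simp add: image_image)
    qed
    ultimately have "g' ` l = ln (g' y1) (g' y2)" by simp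
    then show ?thesis using img[OF pi(3)] E(8)[OF l(1) pi(3)] k(1) by simp
  qed
  have g'ln: "g' y \<in> ln u y" if y: "co u y" "y \<noteq> u" for y
  proof -
    have x: "co u (g' y)" "g' y \<noteq> u" using g2[OF y(1)] gu y(2) by auto
    then show ?thesis using g_ln(3)[OF x] g2(1)[OF y(1)] ln_props(3)[OF x(1)] by simp
  qed
  \<comment> \<open>\<open>c\<close> is its own section point. An elation whose axis avoids
    \<open>c\<close> can carry it to the section point of \<open>b\<close>, and its value at
    \<open>c\<close> is that of the cone map.\<close>
  have gsec: "co b (?g c)" if c: "co u c" "co a c" for c
  proof -
    have cu: "c \<noteq> u" using c o oppD by blast
    note l = ln_props[OF c(1) cu[symmetric]]
    have sc: "sect u a c = c" using sect_props(4)[OF o(1) c(1) cu l(3) c(2)] by simp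
    obtain A \<pi> \<sigma> where e: "elation u A \<pi> \<sigma>" "c \<in> \<pi>" using loc[OF c(1) cu] by blast
    note E = elationD[OF e(1)]
    obtain A \<sigma> where e2: "elation u A \<pi> \<sigma>" "\<And>x. x \<in> \<pi> \<Longrightarrow> ?g x = \<sigma> x"
      using cone_image_plane[OF o E(1,6)] by blast
    note sb = sect_props[OF o(2) c(1) cu]
    obtain p where p: "p \<in> \<pi>" "p \<notin> ln u c" using plane_off_line[OF E(1) l(1) plane_ln(4)[OF E(1,6) e(2) cu[symmetric]]] .
    have up: "u \<noteq> p" using p l by blast
    note B = plane_ln[OF E(1,6) p(1) up]
    have cB: "c \<notin> ln u p" using line_unique[OF B(1) l(1) B(2) _ l(2,3) cu[symmetric]] p(2) B(3) by blast
    obtain \<sigma>3 where s3: "elation u (ln u p) \<pi> \<sigma>3" "\<sigma>3 c = sect u b c"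
      using ex_elation[OF E(1) B(1,4,2) e(2) cB sb(1,3)] .
    have "?g c = \<sigma>3 c" using cone_image_eq[OF o s3(1) e(2) cu] s3(2) sc by simp
    then show ?thesis using s3(2) sb(2) by simp
  qed
  interpret X: cone_extension \<Delta> n u a b ?g g'
    by unfold_locales (use o gu g'u g1 g2 g_ln(1) g'ln glin gsec in auto)
  show ?thesis
  proof (rule that[OF X.ext_collineation X.ext_base])
    show "X.ext u = u" using X.ext_cone[OF co_refl[OF uP]] gu by simp
    show "X.ext x \<in> ln u x" if "co u x" "x \<noteq> u" for x using X.ext_cone g_ln that by simp
    fix x assume x: "co u x" "x \<noteq> u" "sect u a x = sect u b x"
    note l = ln_props[OF x(1) x(2)[symmetric]]
    obtain A \<pi> \<sigma> where e: "elation u A \<pi> \<sigma>" "x \<in> \<pi>" using loc[OF x(1,2)] by blast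
    note E = elationD[OF e(1)]
    have "?g x = x" using cone_image_eq[OF o elation_id[OF E(1-4)] e(2) x(2)] x(3) by simp
    then show "X.ext x = x" using X.ext_cone[OF x(1)] by simp
  qed
qed

end

section \<open>Collineations and apartments\<close>

context thick_polar_space
begin

text \<open>For a line off \<open>u\<close>, the line joining the section points of \<open>x\<close>
  and \<open>y\<close> lies in the perps of both \<open>a\<close> and \<open>b\<close>, and it meets
  the line \<open>u z\<close> in the common section point. So fixed frame points span subspaces that
  are fixed pointwise.\<close>

lemma fixed_section_subspace:
  assumes o: "opp u a" "opp u b"
  shows "subspace \<Delta> {x. co u x \<and> (x = u \<or> sect u a x = sect u b x)}" (is "subspace \<Delta> ?F")
proof (rule subspaceI)
  show "?F \<subseteq> P" using co_P by blast
next
  fix l x y z assume l: "l \<in> L" "x \<in> l" "y \<in> l" "x \<in> ?F" "y \<in> ?F" "x \<noteq> y" "z \<in> l"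
  then have c: "co u x" "co u y" by blast+
  have cl: "co u p" if "p \<in> l" for p using perp_line[OF l(1-3,6) c that] .
  note cz = cl[OF l(7)]
  show "z \<in> ?F"
  proof (cases "z = u")
    case True then show ?thesis using cz by blast
  next
    case zu: False
    have "sect u a z = sect u b z"
    proof (cases "u \<in> l")
      case True
      have *: "sect u a z = sect u b z" if w: "w \<in> l" "w \<in> ?F" "w \<noteq> u" for w
      proof -
        have "ln u w = ln u z" using ln_eq[OF l(1) True w(1)] ln_eq[OF l(1) True l(7)] w(3) zu by simp
        then show ?thesis using sect_cong[of u w z a] sect_cong[of u w z b] w by simp
      qed
      show ?thesis using *[OF l(2,4)] *[OF l(3,5)] l(6) by blast
    next
      case False
      have ne: "x \<noteq> u" "y \<noteq> u" using False l by blast+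
      have s: "sect u a x = sect u b x" "sect u a y = sect u b y" using l(4,5) ne by blast+
      note pi = planeI[OF l(1) False cl]
      have in\<pi>: "u \<in> join u l" "l \<subseteq> join u l" using join_self join_base[OF False cl] by blast+
      have xyz: "x \<in> join u l" "y \<in> join u l" "z \<in> join u l" using in\<pi> l by blast+
      note lx = plane_ln[OF pi in\<pi>(1) xyz(1) ne(1)[symmetric]] and ly = plane_ln[OF pi in\<pi>(1) xyz(2) ne(2)[symmetric]]
        and lz = plane_ln[OF pi in\<pi>(1) xyz(3) zu[symmetric]]
      note sx = sect_props[OF o(1) c(1) ne(1)] and sx' = sect_props[OF o(2) c(1) ne(1)]
        and sy = sect_props[OF o(1) c(2) ne(2)] and sy' = sect_props[OF o(2) c(2) ne(2)]
      have ss: "sect u a x \<noteq> sect u a y"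
      proof
        assume "sect u a x = sect u a y"
        then have "ln u x = ln u y" using line_unique[OF lx(1) ly(1) lx(2) sx(1) ly(2)] sy(1) sx(3) by simp
        then have "ln u x = l" using line_unique[OF lx(1) l(1) lx(3) _ l(2,3,6)] ly(3) by simp
        then show False using lx False by blast
      qed
      have sin: "sect u a x \<in> join u l" "sect u a y \<in> join u l" using sx sy lx ly by blast+
      note k = plane_ln[OF pi sin ss]
      have ak: "co a p" "co b p" if "p \<in> ln (sect u a x) (sect u a y)" for p
        using ln_perp[OF k(5) ss sx(2) sy(2) that] ln_perp[OF k(5) ss _ _ that, of b] sx'(2) sy'(2) s by auto
      obtain w where w: "w \<in> ln u z" "w \<in> ln (sect u a x) (sect u a y)" using plane_meet[OF pi lz(1,4) k(1,4)] .
      show ?thesis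
        using sect_props(4)[OF o(1) cz zu w(1) ak(1)[OF w(2)]] sect_props(4)[OF o(2) cz zu w(1) ak(2)[OF w(2)]] by simp
    qed
    then show ?thesis using cz by blast
  qed
qed

section \<open>Action of collineations on subspaces and apartments\<close>

lemma collineation_bij: "collineation \<Delta> \<theta> \<Longrightarrow> bij \<theta>"
  unfolding collineation_def using permutes_bij by blast

lemma collineation_line: "collineation \<Delta> \<theta> \<Longrightarrow> l \<in> L \<Longrightarrow> \<theta> ` l \<in> L"
  unfolding collineation_def bij_betw_def by blast

lemma collineation_point: "collineation \<Delta> \<theta> \<Longrightarrow> x \<in> P \<Longrightarrow> \<theta> x \<in> P"
  unfolding collineation_def using permutes_in_image by metis

lemma collineation_inv_apply:
  assumes "collineation \<Delta> \<theta>"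
  shows "inv \<theta> (\<theta> x) = x" "\<theta> (inv \<theta> x) = x" "inv \<theta> ` \<theta> ` S = S" "\<theta> ` inv \<theta> ` S = S"
proof -
  have b: "bij \<theta>" using assms by (rule collineation_bij)
  show *: "inv \<theta> (\<theta> x) = x" "\<theta> (inv \<theta> x) = x" for x
    using inv_f_f[OF bij_is_inj[OF b]] surj_f_inv_f[OF bij_is_surj[OF b]] by auto
  show "inv \<theta> ` \<theta> ` S = S" "\<theta> ` inv \<theta> ` S = S" using * by (auto simp: image_image)
qed

lemma collineation_inv:
  assumes c: "collineation \<Delta> \<theta>" shows "collineation \<Delta> (inv \<theta>)"
proof -
  note i = collineation_inv_apply[OF c]
  have "inv \<theta> permutes P" using c permutes_inv unfolding collineation_def by blast
  moreover have inv_line: "inv \<theta> ` l \<in> L" if "l \<in> L" for l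
  proof -
    have "l \<in> (`) \<theta> ` L" using c that unfolding collineation_def bij_betw_def by blast
    then obtain k where "k \<in> L" "l = \<theta> ` k" by blast
    then show ?thesis using i by simp
  qed
  moreover have "bij_betw ((`) (inv \<theta>)) L L"
    by (rule bij_betwI[of _ _ _ "(`) \<theta>"]) (use inv_line collineation_line[OF c] i in auto)
  ultimately show ?thesis unfolding collineation_def by blast
qed

lemma collineation_co: assumes c: "collineation \<Delta> \<theta>" shows "co (\<theta> x) (\<theta> y) \<longleftrightarrow> co x y"
proof -
  have *: "co (\<theta> x) (\<theta> y)" if c: "collineation \<Delta> \<theta>" and xy: "co x y" for \<theta> x y
  proof (cases "x = y")
    case True then show ?thesis using co_refl collineation_point[OF c] co_P xy by blast
  next
    case False
    then show ?thesis using line_co[OF collineation_line[OF c]] ln_props[OF xy False] by blast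
  qed
  show ?thesis using *[OF c, of x y] *[OF collineation_inv[OF c], of "\<theta> x" "\<theta> y"]
      collineation_inv_apply[OF c] by auto
qed

lemma collineation_subspace:
  assumes c: "collineation \<Delta> \<theta>" and S: "subspace \<Delta> S" shows "subspace \<Delta> (\<theta> ` S)"
proof (rule subspaceI)
  show "\<theta> ` S \<subseteq> P" using S collineation_point[OF c] unfolding subspace_def by blast
next
  fix l x y z assume l: "l \<in> L" "x \<in> l" "y \<in> l" "x \<in> \<theta> ` S" "y \<in> \<theta> ` S" "x \<noteq> y" "z \<in> l"
  note i = collineation_inv_apply[OF c]
  have "inv \<theta> z \<in> S"
  proof (rule subspaceD[OF S collineation_line[OF collineation_inv[OF c] l(1)]])
    show "inv \<theta> x \<in> S" "inv \<theta> y \<in> S" using l i by auto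
    show "inv \<theta> x \<noteq> inv \<theta> y" using i(2) l(6) by metis
  qed (use l in blast)+
  then have "\<theta> (inv \<theta> z) \<in> \<theta> ` S" by (rule imageI)
  then show "z \<in> \<theta> ` S" using i by simp
qed

lemma collineation_sing:
  assumes "collineation \<Delta> \<theta>" "sing U" shows "sing (\<theta> ` U)"
  using collineation_subspace[OF assms(1)] collineation_co[OF assms(1)] assms(2)
  unfolding sing_iff clique_def by blast

lemma collineation_span:
  assumes c: "collineation \<Delta> \<theta>" and X: "X \<subseteq> P" shows "span \<Delta> (\<theta> ` X) = \<theta> ` span \<Delta> X"
proof
  have *: "span \<Delta> (\<theta> ` X) \<subseteq> \<theta> ` span \<Delta> X" if c: "collineation \<Delta> \<theta>" and X: "X \<subseteq> P" for \<theta> X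
    by (rule span_least[OF collineation_subspace[OF c span_is_subspace[OF X]] image_mono[OF span_subset]])
  show "span \<Delta> (\<theta> ` X) \<subseteq> \<theta> ` span \<Delta> X" by (rule *[OF c X])
  have "\<theta> ` X \<subseteq> P" using X collineation_point[OF c] by blast
  from *[OF collineation_inv[OF c] this]
  have "span \<Delta> X \<subseteq> inv \<theta> ` span \<Delta> (\<theta> ` X)" unfolding collineation_inv_apply[OF c] .
  then have "\<theta> ` span \<Delta> X \<subseteq> \<theta> ` inv \<theta> ` span \<Delta> (\<theta> ` X)" by (rule image_mono)
  then show "\<theta> ` span \<Delta> X \<subseteq> span \<Delta> (\<theta> ` X)" unfolding collineation_inv_apply[OF c] .
qed

lemma collineation_apartment:
  assumes c: "collineation \<Delta> \<theta>" and r: "r ` frame_index n \<subseteq> P"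
  shows "(`) \<theta> ` apartment \<Delta> n r = apartment \<Delta> n (\<theta> \<circ> r)"
proof
  have *: "(`) \<theta> ` apartment \<Delta> n r \<subseteq> apartment \<Delta> n (\<theta> \<circ> r)"
    if c: "collineation \<Delta> \<theta>" and r: "r ` frame_index n \<subseteq> P" for \<theta> r
  proof
    fix V assume "V \<in> (`) \<theta> ` apartment \<Delta> n r"
    then obtain X where X: "V = \<theta> ` span \<Delta> X" "sing (span \<Delta> X)" "X \<noteq> {}" "X \<subseteq> r ` frame_index n"
      unfolding apartment_def by blast
    have "V = span \<Delta> (\<theta> ` X)" using collineation_span[OF c] X r by blast
    moreover have "\<theta> ` X \<subseteq> (\<theta> \<circ> r) ` frame_index n" using X(4) unfolding image_comp[symmetric] by blast
    moreover have "sing V" using collineation_sing[OF c X(2)] X(1) by simp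
    moreover have "\<theta> ` X \<noteq> {}" using X(3) by simp
    ultimately have "sing V \<and> (\<exists>Y. Y \<noteq> {} \<and> Y \<subseteq> (\<theta> \<circ> r) ` frame_index n \<and> V = span \<Delta> Y)"
      by (intro conjI exI[of _ "\<theta> ` X"])
    then show "V \<in> apartment \<Delta> n (\<theta> \<circ> r)" unfolding apartment_def by simp
  qed
  show "(`) \<theta> ` apartment \<Delta> n r \<subseteq> apartment \<Delta> n (\<theta> \<circ> r)" by (rule *[OF c r])
  have "(\<theta> \<circ> r) ` frame_index n \<subseteq> P" using r collineation_point[OF c] by auto
  from *[OF collineation_inv[OF c] this]
  have sub: "(`) (inv \<theta>) ` apartment \<Delta> n (\<theta> \<circ> r) \<subseteq> apartment \<Delta> n r"
    using collineation_inv_apply(1)[OF c] by (simp add: comp_def)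
  show "apartment \<Delta> n (\<theta> \<circ> r) \<subseteq> (`) \<theta> ` apartment \<Delta> n r"
  proof
    fix V assume "V \<in> apartment \<Delta> n (\<theta> \<circ> r)"
    then have "inv \<theta> ` V \<in> apartment \<Delta> n r" using sub by blast
    moreover have "V = \<theta> ` inv \<theta> ` V" using collineation_inv_apply(4)[OF c] by simp
    ultimately show "V \<in> (`) \<theta> ` apartment \<Delta> n r" by blast
  qed
qed

lemma apartment_cong: "r ` frame_index n = q ` frame_index n \<Longrightarrow> apartment \<Delta> n r = apartment \<Delta> n q"
  unfolding apartment_def by simp

section \<open>Centers of collineations\<close>

definition center :: "('a \<Rightarrow> 'a) \<Rightarrow> 'a \<Rightarrow> bool" where
  "center \<theta> u \<longleftrightarrow> \<theta> u = u \<and> (\<forall>x. co u x \<longrightarrow> x \<noteq> u \<longrightarrow> \<theta> x \<in> ln u x)"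

lemma center_line:
  assumes c: "collineation \<Delta> \<theta>" and u: "\<theta> u = u" and x: "co u x" "x \<noteq> u" "\<theta> x \<in> ln u x"
  shows "\<theta> ` ln u x = ln u x"
proof -
  note l = ln_props[OF x(1) x(2)[symmetric]]
  have "\<theta> x \<noteq> u" using collineation_inv_apply(1)[OF c] u x(2) by metis
  moreover have "u \<in> \<theta> ` ln u x" "\<theta> x \<in> \<theta> ` ln u x" using l u by (metis imageI)+
  ultimately show ?thesis using line_unique[OF collineation_line[OF c l(1)] l(1) _ _ l(2) x(3)] by metis
qed

lemma center_stable:
  assumes c: "collineation \<Delta> \<theta>" and u: "center \<theta> u" and W: "sing W" "u \<in> W"
  shows "\<theta> ` W = W"
proof -
  have u': "\<theta> u = u" using u unfolding center_def by blast
  have *: "ln u x \<subseteq> W \<and> \<theta> ` ln u x = ln u x \<and> x \<in> ln u x" if x: "x \<in> W" "x \<noteq> u" for x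
  proof -
    have cx: "co u x" using sing_co[OF W x(1)] .
    show ?thesis
      using ln_sub[OF sing_subspace[OF W(1)] W(2) x(1) cx x(2)[symmetric]]
        center_line[OF c u' cx x(2)] u cx x(2) ln_props(3)[OF cx x(2)[symmetric]] unfolding center_def by blast
  qed
  show ?thesis
  proof
    show "\<theta> ` W \<subseteq> W"
    proof (rule image_subsetI)
      fix x assume x: "x \<in> W"
      show "\<theta> x \<in> W"
      proof (cases "x = u")
        case True then show ?thesis using u' W(2) by simp
      next
        case False
        then have "\<theta> x \<in> \<theta> ` ln u x" using *[OF x] by blast
        then show ?thesis using *[OF x False] by auto
      qed
    qed
    show "W \<subseteq> \<theta> ` W"
    proof
      fix x assume x: "x \<in> W"
      show "x \<in> \<theta> ` W"
      proof (cases "x = u")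
        case True then show ?thesis using u' W(2) by (metis imageI)
      next
        case False
        then have "x \<in> \<theta> ` ln u x" using *[OF x] by simp
        then show ?thesis using *[OF x False] by blast
      qed
    qed
  qed
qed

text \<open>The property of moving along the line through \<open>e\<close> holds at \<open>a\<close>
  and passes to collinear points of the cone of \<open>e\<close> outside that of \<open>u\<close>
  (\<open>step\<close>). Connectedness in a section carries it to all such points; the remaining
  points of the cone of \<open>e\<close> are fixed.\<close>

lemma second_center:
  assumes c: "collineation \<Delta> \<theta>" and ue: "co u e"
    and fixed: "\<And>x. co u x \<Longrightarrow> co e x \<Longrightarrow> \<theta> x = x"
    and a: "co e a" "\<not> co u a" "\<theta> a \<in> ln e a"
  shows "center \<theta> e"
proof -
  note i = collineation_inv_apply[OF c]
  have eu: "co e u" using co_sym[OF ue] .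
  have uP: "u \<in> P" "e \<in> P" using co_P ue by blast+
  have fe: "\<theta> e = e" using fixed[OF ue co_refl[OF uP(2)]] .
  have step: "\<theta> y' \<in> ln e y'"
    if y: "co e y" "\<not> co u y" "\<theta> y \<in> ln e y" and y': "co e y'" "\<not> co u y'" and yy': "co y y'" for y y'
  proof -
    have ne: "y \<noteq> e" "y' \<noteq> e" using y y' ue by blast+
    note l = ln_props[OF y(1) ne(1)[symmetric]] and l' = ln_props[OF y'(1) ne(2)[symmetric]]
    show ?thesis
    proof (cases "y' \<in> ln e y")
      case True
      then have "\<theta> y' \<in> ln e y" using center_line[OF c fe y(1) ne(1) y(3)] by blast
      then show ?thesis using ln_move[OF y(1) ne(1)[symmetric] True ne(2)] by simp
    next
      case False
      have y'l: "co y' p" if "p \<in> ln e y" for p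
        using ln_perp[OF y(1) ne(1)[symmetric] co_sym[OF y'(1)] co_sym[OF yy'] that] .
      note pi = planeI[OF l(1) False y'l]
      let ?\<pi> = "join y' (ln e y)"
      have in\<pi>: "y' \<in> ?\<pi>" "e \<in> ?\<pi>" "y \<in> ?\<pi>" "ln e y \<subseteq> ?\<pi>" using join_self join_base[OF False y'l] l by blast+
      have nyy': "y \<noteq> y'" using False l by blast
      note k = plane_ln[OF pi in\<pi>(3,1) nyy'] and h = plane_ln[OF pi in\<pi>(2,1) ne(2)[symmetric]]
      obtain d0 where d0: "d0 \<in> ln y y'" "co u d0" using perp_meets[OF uP(1) k(1)] by blast
      have ed0: "co e d0" using ln_perp[OF yy' nyy' y(1) y'(1) d0(1)] .
      have fd0: "\<theta> d0 = d0" using fixed[OF d0(2) ed0] .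
      have d0\<pi>: "d0 \<in> ?\<pi>" using d0 k by blast
      have d0n: "d0 \<notin> ln e y'"
      proof
        assume d0e: "d0 \<in> ln e y'"
        show False
        proof (cases "d0 = e")
          case True
          then have "ln y y' = ln e y" using line_unique[OF k(1) l(1) k(2) _ l(3,2) ne(1)] d0(1) by blast
          then show False using False k by blast
        next
          case ne0: False
          show False using perp_line[OF l'(1) l'(2) d0e ne0[symmetric] ue d0(2) l'(3)] y'(2) by blast
        qed
      qed
      have "\<theta> y \<in> ?\<pi>" using y(3) in\<pi> by blast
      moreover have "\<theta> y \<noteq> d0"
      proof
        assume "\<theta> y = d0"
        then have "y = d0" using i(1)[of y] i(1)[of d0] fd0 by simp
        then show False using d0 y by blast
      qed
      moreover have im: "\<theta> y \<in> \<theta> ` ln y y'" "d0 \<in> \<theta> ` ln y y'" "\<theta> y' \<in> \<theta> ` ln y y'"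
        using k d0 fd0 by (metis imageI)+
      ultimately have \<theta>\<pi>: "\<theta> y' \<in> ?\<pi>"
        using subspaceD[OF sing_subspace[OF plane_sing[OF pi]] collineation_line[OF c k(1)] im(1,2) _ d0\<pi> _ im(3)] by blast
      \<comment> \<open>The fixed point \<open>d0\<close> of \<open>y y'\<close> keeps the image of
        \<open>y'\<close> in the plane. To confine it to the line \<open>e y'\<close>,
        \<open>d\<close> is slid to a fixed point \<open>d'\<close> whose perp meets the plane
        exactly in that line.\<close>
      obtain d where d: "\<And>p. p \<in> ln e y' \<Longrightarrow> co d p" "opp d d0"
        using ex_perp_opp[OF line_sing[OF l'(1)] co_P(2)[OF ed0] d0n] by blast
      have yd: "co y' d" "co e d" using co_sym[OF d(1)[OF l'(3)]] co_sym[OF d(1)[OF l'(2)]] .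
      have d0y': "co d0 y'" using plane_co[OF pi d0\<pi> in\<pi>(1)] .
      have "y' \<noteq> d" using d(2) d0y' oppD(4) by blast
      moreover have "opp y' u" using y'(2) co_sym uP co_P[OF y'(1)] unfolding opp_def by blast
      ultimately obtain d' where d': "co u d'" "co y' d'" "\<And>q. co q y' \<Longrightarrow> co q d' \<longleftrightarrow> co q d"
        using proj[OF yd(1)] by metis
      have ed': "co e d'" using d'(3)[OF y'(1)] yd by blast
      have nd': "\<not> co d' d0" using d'(3)[OF d0y'] oppD(4)[OF d(2)] co_sym[of d' d0] by blast
      have "co (\<theta> d') (\<theta> y')" using collineation_co[OF c] co_sym[OF d'(2)] by blast
      then have "co d' (\<theta> y')" using fixed[OF d'(1) ed'] by simp
      moreover have "co d' p" if "p \<in> ln e y'" for p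
        using ln_perp[OF y'(1) ne(2)[symmetric] co_sym[OF ed'] co_sym[OF d'(2)] that] .
      ultimately show ?thesis
        using plane_perp_exact[OF pi h(1,4) _ d0\<pi> nd' \<theta>\<pi>] by blast
    qed
  qed
  obtain x' where x': "opp e x'" using ex_opp[OF uP(2)] by blast
  \<comment> \<open>Projection into the perp of one point \<open>x'\<close> opposite
    \<open>e\<close> brings all points into a single section, where
    \<open>complement_connected\<close> applies.\<close>
  have pr: "\<exists>y1. co e y1 \<and> co x' y1 \<and> \<not> co u y1 \<and> co y y1" if y: "co e y" "\<not> co u y" for y
  proof -
    have ne: "e \<noteq> y" using y ue by blast
    obtain y1 where y1: "y1 \<in> ln e y" "co x' y1" "co e y1" "\<And>q. co q e \<Longrightarrow> co q y1 \<longleftrightarrow> co q y"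
      using proj[OF y(1) ne x'] by metis
    have "\<not> co u y1" using y1(4)[OF ue] y(2) by blast
    moreover have "co y y1" using line_co ln_props[OF y(1) ne] y1(1) by blast
    ultimately show ?thesis using y1 by blast
  qed
  obtain a1 where a1: "co e a1" "co x' a1" "\<not> co u a1" "co a a1" using pr[OF a(1,2)] by blast
  have Qa1: "\<theta> a1 \<in> ln e a1" using step[OF a a1(1,3,4)] .
  have "\<theta> y \<in> ln e y" if y: "co e y" "y \<noteq> e" for y
  proof (cases "co u y")
    case True then show ?thesis using fixed[OF True y(1)] ln_props(3)[OF y(1)] y(2) by simp
  next
    case False
    obtain y1 where y1: "co e y1" "co x' y1" "\<not> co u y1" "co y y1" using pr[OF y(1) False] by blast
    obtain c1 c2 where p: "co a1 c1" "co c1 c2" "co c2 y1" "co e c1" "co x' c1" "co e c2" "co x' c2"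
      "\<not> co u c1" "\<not> co u c2"
      using complement_connected[OF x' uP(1) a1(3) y1(3) a1(1,2) y1(1,2)] by blast
    have "\<theta> c1 \<in> ln e c1" using step[OF a1(1,3) Qa1 p(4,8,1)] .
    then have "\<theta> c2 \<in> ln e c2" using step[OF p(4,8) _ p(6,9,2)] by blast
    then have "\<theta> y1 \<in> ln e y1" using step[OF p(6,9) _ y1(1,3) p(3)] by blast
    then show ?thesis using step[OF y1(1,3) _ y(1) False co_sym[OF y1(4)]] by blast
  qed
  then show ?thesis using fe unfolding center_def by blast
qed

section \<open>Frames and roots of both kinds\<close>

abbreviation "I \<equiv> frame_index n"

lemma finite_I: "finite I" unfolding frame_index_def by simp

lemma neg_I: "k \<in> I \<Longrightarrow> - k \<in> I" "k \<in> I \<Longrightarrow> k \<noteq> - k"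
  unfolding frame_index_def by auto

lemma frameD:
  assumes "polar_frame \<Delta> n p"
  shows "p ` I \<subseteq> P" "k \<in> I \<Longrightarrow> p k \<in> P" "inj_on p I"
    "k \<in> I \<Longrightarrow> m \<in> I \<Longrightarrow> co (p k) (p m) \<longleftrightarrow> k + m \<noteq> 0"
    "k \<in> I \<Longrightarrow> m \<in> I \<Longrightarrow> p k = p m \<longleftrightarrow> k = m"
  using assms unfolding polar_frame_def by (auto simp: inj_on_eq_iff)

lemma frame_card: "polar_frame \<Delta> n p \<Longrightarrow> card (p ` I) = card I"
  using frameD(3) card_image by blast

lemma frame_opp_unique:
  assumes "polar_frame \<Delta> n p" "x \<in> p ` I" "y \<in> p ` I" "z \<in> p ` I" "\<not> co x y" "\<not> co x z" shows "y = z"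
proof -
  obtain i j k where "i \<in> I" "j \<in> I" "k \<in> I" "x = p i" "y = p j" "z = p k" using assms(2-4) by blast
  moreover from this have "i + j = 0" "i + k = 0" using frameD(4)[OF assms(1)] assms(5,6) by auto
  then have "j = k" by simp
  ultimately show ?thesis by simp
qed

lemma frame_opp_ex:
  assumes "polar_frame \<Delta> n p" "x \<in> p ` I" obtains y where "y \<in> p ` I" "\<not> co x y"
proof -
  obtain i where "i \<in> I" "x = p i" using assms(2) by blast
  then show ?thesis using that[of "p (- i)"] frameD(4)[OF assms(1)] neg_I by simp
qed

text \<open>Otherwise the frame point opposite \<open>x\<close> would be collinear to all of
  \<open>X\<close>, hence to its span and to \<open>x\<close>.\<close>

lemma frame_span:
  assumes p: "polar_frame \<Delta> n p" and X: "X \<subseteq> p ` I" and x: "x \<in> p ` I" "x \<in> span \<Delta> X"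
  shows "x \<in> X"
proof (rule ccontr)
  assume n: "x \<notin> X"
  obtain y where y: "y \<in> p ` I" "\<not> co x y" using frame_opp_ex[OF p x(1)] .
  have "co y z" if "z \<in> X" for z
    using frame_opp_unique[OF p y(1) x(1), of z] that X n y(2) co_sym by blast
  moreover have "X \<subseteq> P" using X frameD(1)[OF p] by blast
  ultimately have "X \<subseteq> perps {y}" unfolding perps_def by blast
  then have "x \<in> perps {y}" using span_perps x(2) by blast
  then show False using y(2) co_sym unfolding perps_def by blast
qed

lemma span_point: "x \<in> P \<Longrightarrow> span \<Delta> {x} = {x}"
  using span_least[of "{x}" "{x}"] span_subset[of "{x}"] point_sing sing_subspace by blast

lemma span_pair: "co x y \<Longrightarrow> x \<noteq> y \<Longrightarrow> span \<Delta> {x, y} = ln x y"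
proof
  assume c: "co x y" "x \<noteq> y"
  note l = ln_props[OF c]
  show "span \<Delta> {x, y} \<subseteq> ln x y" by (rule span_least[OF sing_subspace[OF line_sing[OF l(1)]]]) (use l in simp)
  have "{x, y} \<subseteq> P" using co_P c by blast
  then show "ln x y \<subseteq> span \<Delta> {x, y}"
    using ln_sub[OF span_is_subspace _ _ c] span_subset[of "{x, y}"] by blast
qed

lemma apartment_point:
  assumes "polar_frame \<Delta> n p" shows "{x} \<in> apartment \<Delta> n p \<longleftrightarrow> x \<in> p ` I"
proof
  assume "{x} \<in> apartment \<Delta> n p"
  then obtain X where "X \<noteq> {}" "X \<subseteq> p ` I" "{x} = span \<Delta> X" unfolding apartment_def by blast
  moreover from this have "X \<subseteq> {x}" using span_subset[of X] by simp
  ultimately show "x \<in> p ` I" by blast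
next
  assume x: "x \<in> p ` I"
  then have "x \<in> P" using frameD(1)[OF assms] by blast
  then show "{x} \<in> apartment \<Delta> n p" unfolding apartment_def
    using x span_point point_sing by (auto intro!: exI[of _ "{x}"])
qed

text \<open>A singular subspace above a member of the interior contains a center and is therefore
  stable; one below it is fixed pointwise.\<close>

lemma root_group_moves:
  assumes c: "collineation \<Delta> \<theta>" and r: "polar_frame \<Delta> n r" and im: "\<theta> ` r ` I = q ` I"
    and fixed: "\<And>U x. U \<in> \<beta> \<Longrightarrow> x \<in> U \<Longrightarrow> \<theta> x = x"
    and cent: "\<And>U. U \<in> \<beta> \<Longrightarrow> \<exists>u\<in>U. center \<theta> u"
  shows "\<exists>g\<in>root_group \<Delta> \<beta>. (`) g ` apartment \<Delta> n r = apartment \<Delta> n q"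
proof (rule bexI[of _ \<theta>])
  show "(`) \<theta> ` apartment \<Delta> n r = apartment \<Delta> n q"
    unfolding collineation_apartment[OF c frameD(1)[OF r]]
    by (rule apartment_cong) (use im in \<open>simp add: image_comp\<close>)
  have "\<theta> ` W = W" if W: "sing W" and U: "U \<in> \<beta>" "U \<subseteq> W \<or> W \<subseteq> U" for W U
    using U(2)
  proof
    assume "U \<subseteq> W"
    then show ?thesis using cent[OF U(1)] center_stable[OF c _ W] by blast
  next
    assume "W \<subseteq> U"
    then have "\<theta> x = x" if "x \<in> W" for x using fixed[OF U(1)] that by blast
    then show ?thesis by simp
  qed
  then show "\<theta> \<in> root_group \<Delta> \<beta>" unfolding root_group_def using c fixed by blast
qed

text \<open>All points \<open>p k\<close> with \<open>k \<noteq> i\<close> survive in the root, so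
  the frame \<open>r\<close> has one new point \<open>a\<close>. Opposition matches the points of a
  frame in pairs, and \<open>p (- i)\<close> is the only old point without a partner.\<close>

lemma root1_point:
  assumes p: "polar_frame \<Delta> n p" and r: "polar_frame \<Delta> n r" and i: "i \<in> I"
    and sub: "root1 \<Delta> n p i \<subseteq> apartment \<Delta> n r"
  obtains a where "r ` I = insert a (p ` (I - {i}))" "opp (p (- i)) a"
    "\<And>k. k \<in> I \<Longrightarrow> k \<noteq> i \<Longrightarrow> k \<noteq> - i \<Longrightarrow> co a (p k)"
proof -
  let ?F = "p ` (I - {i})"
  have Fr: "?F \<subseteq> r ` I"
  proof
    fix x assume x: "x \<in> ?F"
    then have "x \<noteq> p i" using frameD(5)[OF p] i by auto
    then have "{x} \<in> root1 \<Delta> n p i" unfolding root1_def using apartment_point[OF p] x by blast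
    then show "x \<in> r ` I" using sub apartment_point[OF r] by blast
  qed
  have "card ?F = card I - 1" using card_image[OF inj_on_subset[OF frameD(3)[OF p]], of "I - {i}"] i finite_I by simp
  then have "card (r ` I - ?F) = card I - (card I - 1)"
    using card_Diff_subset[OF _ Fr] frame_card[OF r] finite_I by simp
  moreover have "card I > 0" using i finite_I card_gt_0_iff by blast
  ultimately have "card (r ` I - ?F) = 1" by simp
  then obtain a where a: "r ` I - ?F = {a}" by (rule card_1_singletonE)
  then have aF: "a \<notin> ?F" "a \<in> r ` I" "r ` I = insert a ?F" using Fr by blast+
  have ni: "- i \<in> I - {i}" using neg_I[OF i] by auto
  have co: "co a (p k)" if k: "k \<in> I" "k \<noteq> i" "k \<noteq> - i" for k
  proof (rule ccontr)
    assume n: "\<not> co a (p k)"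
    have k': "- k \<in> I - {i}" "k \<in> I - {i}" using k neg_I by auto
    then have "p (- k) \<in> r ` I" "p k \<in> r ` I" using Fr by blast+
    moreover have "\<not> co (p k) (p (- k))" using frameD(4)[OF p k(1)] neg_I k by simp
    ultimately have "a = p (- k)" using frame_opp_unique[OF r _ aF(2)] n co_sym by blast
    then show False using aF k' by blast
  qed
  obtain y where y: "y \<in> r ` I" "\<not> co a y" using frame_opp_ex[OF r aF(2)] .
  have "a \<in> P" using aF frameD(1)[OF r] by blast
  then have "y \<noteq> a" using y co_refl by blast
  then obtain k where "k \<in> I" "k \<noteq> i" "y = p k" using y aF by blast
  then have "y = p (- i)" using co y(2) by blast
  then have "opp (p (- i)) a" using y(2) co_sym \<open>a \<in> P\<close> frameD(2)[OF p] ni unfolding opp_def by blast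
  then show ?thesis using that aF co by blast
qed

lemma moufang_root1:
  assumes p: "polar_frame \<Delta> n p" and i: "i \<in> I"
    and r: "polar_frame \<Delta> n r" "root1 \<Delta> n p i \<subseteq> apartment \<Delta> n r"
    and q: "polar_frame \<Delta> n q" "root1 \<Delta> n p i \<subseteq> apartment \<Delta> n q"
  shows "\<exists>g\<in>root_group \<Delta> (interior1 \<Delta> n p i). (`) g ` apartment \<Delta> n r = apartment \<Delta> n q"
proof -
  obtain a where a: "r ` I = insert a (p ` (I - {i}))" "opp (p (- i)) a"
    "\<And>k. k \<in> I \<Longrightarrow> k \<noteq> i \<Longrightarrow> k \<noteq> - i \<Longrightarrow> co a (p k)" using root1_point[OF p r(1) i r(2)] by blast
  obtain b where b: "q ` I = insert b (p ` (I - {i}))" "opp (p (- i)) b"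
    "\<And>k. k \<in> I \<Longrightarrow> k \<noteq> i \<Longrightarrow> k \<noteq> - i \<Longrightarrow> co b (p k)" using root1_point[OF p q(1) i q(2)] by blast
  let ?u = "p (- i)"
  obtain \<theta> where t: "collineation \<Delta> \<theta>" "\<theta> a = b" "\<theta> ?u = ?u"
    "\<And>x. co ?u x \<Longrightarrow> x \<noteq> ?u \<Longrightarrow> \<theta> x \<in> ln ?u x"
    "\<And>x. co ?u x \<Longrightarrow> x \<noteq> ?u \<Longrightarrow> sect ?u a x = sect ?u b x \<Longrightarrow> \<theta> x = x"
    using ex_central_collineation[OF a(2) b(2)] by blast
  let ?F = "{x. co ?u x \<and> (x = ?u \<or> sect ?u a x = sect ?u b x)}"
  note ni = neg_I[OF i]
  have F: "p k \<in> ?F" if k: "k \<in> I" "k \<noteq> i" for k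
  proof -
    have c: "co ?u (p k)" using frameD(4)[OF p ni(1) k(1)] k(2) by simp
    show ?thesis
    proof (cases "p k = ?u")
      case True then show ?thesis using c by simp
    next
      case False
      then have "k \<noteq> - i" by blast
      then have "co a (p k)" "co b (p k)" using a(3) b(3) k by blast+
      then have "p k = sect ?u a (p k)" "p k = sect ?u b (p k)"
        using sect_props(4)[OF a(2) c False] sect_props(4)[OF b(2) c False] ln_props(3)[OF c False[symmetric]] by blast+
      then show ?thesis using c by simp
    qed
  qed
  have fixF: "\<theta> x = x" if "x \<in> ?F" for x using t(3,5) that by blast
  have cent: "center \<theta> ?u" unfolding center_def using t by blast
  have im: "\<theta> ` r ` I = q ` I"
  proof -
    have "\<theta> ` p ` (I - {i}) = p ` (I - {i})" using F fixF by (auto simp: image_image)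
    then show ?thesis unfolding a(1) b(1) using t(2) by simp
  qed
  have sub: "U \<subseteq> ?F" if "U \<in> interior1 \<Delta> n p i" for U
  proof -
    have U: "U \<in> apartment \<Delta> n p" "?u \<in> U" using that unfolding interior1_def by simp_all
    then obtain X where X: "X \<subseteq> p ` I" "U = span \<Delta> X" "sing U" "?u \<in> U"
      unfolding apartment_def by blast
    have "p i \<notin> X"
      using sing_co[OF X(3,4), of "p i"] frameD(4)[OF p ni(1) i] span_subset[of X] X(2) by auto
    then have "X \<subseteq> ?F" using X(1) F by blast
    then show ?thesis using span_least[OF fixed_section_subspace[OF a(2) b(2)]] X(2) by blast
  qed
  show ?thesis
  proof (rule root_group_moves[OF t(1) r(1) im])
    show "\<theta> x = x" if "U \<in> interior1 \<Delta> n p i" "x \<in> U" for U x using sub fixF that by blast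
    show "\<exists>u\<in>U. center \<theta> u" if "U \<in> interior1 \<Delta> n p i" for U using that cent unfolding interior1_def by blast
  qed
qed

lemma frame_line:
  assumes p: "polar_frame \<Delta> n p" and k: "k \<in> I" "m \<in> I" "k \<noteq> m" "k + m \<noteq> 0"
  shows "ln (p k) (p m) \<in> L" "p k \<in> ln (p k) (p m)" "p m \<in> ln (p k) (p m)" "co (p k) (p m)" "p k \<noteq> p m"
proof -
  show *: "co (p k) (p m)" "p k \<noteq> p m" using frameD(4,5)[OF p k(1,2)] k(3,4) by auto
  show "ln (p k) (p m) \<in> L" "p k \<in> ln (p k) (p m)" "p m \<in> ln (p k) (p m)" using ln_props[OF *] by auto
qed

text \<open>This line stays in the root because no singular subspace contains it together with
  \<open>p j\<close>. It records where the frame point that replaces \<open>p i\<close> has to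
  lie.\<close>

lemma root2_line:
  assumes p: "polar_frame \<Delta> n p" and ij: "i \<in> I" "j \<in> I" "i \<noteq> j" "i + j \<noteq> 0"
  shows "ln (p i) (p (- j)) \<in> root2 \<Delta> n p i j" "ln (p i) (p (- j)) \<in> root2 \<Delta> n p j i"
proof -
  note l = frame_line[OF p ij(1) neg_I(1)[OF ij(2)]]
  have k: "i \<noteq> - j" "i + - j \<noteq> 0" using ij by auto
  have "ln (p i) (p (- j)) \<in> apartment \<Delta> n p"
    unfolding apartment_def using line_sing l[OF k] span_pair[OF l(4)[OF k] l(5)[OF k]] ij neg_I
    by (auto intro!: exI[of _ "{p i, p (- j)}"])
  moreover have "\<not> (\<exists>M. maximal_member (apartment \<Delta> n p) M \<and> p j \<in> M \<and> ln (p i) (p (- j)) \<subseteq> M)"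
  proof
    assume "\<exists>M. maximal_member (apartment \<Delta> n p) M \<and> p j \<in> M \<and> ln (p i) (p (- j)) \<subseteq> M"
    then obtain M where M: "M \<in> apartment \<Delta> n p" "p j \<in> M" "ln (p i) (p (- j)) \<subseteq> M"
      unfolding maximal_member_def by blast
    then have "co (p j) (p (- j))" using sing_co[of M] l(3)[OF k] unfolding apartment_def by blast
    then show False using frameD(4)[OF p ij(2) neg_I(1)[OF ij(2)]] by simp
  qed
  ultimately show "ln (p i) (p (- j)) \<in> root2 \<Delta> n p i j" "ln (p i) (p (- j)) \<in> root2 \<Delta> n p j i"
    unfolding root2_def by blast+
qed

lemma root2_commute: "root2 \<Delta> n p i j = root2 \<Delta> n p j i"
  unfolding root2_def by blast

text \<open>The line of \<open>root2_line\<close> also belongs to the second apartment, so frame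
  points of \<open>r\<close> span it. One of them is \<open>p (- j)\<close>, and a further one is
  the new point \<open>a\<close>.\<close>

lemma root2_new_point:
  assumes p: "polar_frame \<Delta> n p" and r: "polar_frame \<Delta> n r" and ij: "i \<in> I" "j \<in> I" "i \<noteq> j" "i + j \<noteq> 0"
    and sub: "root2 \<Delta> n p i j \<subseteq> apartment \<Delta> n r"
  shows "p ` (I - {i, j}) \<subseteq> r ` I"
    "\<exists>a. a \<in> r ` I \<and> a \<in> ln (p i) (p (- j)) \<and> a \<noteq> p (- j) \<and> a \<notin> p ` (I - {i, j}) \<and> opp (p (- i)) a"
proof -
  show Fr: "p ` (I - {i, j}) \<subseteq> r ` I"
  proof
    fix x assume x: "x \<in> p ` (I - {i, j})"
    then have "x \<noteq> p i" "x \<noteq> p j" using frameD(5)[OF p] ij by auto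
    then have "{x} \<in> root2 \<Delta> n p i j" unfolding root2_def using apartment_point[OF p] x by blast
    then show "x \<in> r ` I" using sub apartment_point[OF r] by blast
  qed
  note nj = neg_I[OF ij(2)] and ni = neg_I[OF ij(1)]
  have nji: "- j \<noteq> i" "i \<noteq> - j" "i + - j \<noteq> 0" using ij by auto
  note l = frame_line[OF p ij(1) nj(1) nji(2,3)]
  obtain X where X: "X \<subseteq> r ` I" "ln (p i) (p (- j)) = span \<Delta> X"
    using root2_line(1)[OF p ij] sub unfolding apartment_def by blast
  have "- j \<in> I - {i, j}" using nj nji(1) by auto
  then have e: "p (- j) \<in> r ` I" using Fr by blast
  then have eX: "p (- j) \<in> X" using frame_span[OF r X(1)] X(2) l(3) by simp
  have "X \<noteq> {p (- j)}"
  proof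
    assume "X = {p (- j)}"
    then have "ln (p i) (p (- j)) = {p (- j)}" using X(2) span_point[OF frameD(2)[OF p nj(1)]] by simp
    then show False using l(2,5) by blast
  qed
  then obtain a where a: "a \<in> X" "a \<noteq> p (- j)" using eX by blast
  have al: "a \<in> ln (p i) (p (- j))" using a(1) span_subset[of X] X(2) by blast
  have "a \<notin> p ` (I - {i, j})"
  proof
    assume "a \<in> p ` (I - {i, j})"
    then obtain k where k: "k \<in> I" "k \<noteq> i" "a = p k" by blast
    have "p k \<in> {p i, p (- j)}"
      by (rule frame_span[OF p]) (use k al ij nj span_pair[OF l(4,5)] in auto)
    then show False using a(2) k frameD(5)[OF p k(1) ij(1)] by auto
  qed
  moreover have "opp (p (- i)) a"
  proof -
    have "\<not> co (p (- i)) a"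
    proof
      assume c: "co (p (- i)) a"
      have "co (p (- i)) (p (- j))" using frameD(4)[OF p ni(1) nj(1)] ij(4) by simp
      then have "co (p (- i)) (p i)" using perp_line[OF l(1) al l(3) a(2) c _ l(2)] by blast
      then show False using frameD(4)[OF p ni(1) ij(1)] by simp
    qed
    moreover have "a \<in> P" using a X frameD(1)[OF r] by blast
    ultimately show ?thesis using frameD(2)[OF p ni(1)] unfolding opp_def by blast
  qed
  ultimately show "\<exists>a. a \<in> r ` I \<and> a \<in> ln (p i) (p (- j)) \<and> a \<noteq> p (- j) \<and> a \<notin> p ` (I - {i, j}) \<and> opp (p (- i)) a"
    using a al X by blast
qed

text \<open>The pairs \<open>(i, j)\<close> and \<open>(j, i)\<close> give one new point each, and
  counting excludes others. These two are collinear because the only point of the frame opposite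
  \<open>a\<close> is \<open>p (- i)\<close>.\<close>

lemma root2_points:
  assumes p: "polar_frame \<Delta> n p" and r: "polar_frame \<Delta> n r" and ij: "i \<in> I" "j \<in> I" "i \<noteq> j" "i + j \<noteq> 0"
    and sub: "root2 \<Delta> n p i j \<subseteq> apartment \<Delta> n r"
  obtains a a' where "r ` I = insert a (insert a' (p ` (I - {i, j})))"
    "a \<in> ln (p i) (p (- j))" "a \<noteq> p (- j)" "opp (p (- i)) a"
    "a' \<in> ln (p j) (p (- i))" "a' \<noteq> p (- i)" "co a a'"
proof -
  have ji: "j \<noteq> i" "j + i \<noteq> 0" using ij by auto
  let ?F = "p ` (I - {i, j})"
  note n1 = root2_new_point[OF p r ij sub]
  note n2 = root2_new_point[OF p r ij(2,1) ji sub[unfolded root2_commute[of p i j]]]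
  obtain a where a: "a \<in> r ` I" "a \<in> ln (p i) (p (- j))" "a \<noteq> p (- j)" "a \<notin> ?F" "opp (p (- i)) a"
    using n1(2) by blast
  obtain a' where a': "a' \<in> r ` I" "a' \<in> ln (p j) (p (- i))" "a' \<noteq> p (- i)" "a' \<notin> ?F" "opp (p (- j)) a'"
    using n2(2) by (auto simp: insert_commute)
  note nj = neg_I[OF ij(2)] and ni = neg_I[OF ij(1)]
  have nji: "i \<noteq> - j" "i + - j \<noteq> 0" "- i \<noteq> j" using ij by auto
  note l = frame_line[OF p ij(1) nj(1) nji(1,2)]
  have "co (p (- j)) a" using line_co l a by blast
  then have aa': "a \<noteq> a'" using oppD(3)[OF a'(5)] by blast
  have "card ?F = card I - 2"
    using card_image[OF inj_on_subset[OF frameD(3)[OF p]], of "I - {i, j}"] ij finite_I by simp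
  moreover have "card {i, j} \<le> card I" using ij finite_I by (intro card_mono) auto
  ultimately have "card (insert a (insert a' ?F)) = card I" using a(4) a'(4) aa' finite_I ij(3) by simp
  moreover have "insert a (insert a' ?F) \<subseteq> r ` I" using n1(1) a a' by blast
  ultimately have eq: "insert a (insert a' ?F) = r ` I"
    using card_subset_eq[of "r ` I"] frame_card[OF r] finite_I by simp
  have "- i \<in> I - {i, j}" using ni nji(3) by auto
  then have "p (- i) \<in> r ` I" using n1(1) by blast
  then have "co a a'" using frame_opp_unique[OF r a(1) _ a'(1)] oppD(4)[OF a(5)] a'(3) by blast
  then show ?thesis using that a a' eq by metis
qed

text \<open>A member of the interior contains \<open>p (- i)\<close> or \<open>p (- j)\<close>, so
  both have to be centers. The second new point takes care of itself: \<open>b'\<close> is the only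
  point of the line \<open>p j p (- i)\<close> collinear to \<open>b\<close>, so it is the image of
  \<open>a'\<close>.\<close>

lemma moufang_root2:
  assumes p: "polar_frame \<Delta> n p" and ij: "i \<in> I" "j \<in> I" "i \<noteq> j" "i + j \<noteq> 0"
    and r: "polar_frame \<Delta> n r" "root2 \<Delta> n p i j \<subseteq> apartment \<Delta> n r"
    and q: "polar_frame \<Delta> n q" "root2 \<Delta> n p i j \<subseteq> apartment \<Delta> n q"
  shows "\<exists>g\<in>root_group \<Delta> (interior2 \<Delta> n p i j). (`) g ` apartment \<Delta> n r = apartment \<Delta> n q"
proof -
  let ?u = "p (- i)" and ?e = "p (- j)"
  obtain a a' where a: "r ` I = insert a (insert a' (p ` (I - {i, j})))"
    "a \<in> ln (p i) ?e" "a \<noteq> ?e" "opp ?u a" "a' \<in> ln (p j) ?u" "a' \<noteq> ?u" "co a a'"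
    using root2_points[OF p r(1) ij r(2)] by metis
  obtain b b' where b: "q ` I = insert b (insert b' (p ` (I - {i, j})))"
    "b \<in> ln (p i) ?e" "b \<noteq> ?e" "opp ?u b" "b' \<in> ln (p j) ?u" "b' \<noteq> ?u" "co b b'"
    using root2_points[OF p q(1) ij q(2)] by metis
  obtain \<theta> where t: "collineation \<Delta> \<theta>" "\<theta> a = b" "\<theta> ?u = ?u"
    "\<And>x. co ?u x \<Longrightarrow> x \<noteq> ?u \<Longrightarrow> \<theta> x \<in> ln ?u x"
    "\<And>x. co ?u x \<Longrightarrow> x \<noteq> ?u \<Longrightarrow> sect ?u a x = sect ?u b x \<Longrightarrow> \<theta> x = x"
    using ex_central_collineation[OF a(4) b(4)] by blast
  note nj = neg_I[OF ij(2)] and ni = neg_I[OF ij(1)]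
  have nji: "i \<noteq> - j" "i + - j \<noteq> 0" "j \<noteq> - i" "j + - i \<noteq> 0" using ij by auto
  note l = frame_line[OF p ij(1) nj(1) nji(1,2)] and m = frame_line[OF p ij(2) ni(1) nji(3,4)]
  have ue: "co ?u ?e" using frameD(4)[OF p ni(1) nj(1)] ij(4) by simp
  \<comment> \<open>The section point of \<open>a\<close> on the line \<open>u x\<close> is
    collinear to \<open>e\<close> and \<open>a\<close>, hence to \<open>b\<close> on the line
    \<open>e a\<close>; so it is the section point of \<open>b\<close> as well.\<close>
  have fixed: "\<theta> x = x" if x: "co ?u x" "co ?e x" for x
  proof (cases "x = ?u")
    case True then show ?thesis using t(3) by simp
  next
    case False
    note s = sect_props[OF a(4) x(1) False]
    have "co ?e (sect ?u a x)" using ln_perp[OF x(1) False[symmetric] co_sym[OF ue] x(2) s(1)] .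
    then have "co b (sect ?u a x)"
      using perp_line[OF l(1) a(2) l(3) a(3) co_sym[OF s(2)] co_sym b(2)] co_sym by blast
    then have "sect ?u a x = sect ?u b x" using sect_props(4)[OF b(4) x(1) False s(1)] by blast
    then show ?thesis using t(5)[OF x(1) False] by blast
  qed
  have F: "co ?u (p k)" "co ?e (p k)" if k: "k \<in> I" "k \<noteq> i" "k \<noteq> j" for k
    using frameD(4)[OF p ni(1) k(1)] frameD(4)[OF p nj(1) k(1)] k by auto
  have cu: "center \<theta> ?u" unfolding center_def using t by blast
  have ea: "co ?e a" using line_co[OF l(1,3) a(2)] .
  have "ln ?e a = ln (p i) ?e" using ln_eq[OF l(1,3) a(2)] a(3) by blast
  then have ce: "center \<theta> ?e"
    using second_center[OF t(1) ue fixed ea oppD(3)[OF a(4)]] b(2) t(2) by simp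
  have a'b': "\<theta> a' = b'"
  proof -
    have ua': "co ?u a'" using line_co[OF m(1,3) a(5)] .
    have "ln ?u a' = ln (p j) ?u" using ln_eq[OF m(1,3) a(5)] a(6) by blast
    then have "\<theta> a' \<in> ln (p j) ?u" using t(4)[OF ua' a(6)] by simp
    moreover have "co b (\<theta> a')" using collineation_co[OF t(1), of a a'] a(7) t(2) by simp
    ultimately show ?thesis using line_opp_unique[OF m(1,3) oppD(4)[OF b(4)] _ b(5) _ b(7)] by blast
  qed
  have im: "\<theta> ` r ` I = q ` I"
  proof -
    have "\<theta> ` p ` (I - {i, j}) = p ` (I - {i, j})" using F fixed by (auto simp: image_image)
    then show ?thesis unfolding a(1) b(1) using t(2) a'b' by simp
  qed
  have sub: "co ?u x \<and> co ?e x" if U: "U \<in> interior2 \<Delta> n p i j" and x: "x \<in> U" for U x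
  proof -
    obtain X where X: "X \<subseteq> p ` I" "U = span \<Delta> X" "p i \<notin> U" "p j \<notin> U"
      using U unfolding interior2_def apartment_def by blast
    have "X \<subseteq> perps {?u, ?e}"
    proof
      fix y assume y: "y \<in> X"
      then obtain k where k: "k \<in> I" "y = p k" using X(1) by blast
      have "k \<noteq> i" "k \<noteq> j" using y k X span_subset[of X] by blast+
      then show "y \<in> perps {?u, ?e}" using F k frameD(2)[OF p k(1)] unfolding perps_def by blast
    qed
    then have "x \<in> perps {?u, ?e}" using span_perps X(2) x by blast
    then show ?thesis unfolding perps_def by blast
  qed
  show ?thesis
  proof (rule root_group_moves[OF t(1) r(1) im])
    show "\<theta> x = x" if "U \<in> interior2 \<Delta> n p i j" "x \<in> U" for U x using sub[OF that] fixed by blast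
    show "\<exists>u\<in>U. center \<theta> u" if "U \<in> interior2 \<Delta> n p i j" for U
      using that cu ce unfolding interior2_def by blast
  qed
qed

theorem is_moufang: "moufang \<Delta> n"
  unfolding moufang_def
proof (intro allI impI ballI)
  fix \<alpha> \<beta> A B
  assume root: "root_with_interior \<Delta> n \<alpha> \<beta>" and A: "A \<in> apartments \<Delta> n" and B: "B \<in> apartments \<Delta> n"
    and sub: "\<alpha> \<subseteq> A \<and> \<alpha> \<subseteq> B"
  obtain r where r: "polar_frame \<Delta> n r" "A = apartment \<Delta> n r" using A unfolding apartments_def by blast
  obtain q where q: "polar_frame \<Delta> n q" "B = apartment \<Delta> n q" using B unfolding apartments_def by blast
  obtain p where p: "polar_frame \<Delta> n p" and
    "(\<exists>i\<in>I. \<alpha> = root1 \<Delta> n p i \<and> \<beta> = interior1 \<Delta> n p i) \<or>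
     (\<exists>i\<in>I. \<exists>j\<in>I. p i \<noteq> p j \<and> co (p i) (p j) \<and> \<alpha> = root2 \<Delta> n p i j \<and> \<beta> = interior2 \<Delta> n p i j)"
    using root unfolding root_with_interior_def by blast
  then show "\<exists>g\<in>root_group \<Delta> \<beta>. (`) g ` A = B"
  proof (elim disjE bexE conjE)
    fix i assume "i \<in> I" "\<alpha> = root1 \<Delta> n p i" "\<beta> = interior1 \<Delta> n p i"
    then show ?thesis using moufang_root1[OF p] r q sub by blast
  next
    fix i j assume *: "i \<in> I" "j \<in> I" "p i \<noteq> p j" "co (p i) (p j)" "\<alpha> = root2 \<Delta> n p i j" "\<beta> = interior2 \<Delta> n p i j"
    then have "i \<noteq> j" "i + j \<noteq> 0" using frameD(4)[OF p *(1,2)] by auto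
    then show ?thesis using moufang_root2[OF p *(1,2)] r q sub * by blast
  qed
qed

end

theorem corollary5p9:
  fixes \<Delta> :: "'a geometry" and n :: nat
  assumes "polar_space \<Delta>" and "has_rank \<Delta> n" and "thick \<Delta> n" and "n \<ge> 3"
  shows "moufang \<Delta> n"
  using thick_polar_space.is_moufang[OF thick_polar_space.intro[OF assms]] .

end
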